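(* (i) Let $n\ge 3$ be an odd integer, $k=\frac{n-3}{2}$ and $\alpha=\frac{n-2}{2}$. Let $g\in C_c^\infty((0,2))$ and put $h(t)=t^{n-2}g(t)$. Then the following two conditions are equivalent: (a) $[\mathcal{L}_k h](1-t)=[\mathcal{L}_k h](1+t)$ for all $t\in[0,1]$; (b) for every $0<t<1$, $$\int_0^{1-t}\frac{u\,h(u)}{u^{2\alpha}}\left\{\left[(1+u)^2-t^2\right]\left[(1-u)^2-t^2\right]\right\}^{\alpha-\frac12}du=\int_{1+t}^{2}\frac{u\,h(u)}{u^{2\alpha}}\left\{\left[(1+u)^2-t^2\right]\left[(1-u)^2-t^2\right]\right\}^{\alpha-\frac12}du .$$ (ii) Hence the following range characterization is valid in all dimensions: for every integer $n\ge 2$ (even or odd), with $\alpha=\frac{n-2}{2}$ and $\mathbb{B}$ the unit ball in $\mathbb{R}^n$, a function $g\in C_c^\infty((0,2))$ is representable as $g=\mathcal{R}f$ for a radial function $f\in C_c^\infty(\mathbb{B})$ if and only if $h(t)=t^{n-2}g(t)$ satisfies the integral identity in (b) for every $0<t<1$.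
   Context: $\mathbb{B}$ is the open unit ball in $\mathbb{R}^n$ and $\mathbb{S}^{n-1}$ the unit sphere. The spherical mean transform of $f\in C_c^\infty(\mathbb{B})$ (extended by zero to $\mathbb{R}^n$) is $$\mathcal{R}f(p,t)=\frac{1}{|\mathbb{S}^{n-1}|}\int_{\mathbb{S}^{n-1}}f(p+t\theta)\,dS(\theta),\qquad (p,t)\in\mathbb{S}^{n-1}\times(0,2),$$ where $|\mathbb{S}^{n-1}|$ is the surface area of the unit sphere and $dS$ the surface measure. For radial $f$, $\mathcal{R}f(p,t)$ does not depend on $p$, and $g=\mathcal{R}f$ means $g(t)=\mathcal{R}f(p,t)$ for all $(p,t)$. For an integer $k\ge 0$, $\mathcal{L}_k$ is the linear differential operator of order $k$ $$\mathcal{L}_k=\sum_{l=0}^k\frac{(k+l)!}{(k-l)!\,l!\,2^l}(1-t)^{k-l}D^{k-l},\qquad D=\frac1t\frac{d}{dt},\quad D^0=\mathrm{id},$$ and $[\mathcal{L}_kh](s)$ denotes the value of the function $\mathcal{L}_kh$ at the point $s$, i.e. $[\mathcal{L}_kh](s)=\sum_{l=0}^k\frac{(k+l)!}{(k-l)!\,l!\,2^l}(1-s)^{k-l}(D^{k-l}h)(s)$. Functions in $C_c^\infty((0,2))$ are extended by zero, so $\mathcal{L}_kh$ vanishes near the endpoints $0$ and $2$. *)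

theory Defs
  imports "HOL-Analysis.Analysis"
begin

section \<open>Smooth functions with compact support\<close>

fun C_k :: "nat \<Rightarrow> ('a::euclidean_space \<Rightarrow> real) \<Rightarrow> bool" where
  "C_k 0 f \<longleftrightarrow> continuous_on UNIV f"
| "C_k (Suc k) f \<longleftrightarrow> (\<forall>x. f differentiable at x) \<and>
     (\<forall>v. C_k k (\<lambda>x. frechet_derivative f (at x) v))"

definition smooth :: "('a::euclidean_space \<Rightarrow> real) \<Rightarrow> bool" where
  "smooth f \<longleftrightarrow> (\<forall>k. C_k k f)"

text \<open>
  Elements of \<open>C\<^sub>c\<^sup>\<infinity>(U)\<close>, for open \<open>U\<close>, are represented by their extensions by zero to the
  whole space.
\<close>

definition test_function_on :: "'a::euclidean_space set \<Rightarrow> ('a \<Rightarrow> real) \<Rightarrow> bool" where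
  "test_function_on U f \<longleftrightarrow> smooth f \<and>
     compact (closure {x. f x \<noteq> 0}) \<and> closure {x. f x \<noteq> 0} \<subseteq> U"

definition radial :: "('a::euclidean_space \<Rightarrow> real) \<Rightarrow> bool" where
  "radial f \<longleftrightarrow> (\<forall>x y. norm x = norm y \<longrightarrow> f x = f y)"

section \<open>The spherical mean transform\<close>

text \<open>
  The surface measure of the unit sphere in dimension \<open>n\<close> is the cone measure: a Borel set
  \<open>A\<close> of directions gets \<open>n\<close> times the volume of \<open>{r \<theta> | 0 < r < 1, \<theta> \<in> A}\<close>.
\<close>

definition surface_measure :: "'a::euclidean_space measure" where
  "surface_measure = scale_measure (of_nat DIM('a))
     (distr (restrict_space lborel (ball 0 1 - {0})) (restrict_space borel (sphere 0 1))
       (\<lambda>x. x /\<^sub>R norm x))"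

definition spherical_mean :: "('a::euclidean_space \<Rightarrow> real) \<Rightarrow> 'a \<Rightarrow> real \<Rightarrow> real" where
  "spherical_mean f p t =
     1 / measure (surface_measure :: 'a measure) (sphere 0 1) *
     (\<integral>\<theta>. f (p + t *\<^sub>R \<theta>) \<partial>surface_measure)"

lemma emeasure_surface_measure:
  fixes A :: "'a::euclidean_space set"
  assumes "A \<in> sets borel" "A \<subseteq> sphere 0 1"
  shows "emeasure surface_measure A =
    of_nat DIM('a) * emeasure lborel {x \<in> ball 0 1 - {0}. x /\<^sub>R norm x \<in> A}"
proof -
  let ?B = "ball 0 1 - {0::'a}"
  have B: "?B \<in> sets borel"
    by simp
  have "(\<lambda>x::'a. x /\<^sub>R norm x) \<in> borel_measurable borel"
    by measurable
  then have "(\<lambda>x::'a. x /\<^sub>R norm x) \<in> measurable (restrict_space lborel ?B) borel"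
    by (intro measurable_restrict_space1) simp
  then have meas: "(\<lambda>x::'a. x /\<^sub>R norm x) \<in>
      measurable (restrict_space lborel ?B) (restrict_space borel (sphere 0 1))"
    by (intro measurable_restrict_space2) (auto simp: space_restrict_space)
  have A: "A \<in> sets (restrict_space borel (sphere 0 1))"
    using assms by (subst sets_restrict_space_iff) auto
  have vimage: "(\<lambda>x. x /\<^sub>R norm x) -` A \<inter> space (restrict_space lborel ?B) =
      {x \<in> ?B. x /\<^sub>R norm x \<in> A}"
    by (auto simp: space_restrict_space)
  have "emeasure (restrict_space lborel ?B) {x \<in> ?B. x /\<^sub>R norm x \<in> A} =
      emeasure lborel {x \<in> ?B. x /\<^sub>R norm x \<in> A}"
    using B by (intro emeasure_restrict_space) auto
  then show ?thesis
    unfolding surface_measure_def emeasure_scale_measure emeasure_distr[OF meas A] vimage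
    by simp
qed

lemma measure_surface_measure_sphere:
  "measure (surface_measure :: 'a::euclidean_space measure) (sphere 0 1) =
    DIM('a) * unit_ball_vol DIM('a)"
proof -
  have "{x \<in> ball 0 1 - {0::'a}. x /\<^sub>R norm x \<in> sphere 0 1} = ball 0 1 - {0}"
    by auto
  moreover have "emeasure lborel (ball 0 1 - {0::'a}) = ennreal (unit_ball_vol DIM('a))"
    by (subst emeasure_Diff) (auto simp: emeasure_ball)
  ultimately have "emeasure (surface_measure :: 'a measure) (sphere 0 1) =
      of_nat DIM('a) * ennreal (unit_ball_vol DIM('a))"
    by (simp add: emeasure_surface_measure)
  then have "emeasure (surface_measure :: 'a measure) (sphere 0 1) =
      ennreal (DIM('a) * unit_ball_vol DIM('a))"
    by (simp add: ennreal_mult ennreal_of_nat_eq_real_of_nat)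
  then show ?thesis
    by (simp add: measure_def)
qed

section \<open>The operators and the integral identity\<close>

definition opD :: "(real \<Rightarrow> real) \<Rightarrow> real \<Rightarrow> real" where
  "opD h t = 1 / t * deriv h t"

definition opL :: "nat \<Rightarrow> (real \<Rightarrow> real) \<Rightarrow> real \<Rightarrow> real" where
  "opL k h s = (\<Sum>l=0..k. fact (k + l) / (fact (k - l) * fact l * 2 ^ l) *
     (1 - s) ^ (k - l) * (opD ^^ (k - l)) h s)"

definition identity_integrand :: "real \<Rightarrow> (real \<Rightarrow> real) \<Rightarrow> real \<Rightarrow> real \<Rightarrow> real" where
  "identity_integrand \<alpha> h t u = u * h u / u powr (2 * \<alpha>) *
     (((1 + u)\<^sup>2 - t\<^sup>2) * ((1 - u)\<^sup>2 - t\<^sup>2)) powr (\<alpha> - 1 / 2)"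

text \<open>
  The base of the second power is positive in the interior of both ranges of integration. For
  \<open>\<alpha> = 0\<close> the integrand has an integrable singularity at \<open>1 - t\<close> and at \<open>1 + t\<close>.
\<close>

definition integral_identity :: "real \<Rightarrow> (real \<Rightarrow> real) \<Rightarrow> bool" where
  "integral_identity \<alpha> h \<longleftrightarrow> (\<forall>t. 0 < t \<and> t < 1 \<longrightarrow>
     integral {0..1 - t} (identity_integrand \<alpha> h t) =
     integral {1 + t..2} (identity_integrand \<alpha> h t))"

end

theory Submission imports Defs
begin

text \<open>
  With \<open>\<mu> = (n - 3) / 2\<close> and \<open>P(u, t) = ((1 + u)\<^sup>2 - t\<^sup>2) ((1 - u)\<^sup>2 - t\<^sup>2)\<close>, the integral identity says that
  the moment \<open>mom \<mu> g t\<close>, the integral of \<open>u g(u) sgn(u - 1) P(u, t)\<^sup>\<mu>\<close> over \<open>\<bar>u - 1\<bar> > t\<close>, vanishes for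
  \<open>0 < t < 1\<close>.

  For radial \<open>f(x) = F(\<bar>x\<bar>)\<close> the mean is a multiple of \<open>u\<^sup>2\<^sup>-\<^sup>n\<close> times the integral of \<open>r F(r) (-P(u, r))\<^sup>\<mu>\<close>, so
  its moments against \<open>P(u, t)\<^sup>\<mu>\<close> reduce to integrals in \<open>u\<close> of \<open>(- P(u, t) P(u, r))\<^sup>\<mu>\<close>. These are
  computed by \<open>- P(u, t) P(u, r) / u\<^sup>2 = \<beta>\<^sup>2 - w(u)\<^sup>2\<close>, where \<open>\<beta> = 2 (r\<^sup>2 - t\<^sup>2)\<close> and \<open>w(u) = y\<close> is a
  quartic equation in \<open>u\<close>: power sums over its roots show that the moment of the mean vanishes, while
  the moment with an additional factor \<open>u\<^sup>2\<close> is a multiple of the Abel type integral of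
  \<open>r F(r) (r\<^sup>2 - t\<^sup>2)\<^sup>n\<^sup>-\<^sup>2\<close> over \<open>t < r < 1\<close>.

  Conversely, \<open>F\<close> is recovered from the second moment of \<open>g\<close> by differentiating \<open>n - 1\<close> times with respect
  to \<open>t\<^sup>2\<close>. The mean of the resulting function has the same two moments as \<open>g\<close>, and two such
  moments determine a function: comparing two expressions for \<open>mom (\<mu> + 1) g\<close> gives all the moments
  with factors \<open>u\<^sup>2\<^sup>j\<close>, and these are dense by Weierstrass.

  For odd \<open>n\<close> the exponent \<open>\<mu> = k\<close> is an integer, and applying \<open>D\<close> to \<open>mom k g\<close> exactly
  \<open>2 k + 1\<close> times leaves only the endpoint terms, which are the two values of \<open>\<L>\<^sub>k h\<close> divided by
  \<open>t\<^sup>2\<^sup>k\<^sup>+\<^sup>1\<close>. No kernel of \<open>D\<close> intervenes, since \<open>mom k g\<close> vanishes near \<open>t = 1\<close>.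
\<close>

section \<open>The kernel integral\<close>

text \<open>In even dimensions \<mu> is a half-integer, and for n = 2 it equals -1/2:
  \<open>Pq u t powr \<mu>\<close> is then unbounded and its t-derivative is not integrable. Two
  devices get around this. Moments are compared with those of exponent \<mu> + 1, which are tail
  integrals in t of the former, and all estimates ask only for \<mu> > -1. Moreover, multiplying the
  two kernels and integrating over u leaves the exponent 2 \<mu> + 1 = n - 2, an integer in every
  dimension, so the radial profile is recovered by ordinary differentiation instead of a fractional
  Abel inversion. The remaining difficulty is the origin. For f to be smooth there, its profile must
  be smooth in |x|^2 up to 0, so the second moment must be a smooth function of T = t^2 on the
  closed half-line, although its limits of integration depend on t itself. In the variable y with
  y^2 = \<open>Pq u t\<close> the limits are fixed, and the two values of u that belong to one y
  combine into an integral all of whose T-derivatives stay continuous at T = 0.\<close>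

definition Pq :: "real \<Rightarrow> real \<Rightarrow> real" where
  "Pq u t = ((1 + u)\<^sup>2 - t\<^sup>2) * ((1 - u)\<^sup>2 - t\<^sup>2)"

text \<open>The value 0 at \<open>\<bar>u - 1\<bar> = t\<close> agrees with
  \<open>0 powr \<mu> = 0\<close>, so later rewritings of the integrand hold at every point, not
  only almost everywhere.\<close>

definition pker :: "real \<Rightarrow> real \<Rightarrow> real \<Rightarrow> real" where
  "pker \<mu> t u = (if t < \<bar>u - 1\<bar> \<and> 0 < u \<and> u < 2 then sgn (u - 1) * Pq u t powr \<mu> else 0)"

text \<open>By Heron, \<open>- Pq u r\<close> is sixteen times the squared area of a triangle with
  sides 1, u and r, and the condition is the strict triangle inequality: r is the distance from the
  origin to a point at distance u from a point of the unit sphere.\<close>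

definition kker :: "real \<Rightarrow> real \<Rightarrow> real \<Rightarrow> real" where
  "kker \<mu> r u = (if \<bar>u - 1\<bar> < r \<and> r < 1 + u then (- Pq u r) powr \<mu> else 0)"

text \<open>For \<mu> = (n - 3) / 2 the weight (1 - x^2)^\<mu> is, up to a factor, the density of
  the inner product of a fixed unit vector with a uniformly distributed one. The constant enters
  only through being positive.\<close>

definition gegenbauer_mass :: "real \<Rightarrow> real" where
  "gegenbauer_mass \<mu> = (LBINT x:{-1..1}. (1 - x\<^sup>2) powr \<mu>)"

lemma integrable_powr_left:
  fixes \<mu> a b :: real
  assumes "\<mu> > -1"
  shows "integrable lborel (\<lambda>x. indicator {a<..<b} x * (x - a) powr \<mu>)"
proof -
  define c where "c = max 0 (b - a)"
  have "(\<lambda>x. x powr \<mu>) absolutely_integrable_on {0<..c}"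
    using assms by (intro nonnegative_absolutely_integrable_1 integrable_on_powr_from_0')
      (auto simp: c_def)
  then have "set_integrable lborel {0<..c} (\<lambda>x. x powr \<mu>)"
    by (subst (asm) set_integrable_def, subst set_integrable_def, subst (asm) integrable_completion) auto
  then have "integrable lborel (\<lambda>x. indicator {0<..c} (- a + 1 * x) *\<^sub>R (- a + 1 * x) powr \<mu>)"
    unfolding set_integrable_def by (intro lborel_integrable_real_affine) auto
  then show ?thesis
    by (rule Bochner_Integration.integrable_bound)
      (auto simp: indicator_def c_def max_def)
qed

lemma integrable_powr_right:
  fixes \<mu> a b :: real
  assumes "\<mu> > -1"
  shows "integrable lborel (\<lambda>x. indicator {a<..<b} x * (b - x) powr \<mu>)"
proof -
  have "integrable lborel (\<lambda>x. indicator {-b<..<-a} (0 + (-1) * x) * ((0 + (-1) * x) - (-b)) powr \<mu>)"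
    using integrable_powr_left[OF assms] by (rule lborel_integrable_real_affine) auto
  then show ?thesis
    by (rule Bochner_Integration.integrable_bound) (auto simp: indicator_def)
qed

lemma set_integrable_one_minus_square_powr:
  fixes \<mu> :: real
  assumes "\<mu> > -1"
  shows "set_integrable lborel {-1..1} (\<lambda>x. (1 - x\<^sup>2) powr \<mu>)"
proof -
  \<comment> \<open>On each half of the interval only one of the factors 1 - x and 1 + x can vanish.
    The other lies between 1 and 2, so its power is at most \<open>1 + 2 powr \<mu>\<close> whatever
    the sign of \<mu>.\<close>
  have "integrable lborel (\<lambda>x. (1 + 2 powr \<mu>) * (indicator {-1<..<1} x * (x - (-1)) powr \<mu>
      + indicator {-1<..<1} x * (1 - x) powr \<mu>) :: real)"
    by (intro integrable_mult_right Bochner_Integration.integrable_add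
        integrable_powr_left[OF assms] integrable_powr_right[OF assms])
  then have "integrable lborel (\<lambda>x::real. indicator {-1..1} x *\<^sub>R (1 - x\<^sup>2) powr \<mu>)"
  proof (rule Bochner_Integration.integrable_bound)
    show "AE x in lborel. norm (indicator {-1..1} x *\<^sub>R (1 - x\<^sup>2) powr \<mu>) \<le>
        norm ((1 + 2 powr \<mu>) * (indicator {-1<..<1} x * (x - (-1)) powr \<mu>
      + indicator {-1<..<1} x * (1 - x) powr \<mu>) :: real)"
    proof (rule AE_I2)
      fix x :: real
      consider "x \<notin> {-1<..<1}" | "0 \<le> x" "x < 1" | "-1 < x" "x < 0" by fastforce
      then show "norm (indicator {-1..1} x *\<^sub>R (1 - x\<^sup>2) powr \<mu>) \<le>
        norm ((1 + 2 powr \<mu>) * (indicator {-1<..<1} x * (x - (-1)) powr \<mu>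
      + indicator {-1<..<1} x * (1 - x) powr \<mu>) :: real)"
      proof cases
        case 1
        then have "x = 1 \<or> x = -1 \<or> x \<notin> {-1..1}" by auto
        then show ?thesis by auto
      next
        case 2
        have "(1 + x) powr \<mu> \<le> 1 + 2 powr \<mu>"
        proof (cases "\<mu> \<ge> 0")
          case True
          then have "(1 + x) powr \<mu> \<le> 2 powr \<mu>" using 2 by (intro powr_mono2) auto
          then show ?thesis by linarith
        next
          case False
          then have "(1 + x) powr \<mu> \<le> 1 powr \<mu>" using 2 by (intro powr_mono2') auto
          then show ?thesis by (simp add: add_increasing2)
        qed
        then have "(1 + x) powr \<mu> * (1 - x) powr \<mu> \<le> (1 + 2 powr \<mu>) * (1 - x) powr \<mu>"
          by (intro mult_right_mono) auto
        moreover have "(1 - x\<^sup>2) powr \<mu> = (1 + x) powr \<mu> * (1 - x) powr \<mu>"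
          using 2 by (subst powr_mult[symmetric]) (auto simp: power2_eq_square algebra_simps)
        ultimately show ?thesis using 2
          by (simp add: distrib_left abs_mult add_nonneg_nonneg add_increasing)
      next
        case 3
        have "(1 - x) powr \<mu> \<le> 1 + 2 powr \<mu>"
        proof (cases "\<mu> \<ge> 0")
          case True
          then have "(1 - x) powr \<mu> \<le> 2 powr \<mu>" using 3 by (intro powr_mono2) auto
          then show ?thesis by linarith
        next
          case False
          then have "(1 - x) powr \<mu> \<le> 1 powr \<mu>" using 3 by (intro powr_mono2') auto
          then show ?thesis by (simp add: add_increasing2)
        qed
        then have "(1 - x) powr \<mu> * (x + 1) powr \<mu> \<le> (1 + 2 powr \<mu>) * (x + 1) powr \<mu>"
          by (intro mult_right_mono) auto
        moreover have "(1 - x\<^sup>2) powr \<mu> = (1 - x) powr \<mu> * (x + 1) powr \<mu>"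
          using 3 by (subst powr_mult[symmetric]) (auto simp: power2_eq_square algebra_simps)
        ultimately show ?thesis using 3
          by (simp add: distrib_left abs_mult add_nonneg_nonneg add_increasing2)
      qed
    qed
  qed auto
  then show ?thesis by (simp add: set_integrable_def)
qed

lemma scaled_beta_integral:
  fixes \<mu> \<beta> :: real
  assumes "\<mu> > -1" "\<beta> > 0"
  shows "set_integrable lborel {-\<beta>..\<beta>} (\<lambda>y. (\<beta>\<^sup>2 - y\<^sup>2) powr \<mu>)"
    and "(LBINT y:{-\<beta>..\<beta>}. (\<beta>\<^sup>2 - y\<^sup>2) powr \<mu>) = \<beta> powr (2 * \<mu> + 1) * gegenbauer_mass \<mu>"
proof -
  have eq: "indicator {-\<beta>..\<beta>} y *\<^sub>R (\<beta>\<^sup>2 - y\<^sup>2) powr \<mu> =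
    \<beta> powr (2 * \<mu>) * (indicator {-1..1} (0 + (1 / \<beta>) * y) *\<^sub>R (1 - (0 + (1 / \<beta>) * y)\<^sup>2) powr \<mu>)" for y
  proof (cases "y \<in> {-\<beta>..\<beta>}")
    case True
    then have "\<bar>y\<bar> \<le> \<bar>\<beta>\<bar>" using assms by auto
    then have y: "y\<^sup>2 \<le> \<beta>\<^sup>2" by (simp add: abs_le_square_iff)
    have "(\<beta>\<^sup>2 - y\<^sup>2) = \<beta>\<^sup>2 * (1 - (y / \<beta>)\<^sup>2)"
      using assms by (simp add: power_divide field_simps)
    moreover have "(\<beta>\<^sup>2) powr \<mu> = \<beta> powr (2 * \<mu>)"
      using assms by (simp add: powr_powr flip: powr_numeral)
    ultimately show ?thesis
      using True assms y by (simp add: powr_divide field_simps)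
  next
    case False
    then have "y / \<beta> \<notin> {-1..1}" using assms by (auto simp: field_simps)
    then show ?thesis using False by simp
  qed
  have int: "integrable lborel (\<lambda>x::real. indicator {-1..1} x *\<^sub>R (1 - x\<^sup>2) powr \<mu>)"
    using set_integrable_one_minus_square_powr[OF assms(1)] by (simp add: set_integrable_def)
  then have int': "integrable lborel (\<lambda>y::real. indicator {-1..1} (0 + (1 / \<beta>) * y) *\<^sub>R (1 - (0 + (1 / \<beta>) * y)\<^sup>2) powr \<mu>)"
    using assms by (intro lborel_integrable_real_affine) auto
  then show "set_integrable lborel {-\<beta>..\<beta>} (\<lambda>y. (\<beta>\<^sup>2 - y\<^sup>2) powr \<mu>)"
    unfolding set_integrable_def eq by (intro integrable_mult_right)
  have "(LBINT y:{-\<beta>..\<beta>}. (\<beta>\<^sup>2 - y\<^sup>2) powr \<mu>) = \<beta> powr (2 * \<mu>) *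
     (\<integral>y. (indicator {-1..1} (0 + (1 / \<beta>) * y) *\<^sub>R (1 - (0 + (1 / \<beta>) * y)\<^sup>2) powr \<mu>) \<partial>lborel)"
    unfolding set_lebesgue_integral_def eq by simp
  also have "(\<integral>y. (indicator {-1..1} (0 + (1 / \<beta>) * y) *\<^sub>R (1 - (0 + (1 / \<beta>) * y)\<^sup>2) powr \<mu>) \<partial>lborel)
     = \<beta> * gegenbauer_mass \<mu>"
    using lborel_integral_real_affine[of "1 / \<beta>" "\<lambda>x::real. indicator {-1..1} x *\<^sub>R (1 - x\<^sup>2) powr \<mu>" 0] assms
    by (simp add: gegenbauer_mass_def set_lebesgue_integral_def field_simps)
  finally show "(LBINT y:{-\<beta>..\<beta>}. (\<beta>\<^sup>2 - y\<^sup>2) powr \<mu>) = \<beta> powr (2 * \<mu> + 1) * gegenbauer_mass \<mu>"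
    using assms by (simp add: powr_add)
qed

lemma gegenbauer_mass_pos:
  assumes "\<mu> > -1"
  shows "gegenbauer_mass \<mu> > 0"
proof -
  have int: "integrable lborel (\<lambda>x::real. indicator {-1..1} x *\<^sub>R (1 - x\<^sup>2) powr \<mu>)"
    using set_integrable_one_minus_square_powr[OF assms(1)] by (simp add: set_integrable_def)
  have "gegenbauer_mass \<mu> \<noteq> 0"
  proof
    assume "gegenbauer_mass \<mu> = 0"
    then have "AE x::real in lborel. indicator {-1..1} x *\<^sub>R (1 - x\<^sup>2) powr \<mu> = (0::real)"
      using int unfolding gegenbauer_mass_def set_lebesgue_integral_def
      by (subst (asm) integral_nonneg_eq_0_iff_AE) auto
    then have "AE x::real in lborel. x \<notin> {0<..<1}"
    proof eventually_elim
      fix x :: real assume *: "indicator {-1..1} x *\<^sub>R (1 - x\<^sup>2) powr \<mu> = (0::real)"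
      show "x \<notin> {0<..<1}"
      proof
        assume "x \<in> {0<..<1}"
        then have "x\<^sup>2 < 1" by (auto simp: power_less_one_iff)
        then show False using * \<open>x \<in> _\<close> by auto
      qed
    qed
    then have "emeasure lborel {0<..<1::real} = 0"
      by (subst (asm) AE_iff_measurable[of "{0<..<1::real}"]) auto
    then show False by simp
  qed
  moreover have "gegenbauer_mass \<mu> \<ge> 0"
    unfolding gegenbauer_mass_def set_lebesgue_integral_def by (intro integral_nonneg_AE) auto
  ultimately show ?thesis by simp
qed

section \<open>Sums over the roots of a quartic without cubic term\<close>

text \<open>With p(x) = x^4 + a x^2 - y x + c, eliminating y shows D(x) = p'(x) / x at every root.
  The two sums are therefore those of x / p'(x) and x^3 / p'(x) over all roots of p, which by
  Lagrange interpolation are the coefficient of x^3 in the cubic that interpolates x, respectively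
  x^3.\<close>

lemma quartic_roots_sums:
  fixes x1 x2 x3 x4 :: real
  assumes ne: "x1 \<noteq> 0" "x2 \<noteq> 0" "x3 \<noteq> 0" "x4 \<noteq> 0"
    and d: "x1 \<noteq> x2" "x1 \<noteq> x3" "x1 \<noteq> x4" "x2 \<noteq> x3" "x2 \<noteq> x4" "x3 \<noteq> x4"
    and r1: "x1 ^ 4 + a * x1\<^sup>2 - y * x1 + c = 0"
    and r2: "x2 ^ 4 + a * x2\<^sup>2 - y * x2 + c = 0"
    and r3: "x3 ^ 4 + a * x3\<^sup>2 - y * x3 + c = 0"
    and r4: "x4 ^ 4 + a * x4\<^sup>2 - y * x4 + c = 0"
    and D: "\<And>x. D x = 3 * x\<^sup>2 + a - c / x\<^sup>2"
  shows "1 / D x1 + 1 / D x2 + 1 / D x3 + 1 / D x4 = 0"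
    and "x1\<^sup>2 / D x1 + x2\<^sup>2 / D x2 + x3\<^sup>2 / D x3 + x4\<^sup>2 / D x4 = 1"
proof -
  \<comment> \<open>Divided differences of the quartic at two, three and four roots express y, then
    a, then the vanishing sum of the roots.\<close>
  have y2: "p^3 + p\<^sup>2*q + p*q\<^sup>2 + q^3 + a*(p+q) - y = 0"
    if "p^4 + a*p\<^sup>2 - y*p + c = 0" "q^4 + a*q\<^sup>2 - y*q + c = 0" "p \<noteq> q" for p q :: real
  proof -
    have "(p - q) * (p^3 + p\<^sup>2*q + p*q\<^sup>2 + q^3 + a*(p+q) - y) = 0"
      using that by (simp add: algebra_simps power2_eq_square power3_eq_cube power4_eq_xxxx)
    then show ?thesis using that by simp
  qed
  have a3: "p\<^sup>2 + q\<^sup>2 + s\<^sup>2 + p * q + p * s + q * s + a = 0"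
    if "p^4 + a*p\<^sup>2 - y*p + c = 0" "q^4 + a*q\<^sup>2 - y*q + c = 0" "s^4 + a * s\<^sup>2 - y * s + c = 0"
      "p \<noteq> q" "p \<noteq> s" "q \<noteq> s" for p q s :: real
  proof -
    have "(q - s) * (p\<^sup>2 + q\<^sup>2 + s\<^sup>2 + p * q + p * s + q * s + a) = 0"
      using y2[OF that(1,2)] y2[OF that(1,3)] that
      by (simp add: algebra_simps power2_eq_square power3_eq_cube)
    then show ?thesis using that by simp
  qed
  have "(x3 - x4) * (x1 + x2 + x3 + x4) = 0"
    using a3[OF r1 r2 r3] a3[OF r1 r2 r4] d by (simp add: algebra_simps power2_eq_square)
  then have e1: "x4 = - x1 - x2 - x3" using d by simp
  have ea: "a = - (x1\<^sup>2 + x2\<^sup>2 + x3\<^sup>2 + x1*x2 + x1*x3 + x2*x3)"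
    using a3[OF r1 r2 r3] d by simp
  have ey: "y = x1^3 + x1\<^sup>2*x2 + x1*x2\<^sup>2 + x2^3 + a*(x1+x2)"
    using y2[OF r1 r2] d by simp
  have Dx: "D x = (4 * x^3 + 2 * a * x - y) / x" if "x \<noteq> 0" "x^4 + a*x\<^sup>2 - y*x + c = 0" for x
  proof -
    have c: "c = y*x - x^4 - a*x\<^sup>2" using that by simp
    show ?thesis unfolding D c using that
      by (simp add: field_simps power2_eq_square power3_eq_cube power4_eq_xxxx)
  qed
  have "4 * x1^3 + 2 * a * x1 - y = (x1 - x2) * (x1 - x3) * (x1 - x4)"
    unfolding ey ea e1 by (simp add: algebra_simps power2_eq_square power3_eq_cube)
  then have D1: "D x1 = (x1 - x2) * (x1 - x3) * (x1 - x4) / x1"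
    using Dx[OF ne(1) r1] by simp
  have "4 * x2^3 + 2 * a * x2 - y = (x2 - x1) * (x2 - x3) * (x2 - x4)"
    unfolding ey ea e1 by (simp add: algebra_simps power2_eq_square power3_eq_cube)
  then have D2: "D x2 = (x2 - x1) * (x2 - x3) * (x2 - x4) / x2"
    using Dx[OF ne(2) r2] by simp
  have "4 * x3^3 + 2 * a * x3 - y = (x3 - x1) * (x3 - x2) * (x3 - x4)"
    unfolding ey ea e1 by (simp add: algebra_simps power2_eq_square power3_eq_cube)
  then have D3: "D x3 = (x3 - x1) * (x3 - x2) * (x3 - x4) / x3"
    using Dx[OF ne(3) r3] by simp
  have "4 * x4^3 + 2 * a * x4 - y = (x4 - x1) * (x4 - x2) * (x4 - x3)"
    unfolding ey ea e1 by (simp add: algebra_simps power2_eq_square power3_eq_cube)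
  then have D4: "D x4 = (x4 - x1) * (x4 - x2) * (x4 - x3) / x4"
    using Dx[OF ne(4) r4] by simp
  \<comment> \<open>The Vandermonde product is a common denominator of the four fractions, which
    leaves polynomial identities.\<close>
  define V where "V = (x1 - x2) * (x1 - x3) * (x1 - x4) * (x2 - x3) * (x2 - x4) * (x3 - x4)"
  have V0: "V \<noteq> 0" using d by (simp add: V_def)
  have i1: "1 / D x1 = x1 * ((x2 - x3) * (x2 - x4) * (x3 - x4)) / V"
    unfolding D1 V_def using d by (simp add: divide_simps)
  have i2: "1 / D x2 = - x2 * ((x1 - x3) * (x1 - x4) * (x3 - x4)) / V"
    unfolding D2 V_def using d by (simp add: divide_simps) (simp add: algebra_simps)
  have i3: "1 / D x3 = x3 * ((x1 - x2) * (x1 - x4) * (x2 - x4)) / V"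
    unfolding D3 V_def using d by (simp add: divide_simps) (simp add: algebra_simps)
  have i4: "1 / D x4 = - x4 * ((x1 - x2) * (x1 - x3) * (x2 - x3)) / V"
    unfolding D4 V_def using d by (simp add: divide_simps) (simp add: algebra_simps)
  show "1 / D x1 + 1 / D x2 + 1 / D x3 + 1 / D x4 = 0"
    unfolding i1 i2 i3 i4 add_divide_distrib[symmetric]
    by (simp add: algebra_simps)
  have "x1\<^sup>2 / D x1 + x2\<^sup>2 / D x2 + x3\<^sup>2 / D x3 + x4\<^sup>2 / D x4 =
     x1\<^sup>2 * (1 / D x1) + x2\<^sup>2 * (1 / D x2) + x3\<^sup>2 * (1 / D x3) + x4\<^sup>2 * (1 / D x4)"
    by simp
  also have "\<dots> = V / V"
    unfolding i1 i2 i3 i4 times_divide_eq_right add_divide_distrib[symmetric]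
    unfolding V_def by (rule arg_cong2[where f="(/)"]) (simp_all add: algebra_simps power2_eq_square)
  finally show "x1\<^sup>2 / D x1 + x2\<^sup>2 / D x2 + x3\<^sup>2 / D x3 + x4\<^sup>2 / D x4 = 1"
    using V0 by simp
qed

section \<open>The substitution y = w(u)\<close>

definition wfun :: "real \<Rightarrow> real \<Rightarrow> real \<Rightarrow> real" where
  "wfun t r u = u ^ 3 - (2 + r\<^sup>2 + t\<^sup>2) * u + (1 - r\<^sup>2) * (1 - t\<^sup>2) / u"

definition wder :: "real \<Rightarrow> real \<Rightarrow> real \<Rightarrow> real" where
  "wder t r u = 3 * u\<^sup>2 - (2 + r\<^sup>2 + t\<^sup>2) - (1 - r\<^sup>2) * (1 - t\<^sup>2) / u\<^sup>2"

lemma wfun_deriv: "u \<noteq> 0 \<Longrightarrow> (wfun t r has_real_derivative wder t r u) (at u)"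
  unfolding wfun_def wder_def
  by (auto intro!: derivative_eq_intros simp: power2_eq_square field_simps)

text \<open>Since w is odd, a positive root of w = -y becomes a negative root of w = y after a
  change of sign. This is how integrals over u > 0 reach all four roots.\<close>

lemma wfun_minus: "wfun t r (- u) = - wfun t r u" and wder_minus: "wder t r (- u) = wder t r u"
  by (simp_all add: wfun_def wder_def)

lemma Pq_mult_wfun:
  assumes "u \<noteq> 0"
  shows "Pq u t * (- Pq u r) = u\<^sup>2 * ((2 * (r\<^sup>2 - t\<^sup>2))\<^sup>2 - (wfun t r u)\<^sup>2)"
proof -
  \<comment> \<open>A name for the reciprocal makes the claim a polynomial identity modulo
    \<open>u * z = 1\<close>.\<close>
  define z where "z = 1 / u"
  have "u * z = 1" using assms by (simp add: z_def)
  moreover have w: "wfun t r u = u ^ 3 - (2 + r\<^sup>2 + t\<^sup>2) * u + (1 - r\<^sup>2) * (1 - t\<^sup>2) * z"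
    by (simp add: wfun_def z_def)
  ultimately show ?thesis unfolding Pq_def w by algebra
qed

text \<open>At these points one of the two factors \<open>Pq\<close> vanishes, so w is plus or minus
  \<beta> = 2 (r^2 - t^2). The signs show that w runs from -\<beta> up to \<beta> on [1 + t, 1 + r]
  and from \<beta> down to -\<beta> on [1 - r, 1 - t].\<close>

lemma wfun_ends:
  assumes "0 < t" "t < r" "r < 1"
  shows "wfun t r (1 + r) = 2 * (r\<^sup>2 - t\<^sup>2)" "wfun t r (1 - r) = 2 * (r\<^sup>2 - t\<^sup>2)"
    "wfun t r (1 + t) = - (2 * (r\<^sup>2 - t\<^sup>2))" "wfun t r (1 - t) = - (2 * (r\<^sup>2 - t\<^sup>2))"
  using assms by (simp_all add: wfun_def divide_simps) algebra+

text \<open>Since w' increases on u > 0, its sign on each of the two intervals is decided at the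
  endpoint nearest to 1.\<close>

lemma wder_mono:
  assumes "0 < t" "t < r" "r < 1" "0 < u" "u \<le> v"
  shows "wder t r u \<le> wder t r v"
proof -
  have "u\<^sup>2 \<le> v\<^sup>2" using assms by (intro power_mono) auto
  moreover have "0 \<le> (1 - r\<^sup>2) * (1 - t\<^sup>2)"
    using assms by (intro mult_nonneg_nonneg) (auto simp: power_le_one_iff)
  moreover have "0 < u\<^sup>2" using assms by auto
  ultimately have "(1 - r\<^sup>2) * (1 - t\<^sup>2) / v\<^sup>2 \<le> (1 - r\<^sup>2) * (1 - t\<^sup>2) / u\<^sup>2"
    using assms by (intro divide_left_mono mult_pos_pos) auto
  with \<open>u\<^sup>2 \<le> v\<^sup>2\<close> show ?thesis by (simp add: wder_def)
qed

lemma wder_pos: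
  assumes "0 < t" "t < r" "r < 1" "1 + t \<le> u"
  shows "wder t r u > 0"
proof -
  have "wder t r (1 + t) * (1 + t) = 2 * t * ((2 + t)\<^sup>2 - r\<^sup>2)"
    using assms by (simp add: wder_def divide_simps) algebra
  moreover have "r\<^sup>2 < (2 + t)\<^sup>2" using assms by (intro power_strict_mono) auto
  ultimately have "wder t r (1 + t) * (1 + t) > 0" using assms by simp
  then have "wder t r (1 + t) > 0" using assms by (simp add: zero_less_mult_iff)
  with wder_mono[of t r "1 + t" u] assms show ?thesis by linarith
qed

lemma wder_neg:
  assumes "0 < t" "t < r" "r < 1" "0 < u" "u \<le> 1 - t"
  shows "wder t r u < 0"
proof -
  have "wder t r (1 - t) * (1 - t) = - (2 * t * ((2 - t)\<^sup>2 - r\<^sup>2))"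
    using assms by (simp add: wder_def divide_simps) algebra
  moreover have "r\<^sup>2 < (2 - t)\<^sup>2" using assms by (intro power_strict_mono) auto
  ultimately have "wder t r (1 - t) * (1 - t) < 0" using assms by simp
  then have "wder t r (1 - t) < 0" using assms by (simp add: mult_less_0_iff)
  with wder_mono[of t r u "1 - t"] assms show ?thesis by linarith
qed

lemma increasing_inverse:
  fixes f f' :: "real \<Rightarrow> real"
  assumes ab: "a \<le> b" and df: "\<And>x. x \<in> {a..b} \<Longrightarrow> (f has_real_derivative f' x) (at x)"
    and pos: "\<And>x. x \<in> {a..b} \<Longrightarrow> f' x > 0"
  obtains g where "continuous_on {f a..f b} g" "\<And>y. y \<in> {f a..f b} \<Longrightarrow> g y \<in> {a..b} \<and> f (g y) = y"
    "\<And>x. x \<in> {a..b} \<Longrightarrow> f x \<in> {f a..f b} \<and> g (f x) = x"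
proof -
  have mono: "f x < f y" if "x \<in> {a..b}" "y \<in> {a..b}" "x < y" for x y
  proof (rule DERIV_pos_imp_increasing[OF \<open>x < y\<close>])
    fix z assume "x \<le> z" "z \<le> y"
    then have "z \<in> {a..b}" using that by auto
    then show "\<exists>d. DERIV f z :> d \<and> d > 0" using df pos by blast
  qed
  have cont: "continuous_on {a..b} f"
    using df by (intro DERIV_continuous_on) (auto intro: DERIV_subset)
  have inj: "inj_on f {a..b}"
    by (intro linorder_inj_onI) (use mono in \<open>fastforce+\<close>)
  have fin: "f x \<in> {f a..f b}" if "x \<in> {a..b}" for x
    using mono[of a x] mono[of x b] that ab by (cases "x = a"; cases "x = b") auto
  have im: "f ` {a..b} = {f a..f b}"
  proof
    show "{f a..f b} \<subseteq> f ` {a..b}"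
    proof
      fix y assume "y \<in> {f a..f b}"
      then obtain x where "a \<le> x" "x \<le> b" "f x = y" using IVT'[of f a y b] ab cont by auto
      then show "y \<in> f ` {a..b}" by auto
    qed
  qed (use fin in auto)
  define g where "g = inv_into {a..b} f"
  have gf: "g (f x) = x" if "x \<in> {a..b}" for x
    using that inj by (simp add: g_def)
  have "continuous_on (f ` {a..b}) g"
    using gf by (intro continuous_on_inv[OF cont]) auto
  then show ?thesis
  proof (intro that[of g])
    fix y assume "y \<in> {f a..f b}"
    then have "y \<in> f ` {a..b}" by (simp add: im)
    then show "g y \<in> {a..b} \<and> f (g y) = y"
      unfolding g_def by (metis inv_into_into f_inv_into_f)
  qed (use im gf fin in auto)
qed

lemma powr_minus_mult_kernels:
  assumes tr: "0 < t" "t < r" "r < 1" and u: "0 < u" and j: "t < \<bar>u - 1\<bar>" "\<bar>u - 1\<bar> < r"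
  shows "u powr (- 2 * \<mu>) * (Pq u t powr \<mu> * (- Pq u r) powr \<mu>) =
    ((2 * (r\<^sup>2 - t\<^sup>2))\<^sup>2 - (wfun t r u)\<^sup>2) powr \<mu>"
    and "0 < Pq u t" "0 < - Pq u r"
proof -
  have "t\<^sup>2 < \<bar>u - 1\<bar>\<^sup>2" "\<bar>u - 1\<bar>\<^sup>2 < r\<^sup>2"
    using assms by (intro power_strict_mono; auto)+
  then have "t\<^sup>2 < (u - 1)\<^sup>2" "(u - 1)\<^sup>2 < r\<^sup>2" by simp_all
  moreover have "t\<^sup>2 < (1 + u)\<^sup>2" "r\<^sup>2 < (1 + u)\<^sup>2"
    using assms by (intro power_strict_mono; linarith)+
  ultimately show P: "0 < Pq u t" and K: "0 < - Pq u r"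
    unfolding Pq_def by (auto simp: power2_commute[of 1 u] zero_less_mult_iff mult_less_0_iff)
  have "u powr (- 2 * \<mu>) * u powr (2 * \<mu>) = 1"
    using u by (simp add: powr_minus)
  moreover have "(u\<^sup>2) powr \<mu> = u powr (2 * \<mu>)"
    using u by (simp add: powr_powr flip: powr_numeral)
  moreover have "(2 * (r\<^sup>2 - t\<^sup>2))\<^sup>2 - (wfun t r u)\<^sup>2 \<ge> 0"
    using Pq_mult_wfun[of u t r] P K u
    by (metis less_imp_le mult_pos_pos zero_less_mult_pos zero_less_power less_irrefl)
  then have "(u\<^sup>2 * ((2 * (r\<^sup>2 - t\<^sup>2))\<^sup>2 - (wfun t r u)\<^sup>2)) powr \<mu> =
     (u\<^sup>2) powr \<mu> * ((2 * (r\<^sup>2 - t\<^sup>2))\<^sup>2 - (wfun t r u)\<^sup>2) powr \<mu>"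
    by (simp add: powr_mult)
  moreover have "Pq u t powr \<mu> * (- Pq u r) powr \<mu> = (Pq u t * - Pq u r) powr \<mu>"
    by (rule powr_mult[symmetric])
  ultimately show "u powr (- 2 * \<mu>) * (Pq u t powr \<mu> * (- Pq u r) powr \<mu>) =
    ((2 * (r\<^sup>2 - t\<^sup>2))\<^sup>2 - (wfun t r u)\<^sup>2) powr \<mu>"
    using Pq_mult_wfun[of u t r] u by (simp add: mult.assoc[symmetric])
qed

text \<open>The supports overlap where \<open>\<bar>u - 1\<bar>\<close> lies between t and r, an
  interval on each side of 1. Substituting y = w(u) on both turns the product of kernels into
  (\<beta>^2 - y^2)^\<mu> times a sum of u^(2 j) / w'(u) over one root on each side. Averaging over
  y and -y brings in the other two roots, and the sum over all four is a constant, 0 or 1.\<close>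

lemma kernel_integral:
  fixes j :: nat
  assumes \<mu>: "\<mu> > -1" and tr: "0 < t" "t < r" "r < 1" and j: "j \<le> 1"
  shows "integrable lborel (\<lambda>u. u ^ (2 * j) * u powr (- 2 * \<mu>) * (pker \<mu> t u * kker \<mu> r u))"
    and "(\<integral>u. u ^ (2 * j) * u powr (- 2 * \<mu>) * (pker \<mu> t u * kker \<mu> r u) \<partial>lborel) =
      (if j = 0 then 0 else gegenbauer_mass \<mu> / 2 * (2 * (r\<^sup>2 - t\<^sup>2)) powr (2 * \<mu> + 1))"
proof -
  define \<beta> where "\<beta> = 2 * (r\<^sup>2 - t\<^sup>2)"
  have \<beta>: "\<beta> > 0" using tr by (auto simp: \<beta>_def power_strict_mono)
  let ?w = "wfun t r" and ?D = "wder t r"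
  define \<rho> where "\<rho> y = (\<beta>\<^sup>2 - y\<^sup>2) powr \<mu>" for y
  note ends = wfun_ends[OF tr, folded \<beta>_def]
  obtain gp where gp: "continuous_on {-\<beta>..\<beta>} gp"
    "\<And>y. y \<in> {-\<beta>..\<beta>} \<Longrightarrow> gp y \<in> {1+t..1+r} \<and> ?w (gp y) = y"
    "\<And>x. x \<in> {1+t..1+r} \<Longrightarrow> ?w x \<in> {-\<beta>..\<beta>} \<and> gp (?w x) = x"
    using increasing_inverse[of "1+t" "1+r" ?w ?D] tr wder_pos[OF tr] wfun_deriv
    unfolding ends by (smt (verit) atLeastAtMost_iff)
  \<comment> \<open>The left branch is parametrised through -w, which increases there; so
    \<open>gm y\<close> solves w = -y, and \<open>- gm y\<close> solves w = y.\<close>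
  obtain gm where gm: "continuous_on {-\<beta>..\<beta>} gm"
    "\<And>y. y \<in> {-\<beta>..\<beta>} \<Longrightarrow> gm y \<in> {1-r..1-t} \<and> - ?w (gm y) = y"
    "\<And>x. x \<in> {1-r..1-t} \<Longrightarrow> - ?w x \<in> {-\<beta>..\<beta>} \<and> gm (- ?w x) = x"
  proof (rule increasing_inverse[of "1-r" "1-t" "\<lambda>x. - ?w x" "\<lambda>x. - ?D x"])
    show "((\<lambda>x. - ?w x) has_real_derivative - ?D x) (at x)" if "x \<in> {1-r..1-t}" for x
      using that tr by (intro DERIV_minus wfun_deriv) auto
  qed (use tr wder_neg[OF tr] in \<open>auto simp: ends\<close>)
  define fp where "fp y = \<rho> y * (gp y ^ (2 * j) / ?D (gp y))" for y
  define fm where "fm y = \<rho> y * (gm y ^ (2 * j) / - ?D (gm y))" for y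
  have contD: "continuous_on {0<..} ?D"
    unfolding wder_def by (intro continuous_intros) auto
  have Dgp: "?D (gp y) > 0" if "y \<in> {-\<beta>..\<beta>}" for y
    using gp(2)[OF that] wder_pos[OF tr] by auto
  have Dgm: "?D (gm y) < 0" if "y \<in> {-\<beta>..\<beta>}" for y
    using gm(2)[OF that] wder_neg[OF tr] tr by auto
  have \<rho>_int: "set_integrable lborel {-\<beta>..\<beta>} \<rho>"
    unfolding \<rho>_def using scaled_beta_integral(1)[OF \<mu> \<beta>] .
  have prod_int: "set_integrable lborel {-\<beta>..\<beta>} (\<lambda>y. \<rho> y * c y)"
    if c: "continuous_on {-\<beta>..\<beta>} c" for c
  proof -
    have "bounded (c ` {-\<beta>..\<beta>})" using c by (intro compact_imp_bounded compact_continuous_image) auto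
    then obtain B where "\<forall>z\<in>c ` {-\<beta>..\<beta>}. norm z \<le> B"
      unfolding bounded_iff by blast
    then have B: "\<bar>c y\<bar> \<le> B" if "y \<in> {-\<beta>..\<beta>}" for y
      using that by auto
    have cm: "(\<lambda>y. indicator {-\<beta>..\<beta>} y *\<^sub>R c y) \<in> borel_measurable borel"
      using c by (intro borel_measurable_continuous_on_indicator) auto
    have rm: "(\<lambda>y. indicator {-\<beta>..\<beta>} y *\<^sub>R \<rho> y) \<in> borel_measurable borel"
      using \<rho>_int by (auto simp: set_integrable_def dest: borel_measurable_integrable)
    have eq: "(indicator {-\<beta>..\<beta>} y *\<^sub>R \<rho> y) * (indicator {-\<beta>..\<beta>} y *\<^sub>R c y)
       = indicator {-\<beta>..\<beta>} y *\<^sub>R (\<rho> y * c y)" for y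
      by (auto simp: indicator_def)
    have "(\<lambda>y. indicator {-\<beta>..\<beta>} y *\<^sub>R (\<rho> y * c y)) \<in> borel_measurable borel"
      using borel_measurable_times[OF rm cm] unfolding eq .
    moreover have "integrable lborel (\<lambda>y. B * (indicator {-\<beta>..\<beta>} y *\<^sub>R \<rho> y))"
      using \<rho>_int by (intro integrable_mult_right) (simp add: set_integrable_def)
    ultimately show ?thesis unfolding set_integrable_def
    proof (intro Bochner_Integration.integrable_bound[OF \<open>integrable lborel (\<lambda>y. B * _ y)\<close>] AE_I2)
      fix y
      show "norm (indicator {-\<beta>..\<beta>} y *\<^sub>R (\<rho> y * c y)) \<le> norm (B * (indicator {-\<beta>..\<beta>} y *\<^sub>R \<rho> y))"
        using B[of y] by (cases "y \<in> {-\<beta>..\<beta>}")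
          (auto simp: abs_mult \<rho>_def mult.commute[of _ "c y"] mult.commute[of _ "\<bar>c y\<bar>"] intro!: mult_right_mono)
    qed auto
  qed
  have fp_int: "set_integrable lborel {-\<beta>..\<beta>} fp" unfolding fp_def
    using Dgp gp(1,2) tr by (intro prod_int continuous_intros continuous_on_compose2[OF contD]) force+
  have fm_int: "set_integrable lborel {-\<beta>..\<beta>} fm" unfolding fm_def
    using Dgm gm(1,2) tr by (intro prod_int continuous_intros continuous_on_compose2[OF contD]) force+
  have contDp: "continuous_on {1+t..1+r} ?D" and contDm: "continuous_on {1-r..1-t} (\<lambda>x. - ?D x)"
    using tr by (intro continuous_intros continuous_on_subset[OF contD]; force)+
  note sp = integral_substitution[of ?w "1+t" "1+r" fp ?D, unfolded ends, OF fp_int _ contDp]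
  note sm = integral_substitution[of "\<lambda>x. - ?w x" "1-r" "1-t" fm "\<lambda>x. - ?D x", unfolded ends minus_minus, OF fm_int _ contDm]
  have Dp_nn: "0 \<le> ?D x" if "x \<in> {1+t..1+r}" for x using wder_pos[OF tr, of x] that by auto
  have Dm_nn: "0 \<le> - ?D x" if "x \<in> {1-r..1-t}" for x using wder_neg[OF tr, of x] that tr by auto
  have derp: "(?w has_real_derivative ?D x) (at x)" if "x \<in> {1+t..1+r}" for x
    using that tr by (intro wfun_deriv) auto
  have derm: "((\<lambda>x. - ?w x) has_real_derivative - ?D x) (at x)" if "x \<in> {1-r..1-t}" for x
    using that tr by (intro DERIV_minus wfun_deriv) auto
  have sp1: "set_integrable lborel {1+t..1+r} (\<lambda>x. fp (?w x) * ?D x)"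
    and sp2: "(LBINT x. fp x * indicator {-\<beta>..\<beta>} x) = (LBINT x. fp (?w x) * ?D x * indicator {1+t..1+r} x)"
    using sp derp Dp_nn tr by auto
  have sm1: "set_integrable lborel {1-r..1-t} (\<lambda>x. fm (- ?w x) * - ?D x)"
    and sm2: "(LBINT x. fm x * indicator {-\<beta>..\<beta>} x) = (LBINT x. fm (- ?w x) * - ?D x * indicator {1-r..1-t} x)"
    using sm derm Dm_nn tr by auto
  have fpw: "fp (?w u) * ?D u = u ^ (2 * j) * \<rho> (?w u)" if "u \<in> {1+t..1+r}" for u
    using gp(3)[OF that] wder_pos[OF tr, of u] that by (simp add: fp_def)
  have fmw: "fm (- ?w u) * - ?D u = u ^ (2 * j) * \<rho> (?w u)" if "u \<in> {1-r..1-t}" for u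
    using gm(3)[OF that] wder_neg[OF tr, of u] that tr by (simp add: fm_def \<rho>_def)
  \<comment> \<open>At the four endpoints the open conditions in the kernels give 0, and so does
    \<open>0 powr \<mu>\<close> on the substituted side.\<close>
  have \<rho>0: "\<rho> (?w (1 + r)) = 0" "\<rho> (?w (1 - r)) = 0" "\<rho> (?w (1 + t)) = 0" "\<rho> (?w (1 - t)) = 0"
    unfolding ends by (simp_all add: \<rho>_def)
  have eq: "u ^ (2 * j) * u powr (- 2 * \<mu>) * (pker \<mu> t u * kker \<mu> r u) =
      fp (?w u) * ?D u * indicator {1+t..1+r} u - fm (- ?w u) * - ?D u * indicator {1-r..1-t} u" for u
  proof -
    consider "1 + t < u" "u < 1 + r" | "1 - r < u" "u < 1 - t" | "u \<in> {1 + t, 1 + r}" | "u \<in> {1 - t, 1 - r}"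
      | "u \<notin> {1+t..1+r} \<union> {1-r..1-t}" by fastforce
    then show ?thesis
    proof cases
      case 1
      then have k: "u powr (- 2 * \<mu>) * (Pq u t powr \<mu> * (- Pq u r) powr \<mu>) = \<rho> (?w u)"
        unfolding \<rho>_def \<beta>_def using tr by (intro powr_minus_mult_kernels) auto
      have "pker \<mu> t u = Pq u t powr \<mu>" "kker \<mu> r u = (- Pq u r) powr \<mu>"
        using 1 tr by (auto simp: pker_def kker_def)
      then show ?thesis using fpw[of u] 1 tr k by (simp add: mult.assoc indicator_def)
    next
      case 2
      then have k: "u powr (- 2 * \<mu>) * (Pq u t powr \<mu> * (- Pq u r) powr \<mu>) = \<rho> (?w u)"
        unfolding \<rho>_def \<beta>_def using tr by (intro powr_minus_mult_kernels) auto
      have "pker \<mu> t u = - (Pq u t powr \<mu>)" "kker \<mu> r u = (- Pq u r) powr \<mu>"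
        using 2 tr by (auto simp: pker_def kker_def)
      then show ?thesis using fmw[of u] 2 tr k by (simp add: mult.assoc indicator_def)
    next
      case 3
      then have "pker \<mu> t u * kker \<mu> r u = 0" using tr by (auto simp: pker_def kker_def)
      then show ?thesis using fpw[of u] 3 tr \<rho>0 by (auto simp: indicator_def)
    next
      case 4
      then have "pker \<mu> t u * kker \<mu> r u = 0" using tr by (auto simp: pker_def kker_def)
      then show ?thesis using fmw[of u] 4 tr \<rho>0 by (auto simp: indicator_def)
    next
      case 5
      then have "pker \<mu> t u * kker \<mu> r u = 0" using tr by (auto simp: pker_def kker_def)
      then show ?thesis using 5 by (auto simp: indicator_def)
    qed
  qed
  have ip: "integrable lborel (\<lambda>u. fp (?w u) * ?D u * indicator {1+t..1+r} u)"
    using sp1 by (simp add: set_integrable_def mult.commute)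
  have im: "integrable lborel (\<lambda>u. fm (- ?w u) * - ?D u * indicator {1-r..1-t} u)"
    using sm1 by (simp add: set_integrable_def mult.commute)
  show "integrable lborel (\<lambda>u. u ^ (2 * j) * u powr (- 2 * \<mu>) * (pker \<mu> t u * kker \<mu> r u))"
    unfolding eq by (intro Bochner_Integration.integrable_diff ip im)
  define S where "S y = gp y ^ (2 * j) / ?D (gp y) + gm y ^ (2 * j) / ?D (gm y)" for y
  \<comment> \<open>For this y the roots of w = y are \<open>gp y\<close>,
    \<open>- gp (- y)\<close>, \<open>gm (- y)\<close> and \<open>- gm y\<close>. The endpoints of
    the y-interval are left out to keep the roots distinct.\<close>
  have SS: "S y + S (- y) = real j" if y: "y \<in> {-\<beta><..<\<beta>}" for y
  proof -
    have yy: "y \<in> {-\<beta>..\<beta>}" "- y \<in> {-\<beta>..\<beta>}" using y by auto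
    note p = gp(2)[OF yy(1)] gp(2)[OF yy(2)] gm(2)[OF yy(1)] gm(2)[OF yy(2)]
    have wq: "x ^ 4 + - (2 + r\<^sup>2 + t\<^sup>2) * x\<^sup>2 - y * x + (1 - r\<^sup>2) * (1 - t\<^sup>2) = 0"
      if "?w x = y" "x \<noteq> 0" for x
      using that by (simp add: wfun_def field_simps power2_eq_square power3_eq_cube power4_eq_xxxx)
    have ww: "?w (- gp (- y)) = y" "?w (- gm y) = y" "?w (gp y) = y" "?w (gm (- y)) = y"
      using p by (auto simp: wfun_minus)
    have De: "\<And>x. ?D x = 3 * x\<^sup>2 + - (2 + r\<^sup>2 + t\<^sup>2) - (1 - r\<^sup>2) * (1 - t\<^sup>2) / x\<^sup>2"
      by (simp add: wder_def)
    have ne: "gp y \<noteq> 0" "- gp (- y) \<noteq> 0" "gm (- y) \<noteq> 0" "- gm y \<noteq> 0"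
      using p tr by auto
    have di: "gp y \<noteq> - gp (- y)" "gp y \<noteq> gm (- y)" "gp y \<noteq> - gm y" "- gp (- y) \<noteq> gm (- y)"
      "- gp (- y) \<noteq> - gm y" "gm (- y) \<noteq> - gm y"
      using p tr by (auto simp: not_le)
    note Q = quartic_roots_sums[OF ne di wq[OF ww(3) ne(1)] wq[OF ww(1) ne(2)] wq[OF ww(4) ne(3)] wq[OF ww(2) ne(4)] De]
    consider "j = 0" | "j = 1" using \<open>j \<le> 1\<close> by linarith
    then show ?thesis
    proof cases
      case 1
      then show ?thesis using Q(1) by (simp add: S_def wder_minus)
    next
      case 2
      then show ?thesis using Q(2) by (simp add: S_def wder_minus)
    qed
  qed
  let ?I = "\<integral>u. u ^ (2 * j) * u powr (- 2 * \<mu>) * (pker \<mu> t u * kker \<mu> r u) \<partial>lborel"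
  have ifp: "integrable lborel (\<lambda>y. fp y * indicator {-\<beta>..\<beta>} y)"
    using fp_int by (simp add: set_integrable_def mult.commute)
  have ifm: "integrable lborel (\<lambda>y. fm y * indicator {-\<beta>..\<beta>} y)"
    using fm_int by (simp add: set_integrable_def mult.commute)
  have "?I = (LBINT x. fp x * indicator {-\<beta>..\<beta>} x) - (LBINT x. fm x * indicator {-\<beta>..\<beta>} x)"
    unfolding eq sp2 sm2 by (intro Bochner_Integration.integral_diff ip im)
  also have "\<dots> = (LBINT x. fp x * indicator {-\<beta>..\<beta>} x - fm x * indicator {-\<beta>..\<beta>} x)"
    by (intro Bochner_Integration.integral_diff[symmetric] ifp ifm)
  also have eS: "(\<lambda>x. fp x * indicator {-\<beta>..\<beta>} x - fm x * indicator {-\<beta>..\<beta>} x) =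
     (\<lambda>y. indicator {-\<beta>..\<beta>} y * \<rho> y * S y)"
    by (auto simp: fp_def fm_def S_def indicator_def algebra_simps)
  finally have I1: "?I = (\<integral>y. indicator {-\<beta>..\<beta>} y * \<rho> y * S y \<partial>lborel)" .
  have iS: "integrable lborel (\<lambda>y. indicator {-\<beta>..\<beta>} y * \<rho> y * S y)"
    using Bochner_Integration.integrable_diff[OF ifp ifm] unfolding eS .
  have em: "(\<lambda>y. indicator {-\<beta>..\<beta>} (0 + (-1) * y) * \<rho> (0 + (-1) * y) * S (0 + (-1) * y)) =
      (\<lambda>y. indicator {-\<beta>..\<beta>} y * \<rho> y * S (- y))"
  proof
    fix y
    have "0 + (-1) * y \<in> {-\<beta>..\<beta>} \<longleftrightarrow> y \<in> {-\<beta>..\<beta>}" by auto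
    then show "indicator {-\<beta>..\<beta>} (0 + (-1) * y) * \<rho> (0 + (-1) * y) * S (0 + (-1) * y) =
      indicator {-\<beta>..\<beta>} y * \<rho> y * S (- y)"
      by (simp only: indicator_def) (simp add: \<rho>_def)
  qed
  have iSm: "integrable lborel (\<lambda>y. indicator {-\<beta>..\<beta>} y * \<rho> y * S (- y))"
    using lborel_integrable_real_affine[OF iS, of "-1" 0] unfolding em by simp
  have I2: "?I = (\<integral>y. indicator {-\<beta>..\<beta>} y * \<rho> y * S (- y) \<partial>lborel)"
    unfolding I1 using lborel_integral_real_affine[of "-1" "\<lambda>y. indicator {-\<beta>..\<beta>} y * \<rho> y * S y" 0]
    unfolding em by simp
  \<comment> \<open>The integral is added to its reflection, which is the origin of the division by
    2 in the result.\<close>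
  have "2 * ?I = (\<integral>y. indicator {-\<beta>..\<beta>} y * \<rho> y * S y + indicator {-\<beta>..\<beta>} y * \<rho> y * S (- y) \<partial>lborel)"
    using I1 I2 iS iSm by (subst Bochner_Integration.integral_add) auto
  also have "\<dots> = (\<integral>y. real j * (indicator {-\<beta>..\<beta>} y *\<^sub>R \<rho> y) \<partial>lborel)"
  proof (intro Bochner_Integration.integral_cong refl)
    fix y
    show "indicator {-\<beta>..\<beta>} y * \<rho> y * S y + indicator {-\<beta>..\<beta>} y * \<rho> y * S (- y) =
      real j * (indicator {-\<beta>..\<beta>} y *\<^sub>R \<rho> y)"
    proof (cases "y \<in> {-\<beta><..<\<beta>}")
      case True
      have "indicator {-\<beta>..\<beta>} y * \<rho> y * S y + indicator {-\<beta>..\<beta>} y * \<rho> y * S (- y) =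
        indicator {-\<beta>..\<beta>} y * \<rho> y * (S y + S (- y))" by (simp add: algebra_simps)
      then show ?thesis using SS[OF True] by simp
    next
      case False
      then have "y = \<beta> \<or> y = -\<beta> \<or> y \<notin> {-\<beta>..\<beta>}" by auto
      then show ?thesis by (auto simp: \<rho>_def)
    qed
  qed
  also have "\<dots> = real j * (\<beta> powr (2 * \<mu> + 1) * gegenbauer_mass \<mu>)"
    using scaled_beta_integral(2)[OF \<mu> \<beta>] by (simp add: set_lebesgue_integral_def \<rho>_def)
  finally show "?I = (if j = 0 then 0 else gegenbauer_mass \<mu> / 2 * (2 * (r\<^sup>2 - t\<^sup>2)) powr (2 * \<mu> + 1))"
    using j by (cases "j = 0") (auto simp: \<beta>_def le_Suc_eq field_simps)
qed

section \<open>Moments\<close>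

text \<open>The class is wide enough for the mean of a function with merely continuous profile, and
  for \<open>g\<close> multiplied by powers of u; both are compared with test functions
  below.\<close>

definition tame :: "(real \<Rightarrow> real) \<Rightarrow> bool" where
  "tame g \<longleftrightarrow> continuous_on UNIV g \<and> (\<exists>\<epsilon>>0. \<forall>u. g u \<noteq> 0 \<longrightarrow> \<epsilon> \<le> u \<and> u \<le> 2 - \<epsilon>)"

definition mom :: "real \<Rightarrow> (real \<Rightarrow> real) \<Rightarrow> real \<Rightarrow> real" where
  "mom \<mu> g t = (\<integral>u. u * g u * pker \<mu> t u \<partial>lborel)"

lemma tame_mult: "tame g \<Longrightarrow> continuous_on UNIV c \<Longrightarrow> tame (\<lambda>u. c u * g u)"
  unfolding tame_def by (auto intro!: continuous_intros)

lemma tame_diff: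
  assumes "tame f" "tame g"
  shows "tame (\<lambda>u. f u - g u)"
proof -
  obtain a b where ab: "a > 0" "b > 0" "\<And>u. f u \<noteq> 0 \<Longrightarrow> a \<le> u \<and> u \<le> 2 - a"
     "\<And>u. g u \<noteq> 0 \<Longrightarrow> b \<le> u \<and> u \<le> 2 - b"
    using assms unfolding tame_def by blast
  have "min a b \<le> u \<and> u \<le> 2 - min a b" if "f u - g u \<noteq> 0" for u
    using ab(3)[of u] ab(4)[of u] that by (cases "f u = 0") auto
  then show ?thesis using assms ab(1,2) unfolding tame_def
    by (auto intro!: continuous_intros exI[of _ "min a b"])
qed

lemma tame_bounded:
  assumes "tame g"
  obtains B where "\<And>u. \<bar>g u\<bar> \<le> B" "B \<ge> 0"
proof -
  have "continuous_on {0..2} g" using assms unfolding tame_def by (auto intro: continuous_on_subset)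
  then have "bounded (g ` {0..2})" by (intro compact_imp_bounded compact_continuous_image) auto
  then obtain B where B: "\<forall>z\<in>g ` {0..2}. norm z \<le> B" unfolding bounded_iff by blast
  have "\<bar>g u\<bar> \<le> max B 0" for u
  proof (cases "u \<in> {0..2}")
    case False
    then have "g u = 0" using assms unfolding tame_def by force
    then show ?thesis by simp
  qed (use B in force)
  then show ?thesis by (intro that[of "max B 0"]) auto
qed

lemma pker_measurable [measurable]:
  assumes [measurable]: "f \<in> borel_measurable M" "h \<in> borel_measurable M"
  shows "(\<lambda>x. pker \<mu> (f x) (h x)) \<in> borel_measurable M"
  unfolding pker_def Pq_def by measurable

lemma kker_measurable [measurable]:
  assumes [measurable]: "f \<in> borel_measurable M" "h \<in> borel_measurable M"
  shows "(\<lambda>x. kker \<mu> (f x) (h x)) \<in> borel_measurable M"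
  unfolding kker_def Pq_def by measurable

lemma tame_measurable: "tame g \<Longrightarrow> g \<in> borel_measurable borel"
  unfolding tame_def by (auto intro: borel_measurable_continuous_onI)

lemma powr_le_sum_ends:
  fixes a b z \<mu> :: real
  assumes "0 < a" "a \<le> z" "z \<le> b"
  shows "z powr \<mu> \<le> a powr \<mu> + b powr \<mu>"
proof (cases "\<mu> \<ge> 0")
  case True
  then have "z powr \<mu> \<le> b powr \<mu>" using assms by (intro powr_mono2) auto
  then show ?thesis by (simp add: add_increasing)
next
  case False
  then have "z powr \<mu> \<le> a powr \<mu>" using assms by (intro powr_mono2') auto
  then show ?thesis by (simp add: add_increasing2)
qed

lemma Pq_pos:
  assumes "0 \<le> t" "t < \<bar>u - 1\<bar>" "0 < u"
  shows "Pq u t > 0"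
proof -
  have "t\<^sup>2 < \<bar>u - 1\<bar>\<^sup>2" using assms by (intro power_strict_mono) auto
  moreover have "t\<^sup>2 < (1 + u)\<^sup>2" using assms by (intro power_strict_mono) auto
  ultimately show ?thesis by (simp add: Pq_def power2_commute[of 1 u])
qed

lemma pker_integrable:
  assumes \<mu>: "\<mu> > -1" and t: "0 < t" "t < 1"
  shows "integrable lborel (pker \<mu> t)"
proof -
  \<comment> \<open>The only factor of \<open>Pq u t\<close> that vanishes on the boundary of the
    region is \<open>\<bar>u - 1\<bar> - t\<close>. The product \<open>A\<close> of the others lies
    between \<open>t * (1 - t\<^sup>2)\<close> and \<open>2 * 9\<close>, so its power is at most the
    sum of the powers of these two bounds.\<close>
  define C where "C = (t * (1 - t\<^sup>2)) powr \<mu> + (2 * 9) powr \<mu>"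
  have t2: "t\<^sup>2 < 1" using t by (simp add: power_less_one_iff)
  have "integrable lborel (\<lambda>u. C * (indicator {1+t<..<2} u * (u - (1+t)) powr \<mu>
      + indicator {0<..<1-t} u * ((1-t) - u) powr \<mu>))"
    by (intro integrable_mult_right Bochner_Integration.integrable_add
        integrable_powr_left[OF \<mu>] integrable_powr_right[OF \<mu>])
  then show ?thesis
  proof (rule Bochner_Integration.integrable_bound)
    show "AE u in lborel. norm (pker \<mu> t u) \<le> norm (C * (indicator {1+t<..<2} u * (u - (1+t)) powr \<mu>
      + indicator {0<..<1-t} u * ((1-t) - u) powr \<mu>))"
    proof (rule AE_I2)
      fix u :: real
      show "norm (pker \<mu> t u) \<le> norm (C * (indicator {1+t<..<2} u * (u - (1+t)) powr \<mu>
      + indicator {0<..<1-t} u * ((1-t) - u) powr \<mu>))"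
      proof (cases "t < \<bar>u - 1\<bar> \<and> 0 < u \<and> u < 2")
        case True
        define A where "A = (\<bar>u - 1\<bar> + t) * ((1 + u)\<^sup>2 - t\<^sup>2)"
        have "1 \<le> (1 + u)\<^sup>2" using True by simp
        moreover have "(1 + u)\<^sup>2 \<le> 9"
          using True power_mono[of "1 + u" 3 2] by simp
        moreover have "0 \<le> t\<^sup>2" by simp
        ultimately have "1 - t\<^sup>2 \<le> (1 + u)\<^sup>2 - t\<^sup>2" "(1 + u)\<^sup>2 - t\<^sup>2 \<le> 9" by linarith+
        then have "t * (1 - t\<^sup>2) \<le> A" "A \<le> 2 * 9" unfolding A_def
          using True t t2 by (intro mult_mono; auto)+
        then have "A powr \<mu> \<le> C" unfolding C_def using t t2 by (intro powr_le_sum_ends) auto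
        moreover have "Pq u t = A * (\<bar>u - 1\<bar> - t)"
          unfolding Pq_def A_def using True by (auto simp: abs_if power2_eq_square algebra_simps)
        then have "Pq u t powr \<mu> = A powr \<mu> * (\<bar>u - 1\<bar> - t) powr \<mu>"
          by (simp add: powr_mult)
        ultimately have "Pq u t powr \<mu> \<le> C * (\<bar>u - 1\<bar> - t) powr \<mu>"
          by (simp add: mult_right_mono)
        moreover have "C \<ge> 0" by (simp add: C_def)
        moreover have "norm (pker \<mu> t u) = Pq u t powr \<mu>"
          using True t by (auto simp: pker_def abs_mult sgn_if)
        moreover have "indicator {1+t<..<2} u * (u - (1+t)) powr \<mu>
      + indicator {0<..<1-t} u * ((1-t) - u) powr \<mu> = (\<bar>u - 1\<bar> - t) powr \<mu>"
          using True t by (auto simp: indicator_def abs_if algebra_simps)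
        ultimately show ?thesis by (simp add: abs_mult)
      qed (auto simp: pker_def)
    qed
  qed measurable
qed

lemma pker_mult_integrable:
  assumes \<mu>: "\<mu> > -1" and t: "0 < t" "t < 1" and f: "f \<in> borel_measurable borel"
    and B: "\<And>u. 0 < u \<Longrightarrow> u < 2 \<Longrightarrow> \<bar>f u\<bar> \<le> B"
  shows "integrable lborel (\<lambda>u. f u * pker \<mu> t u)"
proof (rule Bochner_Integration.integrable_bound)
  show "integrable lborel (\<lambda>u. B * pker \<mu> t u)"
    using pker_integrable[OF \<mu> t] by simp
  show "AE u in lborel. norm (f u * pker \<mu> t u) \<le> norm (B * pker \<mu> t u)"
  proof (rule AE_I2)
    fix u show "norm (f u * pker \<mu> t u) \<le> norm (B * pker \<mu> t u)"
    proof (cases "0 < u \<and> u < 2")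
      case True
      then have "\<bar>f u\<bar> \<le> \<bar>B\<bar>" using B[of u] by auto
      then show ?thesis by (simp add: abs_mult mult_right_mono)
    qed (auto simp: pker_def)
  qed
  show "(\<lambda>u. f u * pker \<mu> t u) \<in> borel_measurable lborel" using f by measurable
qed

lemma mom_integrable:
  assumes \<mu>: "\<mu> > -1" and t: "0 < t" "t < 1" and g: "tame g"
  shows "integrable lborel (\<lambda>u. u * g u * pker \<mu> t u)"
proof -
  obtain B where B: "\<And>u. \<bar>g u\<bar> \<le> B" "B \<ge> 0" using tame_bounded[OF g] by blast
  show ?thesis
  proof (rule pker_mult_integrable[OF \<mu> t, where B = "2 * B"])
    show "\<bar>u * g u\<bar> \<le> 2 * B" if "0 < u" "u < 2" for u
      unfolding abs_mult using that B by (intro mult_mono) auto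
  qed (use tame_measurable[OF g] in measurable)
qed

section \<open>Raising the exponent\<close>

lemma pker_Suc:
  assumes "0 \<le> t"
  shows "pker (\<mu> + 1) t u = Pq u t * pker \<mu> t u"
proof (cases "t < \<bar>u - 1\<bar> \<and> 0 < u")
  case True
  then show ?thesis using Pq_pos[OF assms, of u] by (simp add: pker_def powr_add)
qed (auto simp: pker_def)

text \<open>The algebraic expression for the raised moment: \<open>Pq u t\<close> equals u^4 - 2 (1
  + t^2) u^2 + (1 - t^2)^2.\<close>

lemma mom_Suc:
  assumes \<mu>: "\<mu> > -1" and t: "0 < t" "t < 1" and g: "tame g"
  shows "mom (\<mu> + 1) g t = mom \<mu> (\<lambda>u. u ^ 4 * g u) t - 2 * (1 + t\<^sup>2) * mom \<mu> (\<lambda>u. u\<^sup>2 * g u) t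
     + (1 - t\<^sup>2)\<^sup>2 * mom \<mu> g t"
proof -
  have eq: "u * g u * pker (\<mu> + 1) t u = u * (u ^ 4 * g u) * pker \<mu> t u -
     2 * (1 + t\<^sup>2) * (u * (u\<^sup>2 * g u) * pker \<mu> t u) + (1 - t\<^sup>2)\<^sup>2 * (u * g u * pker \<mu> t u)" for u
    using t by (simp add: pker_Suc Pq_def) algebra
  have i: "integrable lborel (\<lambda>u. u * (u ^ k * g u) * pker \<mu> t u)" for k
    by (intro mom_integrable[OF \<mu> t] tame_mult[OF g] continuous_intros)
  have "has_bochner_integral lborel (\<lambda>u. u * (u ^ 4 * g u) * pker \<mu> t u -
     2 * (1 + t\<^sup>2) * (u * (u\<^sup>2 * g u) * pker \<mu> t u) + (1 - t\<^sup>2)\<^sup>2 * (u * g u * pker \<mu> t u))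
     (mom \<mu> (\<lambda>u. u ^ 4 * g u) t - 2 * (1 + t\<^sup>2) * mom \<mu> (\<lambda>u. u\<^sup>2 * g u) t
     + (1 - t\<^sup>2)\<^sup>2 * mom \<mu> g t)"
    using i[of 4] i[of 2] mom_integrable[OF \<mu> t g]
    by (intro has_bochner_integral_add has_bochner_integral_diff has_bochner_integral_mult_right)
      (auto simp: has_bochner_integral_iff mom_def)
  then show ?thesis unfolding mom_def[of "\<mu> + 1"] eq by (rule has_bochner_integral_integral_eq)
qed

text \<open>The fundamental theorem of calculus in the variable \<open>\<tau>\<close>, for an integrand that is
  unbounded at the upper end when \<open>\<mu> < 0\<close>.\<close>

lemma pker_raise:
  assumes \<mu>: "\<mu> > -1" and t: "0 < t" "t < 1"
  shows "has_bochner_integral lborel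
    (\<lambda>\<tau>. indicator {t<..<1} \<tau> * (4 * (\<mu> + 1) * \<tau> * (1 + u\<^sup>2 - \<tau>\<^sup>2) * pker \<mu> \<tau> u)) (pker (\<mu> + 1) t u)"
proof (cases "t < \<bar>u - 1\<bar> \<and> 0 < u \<and> u < 2")
  case False
  then have "(\<lambda>\<tau>. indicator {t<..<1} \<tau> * (4 * (\<mu> + 1) * \<tau> * (1 + u\<^sup>2 - \<tau>\<^sup>2) * pker \<mu> \<tau> u)) = (\<lambda>_. 0)"
    by (auto simp: pker_def fun_eq_iff indicator_def)
  then show ?thesis using False by (auto simp: pker_def)
next
  case True
  define d where "d = \<bar>u - 1\<bar>"
  have d: "t < d" "d < 1" "d\<^sup>2 = (1 - u)\<^sup>2" using True by (auto simp: d_def power2_commute)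
  define f where "f \<tau> = 4 * (\<mu> + 1) * \<tau> * (1 + u\<^sup>2 - \<tau>\<^sup>2) * Pq u \<tau> powr \<mu>" for \<tau>
  \<comment> \<open>For fixed u the kernel lives on \<tau> < d, and \<open>Pq u d = 0\<close>
    because d = \<open>\<bar>u - 1\<bar>\<close>; hence only the lower limit t contributes.\<close>
  have "(f has_integral (- (Pq u d powr (\<mu> + 1)) - - (Pq u t powr (\<mu> + 1)))) {t..d}"
  proof (rule fundamental_theorem_of_calculus_interior)
    show "continuous_on {t..d} (\<lambda>\<tau>. - (Pq u \<tau> powr (\<mu> + 1)))"
    proof (intro continuous_on_minus continuous_on_powr' ballI conjI impI)
      fix \<tau> assume \<tau>: "\<tau> \<in> {t..d}"
      then have "\<tau>\<^sup>2 \<le> d\<^sup>2" "\<tau>\<^sup>2 \<le> (1 + u)\<^sup>2"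
        using t True d_def by (intro power_mono; force)+
      then show "0 \<le> Pq u \<tau>" unfolding Pq_def by (simp add: d(3))
    qed (use \<mu> in \<open>auto simp: Pq_def intro!: continuous_intros\<close>)
    fix \<tau> assume \<tau>: "\<tau> \<in> {t<..<d}"
    then have P: "Pq u \<tau> > 0" using t True by (intro Pq_pos) (auto simp: d_def)
    have "((\<lambda>\<tau>. Pq u \<tau>) has_real_derivative - (4 * \<tau> * (1 + u\<^sup>2 - \<tau>\<^sup>2))) (at \<tau>)"
      unfolding Pq_def by (auto intro!: derivative_eq_intros simp: power2_eq_square algebra_simps)
    from DERIV_fun_powr[OF this P, of "\<mu> + 1"] have "((\<lambda>\<tau>. - (Pq u \<tau> powr (\<mu> + 1))) has_real_derivative f \<tau>) (at \<tau>)"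
      by (intro DERIV_cong[OF DERIV_minus]) (auto simp: f_def algebra_simps)
    then show "((\<lambda>\<tau>. - (Pq u \<tau> powr (\<mu> + 1))) has_vector_derivative f \<tau>) (at \<tau>)"
      by (simp add: has_real_derivative_iff_has_vector_derivative)
  qed (use d in auto)
  moreover have "Pq u d = 0" by (simp add: Pq_def d(3))
  ultimately have hi: "(f has_integral Pq u t powr (\<mu> + 1)) {t..d}" by simp
  have fn: "f \<tau> \<ge> 0" if "\<tau> \<in> {t..d}" for \<tau>
  proof -
    have "\<tau>\<^sup>2 \<le> 1" using that d t by (auto simp: power_le_one_iff)
    then have "0 \<le> 1 + u\<^sup>2 - \<tau>\<^sup>2" by (simp add: add_increasing2)
    then show ?thesis unfolding f_def using that t \<mu> by (intro mult_nonneg_nonneg) auto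
  qed
  have fm: "(\<lambda>\<tau>. indicator {t..d} \<tau> *\<^sub>R f \<tau>) \<in> borel_measurable borel"
    unfolding f_def Pq_def by measurable
  have "f absolutely_integrable_on {t..d}"
    using hi fn by (intro nonnegative_absolutely_integrable_1) auto
  then have si: "set_integrable lborel {t..d} f"
    unfolding set_integrable_def using fm by (subst (asm) integrable_completion) auto
  have "(LBINT \<tau>:{t..d}. f \<tau>) = Pq u t powr (\<mu> + 1)"
    using set_borel_integral_eq_integral(2)[OF si] hi by (simp add: integral_unique)
  then have hb: "has_bochner_integral lborel (\<lambda>\<tau>. indicator {t..d} \<tau> *\<^sub>R f \<tau>) (Pq u t powr (\<mu> + 1))"
    using si by (simp add: has_bochner_integral_iff set_integrable_def set_lebesgue_integral_def)
  have "has_bochner_integral lborel (\<lambda>\<tau>. sgn (u - 1) * (indicator {t..d} \<tau> *\<^sub>R f \<tau>)) (sgn (u - 1) * Pq u t powr (\<mu> + 1))"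
    using hb by (rule has_bochner_integral_mult_right)
  moreover have "AE \<tau> in lborel. sgn (u - 1) * (indicator {t..d} \<tau> *\<^sub>R f \<tau>) =
     indicator {t<..<1} \<tau> * (4 * (\<mu> + 1) * \<tau> * (1 + u\<^sup>2 - \<tau>\<^sup>2) * pker \<mu> \<tau> u)"
    using AE_lborel_singleton[of t] AE_lborel_singleton[of d]
  proof eventually_elim
    case (elim \<tau>)
    then consider "t < \<tau>" "\<tau> < d" | "\<tau> < t" | "d < \<tau>" by fastforce
    then show ?case using True d by cases (auto simp: f_def pker_def d_def)
  qed
  moreover have "(\<lambda>\<tau>. sgn (u - 1) * (indicator {t..d} \<tau> *\<^sub>R f \<tau>)) \<in> borel_measurable lborel"
    using fm by (intro borel_measurable_times) auto
  moreover have "(\<lambda>\<tau>. indicator {t<..<1} \<tau> * (4 * (\<mu> + 1) * \<tau> * (1 + u\<^sup>2 - \<tau>\<^sup>2) * pker \<mu> \<tau> u))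
     \<in> borel_measurable lborel"
    by measurable
  moreover have "pker (\<mu> + 1) t u = sgn (u - 1) * Pq u t powr (\<mu> + 1)"
    using True by (simp add: pker_def)
  ultimately show ?thesis
    by (simp only: has_bochner_integral_cong_AE)
qed

text \<open>The analytic expression for the raised moment: \<open>pker_raise\<close> is integrated
  against \<open>u * g u\<close>, and 1 + u^2 - \<tau>^2 is split as (1 - \<tau>^2) + u^2, so the
  integrand contains just the first two even moments.\<close>

lemma mom_raise:
  assumes \<mu>: "\<mu> > -1" and t: "0 < t" "t < 1" and g: "tame g"
  shows "has_bochner_integral lborel (\<lambda>\<tau>. indicator {t<..<1} \<tau> *
      (4 * (\<mu> + 1) * \<tau> * ((1 - \<tau>\<^sup>2) * mom \<mu> g \<tau> + mom \<mu> (\<lambda>u. u\<^sup>2 * g u) \<tau>))) (mom (\<mu> + 1) g t)"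
proof -
  define k where "k \<tau> u = indicator {t<..<1} \<tau> * (4 * (\<mu> + 1) * \<tau> * (1 + u\<^sup>2 - \<tau>\<^sup>2) * pker \<mu> \<tau> u)" for \<tau> u
  have [measurable]: "g \<in> borel_measurable borel" using tame_measurable[OF g] .
  let ?F = "\<lambda>(u, \<tau>). u * g u * k \<tau> u"
  have meas: "?F \<in> borel_measurable (lborel \<Otimes>\<^sub>M lborel)"
    unfolding k_def by measurable
  have k: "has_bochner_integral lborel (\<lambda>\<tau>. k \<tau> u) (pker (\<mu> + 1) t u)" for u
    unfolding k_def by (rule pker_raise[OF \<mu> t])
  \<comment> \<open>For fixed u the kernel has one sign in \<tau>, so the \<tau>-integral of its
    absolute value is again known exactly. This gives the absolute integrability that Fubini asks
    for.\<close>
  have kabs: "\<bar>k \<tau> u\<bar> = (if u < 1 then - 1 else 1) * k \<tau> u" for \<tau> u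
  proof (cases "t < \<tau> \<and> \<tau> < 1")
    case True
    then have "\<tau>\<^sup>2 \<le> 1" using t by (auto simp: power_le_one_iff)
    then have "0 \<le> 1 + u\<^sup>2 - \<tau>\<^sup>2" by (simp add: add_increasing2)
    then have p: "0 \<le> 4 * (\<mu> + 1) * \<tau> * (1 + u\<^sup>2 - \<tau>\<^sup>2)" using True t \<mu> by simp
    define c where "c = 4 * (\<mu> + 1) * \<tau> * (1 + u\<^sup>2 - \<tau>\<^sup>2)"
    have "k \<tau> u = c * pker \<mu> \<tau> u" using True by (simp add: k_def c_def)
    moreover have "0 \<le> c" using p by (simp add: c_def)
    ultimately have "\<bar>k \<tau> u\<bar> = c * \<bar>pker \<mu> \<tau> u\<bar>" by (simp add: abs_mult)
    also have "\<bar>pker \<mu> \<tau> u\<bar> = (if u < 1 then - 1 else 1) * pker \<mu> \<tau> u"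
      by (simp add: pker_def sgn_if)
    finally show ?thesis using True by (simp add: k_def c_def)
  qed (auto simp: k_def)
  have int: "integrable (lborel \<Otimes>\<^sub>M lborel) ?F"
  proof (rule lborel_pair.Fubini_integrable[OF meas])
    show "AE u in lborel. integrable lborel (\<lambda>\<tau>. ?F (u, \<tau>))"
      using k by (auto simp: has_bochner_integral_iff)
    have "(\<integral>\<tau>. norm (?F (u, \<tau>)) \<partial>lborel) = \<bar>u * g u * pker (\<mu> + 1) t u\<bar>" for u
    proof -
      have "(\<integral>\<tau>. norm (?F (u, \<tau>)) \<partial>lborel) =
         (\<integral>\<tau>. (\<bar>u * g u\<bar> * (if u < 1 then - 1 else 1)) * k \<tau> u \<partial>lborel)"
        by (simp add: abs_mult kabs)
      also have "\<dots> = (\<bar>u * g u\<bar> * (if u < 1 then - 1 else 1)) * pker (\<mu> + 1) t u"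
        using k[of u] by (simp add: has_bochner_integral_iff)
      also have "\<dots> = \<bar>u * g u\<bar> * \<bar>pker (\<mu> + 1) t u\<bar>"
        by (simp add: pker_def sgn_if)
      finally show ?thesis by (simp add: abs_mult)
    qed
    then show "integrable lborel (\<lambda>u. \<integral>\<tau>. norm (?F (u, \<tau>)) \<partial>lborel)"
      using mom_integrable[of "\<mu> + 1" t g] \<mu> t g by simp
  qed
  have inner: "(\<integral>u. u * g u * k \<tau> u \<partial>lborel) = indicator {t<..<1} \<tau> *
      (4 * (\<mu> + 1) * \<tau> * ((1 - \<tau>\<^sup>2) * mom \<mu> g \<tau> + mom \<mu> (\<lambda>u. u\<^sup>2 * g u) \<tau>))" for \<tau>
  proof (cases "t < \<tau> \<and> \<tau> < 1")
    case True
    then have \<tau>: "0 < \<tau>" "\<tau> < 1" using t by auto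
    have i1: "integrable lborel (\<lambda>u. u * g u * pker \<mu> \<tau> u)" by (rule mom_integrable[OF \<mu> \<tau> g])
    have i2: "integrable lborel (\<lambda>u. u * (u\<^sup>2 * g u) * pker \<mu> \<tau> u)"
      by (intro mom_integrable[OF \<mu> \<tau>] tame_mult g continuous_intros)
    have "u * g u * k \<tau> u = 4 * (\<mu> + 1) * \<tau> * ((1 - \<tau>\<^sup>2) * (u * g u * pker \<mu> \<tau> u) + u * (u\<^sup>2 * g u) * pker \<mu> \<tau> u)" for u
      unfolding k_def using True by (simp add: algebra_simps)
    then have "(\<integral>u. u * g u * k \<tau> u \<partial>lborel) = 4 * (\<mu> + 1) * \<tau> *
        (\<integral>u. (1 - \<tau>\<^sup>2) * (u * g u * pker \<mu> \<tau> u) + u * (u\<^sup>2 * g u) * pker \<mu> \<tau> u \<partial>lborel)"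
      by simp
    also have "(\<integral>u. (1 - \<tau>\<^sup>2) * (u * g u * pker \<mu> \<tau> u) + u * (u\<^sup>2 * g u) * pker \<mu> \<tau> u \<partial>lborel) =
       (1 - \<tau>\<^sup>2) * mom \<mu> g \<tau> + mom \<mu> (\<lambda>u. u\<^sup>2 * g u) \<tau>"
      unfolding mom_def using i1 i2 by (subst Bochner_Integration.integral_add) auto
    finally show ?thesis using True by simp
  qed (auto simp: k_def)
  have "(\<integral>\<tau>. (\<integral>u. u * g u * k \<tau> u \<partial>lborel) \<partial>lborel) = (\<integral>u. (\<integral>\<tau>. u * g u * k \<tau> u \<partial>lborel) \<partial>lborel)"
    using lborel_pair.Fubini_integral[OF int] by simp
  also have "\<dots> = mom (\<mu> + 1) g t"
    unfolding mom_def using k by (intro Bochner_Integration.integral_cong) (auto simp: has_bochner_integral_iff)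
  finally have e: "(\<integral>\<tau>. (\<integral>u. u * g u * k \<tau> u \<partial>lborel) \<partial>lborel) = mom (\<mu> + 1) g t" .
  have "integrable lborel (\<lambda>\<tau>. (\<integral>u. u * g u * k \<tau> u \<partial>lborel))"
    using lborel_pair.integrable_snd[OF int] by simp
  with e show ?thesis unfolding inner by (simp add: has_bochner_integral_iff)
qed

lemma mom_raise_zero:
  assumes \<mu>: "\<mu> > -1" and t: "0 < t" "t < 1" and g: "tame g"
    and z: "\<And>\<tau>. 0 < \<tau> \<Longrightarrow> \<tau> < 1 \<Longrightarrow> mom \<mu> g \<tau> = 0 \<and> mom \<mu> (\<lambda>u. u\<^sup>2 * g u) \<tau> = 0"
  shows "mom (\<mu> + 1) g t = 0"
proof -
  have "(\<lambda>\<tau>. indicator {t<..<1} \<tau> *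
      (4 * (\<mu> + 1) * \<tau> * ((1 - \<tau>\<^sup>2) * mom \<mu> g \<tau> + mom \<mu> (\<lambda>u. u\<^sup>2 * g u) \<tau>))) = (\<lambda>_. 0)"
    using z t by (auto simp: indicator_def fun_eq_iff)
  then show ?thesis using mom_raise[OF \<mu> t g] by (simp add: has_bochner_integral_iff)
qed

text \<open>If the moments with u^0 and u^2 vanish, then so does the raised moment by
  \<open>mom_raise\<close>, and \<open>mom_Suc\<close> isolates the one with u^4. Passing from
  \<open>g\<close> to u^2 \<open>g\<close> repeats the step, hence the induction over pairs of
  consecutive moments.\<close>

lemma all_moments_zero:
  assumes \<mu>: "\<mu> > -1" and g: "tame g"
    and z: "\<And>\<tau>. 0 < \<tau> \<Longrightarrow> \<tau> < 1 \<Longrightarrow> mom \<mu> g \<tau> = 0 \<and> mom \<mu> (\<lambda>u. u\<^sup>2 * g u) \<tau> = 0"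
  shows "0 < t \<Longrightarrow> t < 1 \<Longrightarrow> mom \<mu> (\<lambda>u. u ^ (2 * j) * g u) t = 0"
proof -
  have "\<forall>t. 0 < t \<and> t < 1 \<longrightarrow> mom \<mu> (\<lambda>u. u ^ (2 * j) * g u) t = 0 \<and>
     mom \<mu> (\<lambda>u. u ^ (2 * Suc j) * g u) t = 0" for j
  proof (induction j)
    case 0
    then show ?case using z by (simp add: power2_eq_square)
  next
    case (Suc j)
    define f where "f = (\<lambda>u. u ^ (2 * j) * g u)"
    have f: "tame f" unfolding f_def by (intro tame_mult[OF g] continuous_intros)
    have e: "(\<lambda>u. u\<^sup>2 * f u) = (\<lambda>u. u ^ (2 * Suc j) * g u)"
      "(\<lambda>u. u ^ 4 * f u) = (\<lambda>u. u ^ (2 * Suc (Suc j)) * g u)"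
      by (simp_all add: f_def fun_eq_iff power2_eq_square power4_eq_xxxx)
    have z': "mom \<mu> f \<tau> = 0 \<and> mom \<mu> (\<lambda>u. u\<^sup>2 * f u) \<tau> = 0" if "0 < \<tau>" "\<tau> < 1" for \<tau>
      using Suc that unfolding e unfolding f_def by blast
    show ?case
    proof (intro allI impI)
      fix t :: real assume t: "0 < t \<and> t < 1"
      have "mom (\<mu> + 1) f t = 0" using mom_raise_zero[OF \<mu> _ _ f z'] t by blast
      then have "mom \<mu> (\<lambda>u. u ^ 4 * f u) t = 0"
        using mom_Suc[OF \<mu> _ _ f, of t] z'[of t] t by simp
      then show "mom \<mu> (\<lambda>u. u ^ (2 * Suc j) * g u) t = 0 \<and> mom \<mu> (\<lambda>u. u ^ (2 * Suc (Suc j)) * g u) t = 0"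
        using z'[of t] t unfolding e by blast
    qed
  qed
  then show "0 < t \<Longrightarrow> t < 1 \<Longrightarrow> mom \<mu> (\<lambda>u. u ^ (2 * j) * g u) t = 0" by blast
qed

section \<open>Two moments determine a function\<close>

text \<open>On [0, 2] the square is injective, so \<open>\<psi>\<close> is a continuous function of
  v = u^2 on [0, 4] and Weierstrass approximates it uniformly by polynomials in u^2. The function
  \<open>f\<close> is only integrable, which suits the unbounded kernels of negative
  exponent.\<close>

lemma even_moments_determine:
  fixes f \<psi> :: "real \<Rightarrow> real"
  assumes f: "integrable lborel f" and supp: "\<And>u. f u \<noteq> 0 \<Longrightarrow> 0 \<le> u \<and> u \<le> 2"
    and m: "\<And>j. (\<integral>u. u ^ (2 * j) * f u \<partial>lborel) = 0"
    and \<psi>: "continuous_on {0..2} \<psi>" and i: "integrable lborel (\<lambda>u. \<psi> u * f u)"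
  shows "(\<integral>u. \<psi> u * f u \<partial>lborel) = 0"
proof -
  let ?N = "\<integral>u. norm (f u) \<partial>lborel"
  have pint: "integrable lborel (\<lambda>u. u ^ k * f u)" for k
  proof (rule Bochner_Integration.integrable_bound)
    show "integrable lborel (\<lambda>u. 2 ^ k * f u)" using f by simp
    show "AE u in lborel. norm (u ^ k * f u) \<le> norm (2 ^ k * f u)"
    proof (rule AE_I2)
      fix u show "norm (u ^ k * f u) \<le> norm (2 ^ k * f u)"
        using supp[of u] by (cases "f u = 0") (auto simp: abs_mult power_abs intro!: power_mono mult_right_mono)
    qed
  qed (use f in \<open>auto intro!: borel_measurable_times dest: borel_measurable_integrable\<close>)
  have bound: "\<bar>\<integral>u. \<psi> u * f u \<partial>lborel\<bar> \<le> e * ?N" if e: "e > 0" for e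
  proof -
    have "continuous_on {0..4} (\<lambda>v. \<psi> (sqrt v))"
      by (intro continuous_on_compose2[OF \<psi>] continuous_intros)
        (auto intro!: real_le_lsqrt)
    then obtain p where p: "real_polynomial_function p" "\<And>v. v \<in> {0..4} \<Longrightarrow> \<bar>\<psi> (sqrt v) - p v\<bar> < e"
      using Stone_Weierstrass_real_polynomial_function[of "{0..4}" "\<lambda>v. \<psi> (sqrt v)" e] e by auto
    obtain a n where a: "p = (\<lambda>x. \<Sum>i\<le>n. a i * x ^ i)"
      using p(1) unfolding real_polynomial_function_iff_sum by blast
    have pe: "p (u\<^sup>2) * f u = (\<Sum>i\<le>n. a i * (u ^ (2 * i) * f u))" for u
      by (simp add: a sum_distrib_right power_mult mult.assoc)
    have ip: "integrable lborel (\<lambda>u. p (u\<^sup>2) * f u)" unfolding pe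
      by (intro Bochner_Integration.integrable_sum integrable_mult_right pint)
    have "(\<integral>u. p (u\<^sup>2) * f u \<partial>lborel) = 0" unfolding pe
      using pint m by (subst Bochner_Integration.integral_sum) auto
    then have "(\<integral>u. \<psi> u * f u \<partial>lborel) = (\<integral>u. \<psi> u * f u - p (u\<^sup>2) * f u \<partial>lborel)"
      using i ip by (subst Bochner_Integration.integral_diff) auto
    also have "\<bar>\<dots>\<bar> \<le> (\<integral>u. norm (\<psi> u * f u - p (u\<^sup>2) * f u) \<partial>lborel)"
      using integral_norm_bound[of lborel "\<lambda>u. \<psi> u * f u - p (u\<^sup>2) * f u"] by simp
    also have "\<dots> \<le> (\<integral>u. e * norm (f u) \<partial>lborel)"
    proof (rule integral_mono)
      fix u
      show "norm (\<psi> u * f u - p (u\<^sup>2) * f u) \<le> e * norm (f u)"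
      proof (cases "f u = 0")
        case False
        then have u: "0 \<le> u" "u \<le> 2" using supp by auto
        have "u\<^sup>2 \<le> 2\<^sup>2" using u by (intro power_mono) auto
        then have "\<bar>\<psi> u - p (u\<^sup>2)\<bar> \<le> e" using p(2)[of "u\<^sup>2"] u by simp
        then have "\<bar>\<psi> u - p (u\<^sup>2)\<bar> * \<bar>f u\<bar> \<le> e * \<bar>f u\<bar>" by (intro mult_right_mono) auto
        then show ?thesis by (simp add: left_diff_distrib flip: abs_mult)
      qed auto
    qed (use i ip f in auto)
    finally show ?thesis by simp
  qed
  have "?N \<ge> 0" by simp
  have "\<bar>\<integral>u. \<psi> u * f u \<partial>lborel\<bar> \<le> 0"
  proof (rule field_le_epsilon)
    fix e :: real assume "e > 0"
    then have "\<bar>\<integral>u. \<psi> u * f u \<partial>lborel\<bar> \<le> e / (?N + 1) * ?N"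
      using \<open>?N \<ge> 0\<close> by (intro bound divide_pos_pos add_nonneg_pos) auto
    also have "\<dots> = e * (?N / (?N + 1))" by simp
    also have "\<dots> \<le> e * 1"
    proof (rule mult_left_mono)
      have "?N + 1 > 0" using \<open>?N \<ge> 0\<close> by linarith
      then show "?N / (?N + 1) \<le> 1" by (subst divide_le_eq_1_pos) auto
    qed (use \<open>e > 0\<close> in auto)
    finally show "\<bar>\<integral>u. \<psi> u * f u \<partial>lborel\<bar> \<le> 0 + e" by simp
  qed
  then show ?thesis by simp
qed

text \<open>One value of t suffices for a given u: all even moments of
  \<open>v * g v * pker \<mu> t v\<close> vanish, and pairing this function with a continuous
  \<open>\<psi>\<close> of the same sign gives a nonnegative integrand with integral 0. The point u
  = 1 is outside the support of every kernel with t > 0.\<close>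

lemma mom_zero_imp_zero:
  assumes \<mu>: "\<mu> > -1" and g: "tame g"
    and z: "\<And>\<tau>. 0 < \<tau> \<Longrightarrow> \<tau> < 1 \<Longrightarrow> mom \<mu> g \<tau> = 0 \<and> mom \<mu> (\<lambda>u. u\<^sup>2 * g u) \<tau> = 0"
    and u: "u \<noteq> 1"
  shows "g u = 0"
proof (rule ccontr)
  assume nz: "g u \<noteq> 0"
  have supp: "0 < v \<and> v < 2" if "g v \<noteq> 0" for v
    using g that unfolding tame_def by force
  have gc: "continuous_on A g" for A using g unfolding tame_def by (auto intro: continuous_on_subset)
  have [measurable]: "g \<in> borel_measurable borel" using tame_measurable[OF g] .
  \<comment> \<open>Half the distance places u strictly inside the region where the kernel is
    nonzero.\<close>
  define t where "t = \<bar>u - 1\<bar> / 2"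
  have t: "0 < t" "t < 1" using u supp[OF nz] by (auto simp: t_def)
  define f where "f v = v * g v * pker \<mu> t v" for v
  \<comment> \<open>This is \<open>g v\<close> times the sign of v - 1 times
    \<open>max (\<bar>v - 1\<bar> - t) 0\<close>: the sign cancels that of the kernel, and the
    truncation makes the jump at v = 1 disappear.\<close>
  define \<psi> where "\<psi> v = g v * max (v - 1 - t) 0 - g v * max (1 - v - t) 0" for v
  have f: "integrable lborel f" unfolding f_def by (rule mom_integrable[OF \<mu> t g])
  have \<psi>c: "continuous_on A \<psi>" for A unfolding \<psi>_def by (intro continuous_intros gc)
  have "tame \<psi>"
  proof -
    have "\<psi> = (\<lambda>v. (max (v - 1 - t) 0 - max (1 - v - t) 0) * g v)"
      by (auto simp: \<psi>_def algebra_simps)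
    moreover have "tame (\<lambda>v. (max (v - 1 - t) 0 - max (1 - v - t) 0) * g v)"
      by (intro tame_mult[OF g] continuous_intros)
    ultimately show ?thesis by simp
  qed
  then obtain B where B: "\<And>v. \<bar>\<psi> v\<bar> \<le> B" "B \<ge> 0" using tame_bounded by blast
  have i: "integrable lborel (\<lambda>v. \<psi> v * f v)"
  proof (rule Bochner_Integration.integrable_bound)
    show "integrable lborel (\<lambda>v. B * f v)" using f by simp
    show "AE v in lborel. norm (\<psi> v * f v) \<le> norm (B * f v)"
      using B by (auto simp: abs_mult intro!: mult_right_mono)
    show "(\<lambda>v. \<psi> v * f v) \<in> borel_measurable lborel" unfolding \<psi>_def f_def by measurable
  qed
  have "(\<integral>v. \<psi> v * f v \<partial>lborel) = 0"
  proof (rule even_moments_determine[OF f _ _ \<psi>c i])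
    show "0 \<le> v \<and> v \<le> 2" if "f v \<noteq> 0" for v using that supp[of v] by (auto simp: f_def)
    show "(\<integral>v. v ^ (2 * j) * f v \<partial>lborel) = 0" for j
      using all_moments_zero[OF \<mu> g z t, of j] by (simp add: mom_def f_def mult_ac)
  qed
  moreover have nn: "\<psi> v * f v = v * (g v)\<^sup>2 * \<bar>pker \<mu> t v\<bar> * max (\<bar>v - 1\<bar> - t) 0" for v
    using t by (auto simp: \<psi>_def f_def pker_def sgn_if power2_eq_square max_def)
  moreover have "\<psi> v * f v \<ge> 0" for v
    unfolding nn using supp[of v] by (cases "g v = 0") auto
  ultimately have ae: "AE v in lborel. \<psi> v * f v = 0"
    using i by (subst (asm) integral_nonneg_eq_0_iff_AE) auto
  define U where "U = {v. g v \<noteq> 0 \<and> t < \<bar>v - 1\<bar>}"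
  have "open {v. g v \<noteq> 0}" by (intro open_Collect_neq gc continuous_intros)
  moreover have "open {v::real. t < \<bar>v - 1\<bar>}" by (intro open_Collect_less continuous_intros)
  ultimately have "open U" unfolding U_def by (rule open_Collect_conj)
  moreover have "u \<in> U" using nz t u by (auto simp: U_def t_def)
  ultimately obtain e where e: "e > 0" "ball u e \<subseteq> U" by (meson open_contains_ball)
  have "\<psi> v * f v \<noteq> 0" if "v \<in> U" for v
  proof -
    have v: "g v \<noteq> 0" "t < \<bar>v - 1\<bar>" using that by (auto simp: U_def)
    have "Pq v t > 0" using t v supp[of v] by (intro Pq_pos) auto
    then show ?thesis unfolding nn using v t supp[OF v(1)] by (auto simp: pker_def sgn_if)
  qed
  then have "AE v in lborel. v \<notin> ball u e" using ae e by (auto elim!: eventually_mono)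
  then have "emeasure lborel (ball u e) = 0"
    by (subst (asm) AE_iff_measurable[of "ball u e"]) auto
  then show False using e by (simp add: emeasure_ball)
qed

section \<open>Moments of the mean of a radial function\<close>

text \<open>By the law of cosines r^2 = 1 + u^2 + 2 u z, so that r dr = u dz and
  \<open>- Pq u r\<close> = (2 u)^2 (1 - z^2). The Gegenbauer weight in z thus becomes
  \<open>kker\<close> in r.\<close>

lemma chord_substitution:
  fixes \<psi> :: "real \<Rightarrow> real"
  assumes u: "u > 0"
    and int: "set_integrable lborel {-1..1} (\<lambda>z. \<psi> (1 + u\<^sup>2 + 2 * u * z) * (1 - z\<^sup>2) powr \<mu>)"
  shows "has_bochner_integral lborel (\<lambda>r. r * \<psi> (r\<^sup>2) * kker \<mu> r u)
    (u * (2 * u) powr (2 * \<mu>) * (LBINT z:{-1..1}. \<psi> (1 + u\<^sup>2 + 2 * u * z) * (1 - z\<^sup>2) powr \<mu>))"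
proof -
  define f where "f z = \<psi> (1 + u\<^sup>2 + 2 * u * z) * (1 - z\<^sup>2) powr \<mu>" for z
  define q where "q r = (r\<^sup>2 - 1 - u\<^sup>2) / (2 * u)" for r
  let ?a = "\<bar>u - 1\<bar>" and ?b = "1 + u"
  have q1: "q ?a = -1" "q ?b = 1"
    using u by (simp_all add: q_def field_simps power2_eq_square)
  have dq: "(q has_real_derivative r / u) (at r)" for r
    unfolding q_def using u by (auto intro!: derivative_eq_intros simp: field_simps)
  have ab: "?a \<le> ?b" using u by auto
  note sub = integral_substitution[of q ?a ?b f "\<lambda>r. r / u", unfolded q1]
  have cont: "continuous_on {?a..?b} (\<lambda>r. r / u)" using u by (intro continuous_intros) auto
  have nn: "0 \<le> r / u" if "r \<in> {?a..?b}" for r using that u by auto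
  have s1: "set_integrable lborel {?a..?b} (\<lambda>r. f (q r) * (r / u))"
    and s2: "(LBINT z. f z * indicator {-1..1} z) = (LBINT r. f (q r) * (r / u) * indicator {?a..?b} r)"
    using sub[OF int[folded f_def] dq cont nn ab] by auto
  have eq: "r * \<psi> (r\<^sup>2) * kker \<mu> r u = u * (2 * u) powr (2 * \<mu>) * (f (q r) * (r / u) * indicator {?a..?b} r)" for r
  proof (cases "r \<in> {?a<..<?b}")
    case True
    have r: "1 + u\<^sup>2 + 2 * u * q r = r\<^sup>2" using u by (simp add: q_def)
    have "- Pq u r = (2 * u)\<^sup>2 * (1 - (q r)\<^sup>2)"
    proof -
      have "r\<^sup>2 = 1 + u\<^sup>2 + 2 * u * q r" by (rule r[symmetric])
      then show ?thesis unfolding Pq_def by algebra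
    qed
    moreover have "((2 * u)\<^sup>2) powr \<mu> = (2 * u) powr (2 * \<mu>)"
    proof -
      have "(2 * u)\<^sup>2 = (2 * u) powr 2" using u by (subst powr_numeral) auto
      then show ?thesis by (simp only: powr_powr)
    qed
    ultimately have "(- Pq u r) powr \<mu> = (2 * u) powr (2 * \<mu>) * (1 - (q r)\<^sup>2) powr \<mu>"
      by (simp only: powr_mult)
    then show ?thesis using True u by (simp add: kker_def f_def r)
  next
    case False
    then consider "r = ?a" | "r = ?b" | "r \<notin> {?a..?b}" by fastforce
    then show ?thesis
    proof cases
      case 1
      then have "q r = -1" using q1 by simp
      then show ?thesis using 1 by (simp add: f_def kker_def)
    next
      case 2
      then have "q r = 1" using q1 by simp
      then show ?thesis using 2 by (simp add: f_def kker_def)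
    next
      case 3
      then show ?thesis by (auto simp: kker_def)
    qed
  qed
  have "has_bochner_integral lborel (\<lambda>r. f (q r) * (r / u) * indicator {?a..?b} r) (LBINT z:{-1..1}. f z)"
    using s1 s2 by (simp add: has_bochner_integral_iff set_integrable_def set_lebesgue_integral_def mult.commute)
  then show ?thesis unfolding eq f_def by (intro has_bochner_integral_mult_right) (simp add: f_def)
qed

lemma chord_integrable:
  fixes \<phi> :: "real \<Rightarrow> real"
  assumes \<mu>: "\<mu> > -1" and [measurable]: "\<phi> \<in> borel_measurable borel" and B: "\<And>R. \<bar>\<phi> R\<bar> \<le> B"
  shows "set_integrable lborel {-1..1} (\<lambda>z. \<phi> (a + b * z) * (1 - z\<^sup>2) powr \<mu>)"
    and "\<bar>LBINT z:{-1..1}. \<phi> (a + b * z) * (1 - z\<^sup>2) powr \<mu>\<bar> \<le> B * gegenbauer_mass \<mu>"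
proof -
  have i: "integrable lborel (\<lambda>z. B * (indicator {-1..1} z *\<^sub>R (1 - z\<^sup>2) powr \<mu>))"
    using set_integrable_one_minus_square_powr[OF \<mu>] by (intro integrable_mult_right) (simp add: set_integrable_def)
  have le: "norm (indicator {-1..1} z *\<^sub>R (\<phi> (a + b * z) * (1 - z\<^sup>2) powr \<mu>)) \<le>
     B * (indicator {-1..1} z *\<^sub>R (1 - z\<^sup>2) powr \<mu>)" for z
    using B[of "a + b * z"] by (auto simp: abs_mult indicator_def intro!: mult_right_mono)
  show j: "set_integrable lborel {-1..1} (\<lambda>z. \<phi> (a + b * z) * (1 - z\<^sup>2) powr \<mu>)"
    unfolding set_integrable_def
  proof (rule Bochner_Integration.integrable_bound[OF i])
    show "AE z in lborel. norm (indicator {-1..1} z *\<^sub>R (\<phi> (a + b * z) * (1 - z\<^sup>2) powr \<mu>)) \<le>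
      norm (B * (indicator {-1..1} z *\<^sub>R (1 - z\<^sup>2) powr \<mu>))"
      using order_trans[OF le abs_ge_self] by (intro AE_I2) (simp only: real_norm_def)
  qed measurable
  have "\<bar>LBINT z:{-1..1}. \<phi> (a + b * z) * (1 - z\<^sup>2) powr \<mu>\<bar> \<le>
      (\<integral>z. norm (indicator {-1..1} z *\<^sub>R (\<phi> (a + b * z) * (1 - z\<^sup>2) powr \<mu>)) \<partial>lborel)"
    unfolding set_lebesgue_integral_def real_norm_def[symmetric] by (rule integral_norm_bound)
  also have "\<dots> \<le> (\<integral>z. B * (indicator {-1..1} z *\<^sub>R (1 - z\<^sup>2) powr \<mu>) \<partial>lborel)"
    by (intro integral_mono i le integrable_norm) (use j in \<open>simp add: set_integrable_def\<close>)
  finally show "\<bar>LBINT z:{-1..1}. \<phi> (a + b * z) * (1 - z\<^sup>2) powr \<mu>\<bar> \<le> B * gegenbauer_mass \<mu>"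
    by (simp add: gegenbauer_mass_def set_lebesgue_integral_def)
qed

text \<open>Once the mean is an integral over r, exchanging the integrals leaves for each r the
  integral of \<open>kernel_integral\<close>. That formula covers t < r < 1; for r at most t the two
  kernels have disjoint supports, and for r at least 1 the profile is 0.\<close>

lemma range_moments:
  fixes \<phi> g :: "real \<Rightarrow> real" and j :: nat
  assumes \<mu>: "\<mu> > -1" and t: "0 < t" "t < 1" and j: "j \<le> 1"
    and [measurable]: "\<phi> \<in> borel_measurable borel" and B: "\<And>R. \<bar>\<phi> R\<bar> \<le> B"
    and supp: "\<And>R. R \<ge> 1 \<Longrightarrow> \<phi> R = 0"
    and g: "\<And>u. 0 < u \<Longrightarrow> u < 2 \<Longrightarrow> g u = c * (LBINT z:{-1..1}. \<phi> (1 + u\<^sup>2 + 2 * u * z) * (1 - z\<^sup>2) powr \<mu>)"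
  shows "mom \<mu> (\<lambda>u. u ^ (2 * j) * g u) t =
    (if j = 0 then 0 else c * gegenbauer_mass \<mu> * (LBINT r:{t<..<1}. r * \<phi> (r\<^sup>2) * (r\<^sup>2 - t\<^sup>2) powr (2 * \<mu> + 1)))"
proof -
  \<comment> \<open>The power of 2 u cancels the one produced by \<open>chord_substitution\<close>,
    so that c times \<open>k u\<close> times the r-integral of \<open>f r u\<close> is the integrand
    of the moment.\<close>
  define k where "k u = u ^ (2 * j) * (2 * u) powr (- 2 * \<mu>) * pker \<mu> t u" for u
  define f where "f r u = r * \<phi> (r\<^sup>2) * kker \<mu> r u" for r u
  have [measurable]: "(\<lambda>u. k u) \<in> borel_measurable borel" unfolding k_def by measurable
  let ?F = "\<lambda>(u, r). k u * f r u"
  have meas: "?F \<in> borel_measurable (lborel \<Otimes>\<^sub>M lborel)" unfolding f_def by measurable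
  have fint: "has_bochner_integral lborel (\<lambda>r. f r u)
      (u * (2 * u) powr (2 * \<mu>) * (LBINT z:{-1..1}. \<phi> (1 + u\<^sup>2 + 2 * u * z) * (1 - z\<^sup>2) powr \<mu>))" if "u > 0" for u
    unfolding f_def by (intro chord_substitution that chord_integrable(1)[OF \<mu> _ B]) measurable
  have fabs: "has_bochner_integral lborel (\<lambda>r. norm (f r u))
      (u * (2 * u) powr (2 * \<mu>) * (LBINT z:{-1..1}. \<bar>\<phi> (1 + u\<^sup>2 + 2 * u * z)\<bar> * (1 - z\<^sup>2) powr \<mu>))" if "u > 0" for u
  proof -
    have "norm (f r u) = r * \<bar>\<phi> (r\<^sup>2)\<bar> * kker \<mu> r u" for r
      by (auto simp: f_def abs_mult kker_def)
    moreover have m: "(\<lambda>R. \<bar>\<phi> R\<bar>) \<in> borel_measurable borel" by measurable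
    ultimately show ?thesis
      using chord_substitution[OF that chord_integrable(1)[OF \<mu> m, of B]] B by simp
  qed
  have kz: "k u = 0" if "\<not> (0 < u \<and> u < 2)" for u using that by (auto simp: k_def pker_def)
  have pw: "u ^ (2 * j) * (2 * u) powr (- 2 * \<mu>) * (u * (2 * u) powr (2 * \<mu>)) = u ^ (2 * j) * u" if "u > 0" for u
    using that by (simp add: powr_minus field_simps)
  have int: "integrable (lborel \<Otimes>\<^sub>M lborel) ?F"
  proof (rule lborel_pair.Fubini_integrable[OF meas])
    show "AE u in lborel. integrable lborel (\<lambda>r. ?F (u, r))"
    proof (rule AE_I2)
      fix u show "integrable lborel (\<lambda>r. ?F (u, r))"
        using fint[of u] kz[of u] by (cases "0 < u \<and> u < 2") (auto simp: has_bochner_integral_iff)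
    qed
    show "integrable lborel (\<lambda>u. \<integral>r. norm (?F (u, r)) \<partial>lborel)"
    proof (rule Bochner_Integration.integrable_bound)
      show "integrable lborel (\<lambda>u. (u ^ (2 * j) * u * (B * gegenbauer_mass \<mu>)) * pker \<mu> t u)"
      proof (rule pker_mult_integrable[OF \<mu> t, where B = "2 ^ (2 * j) * 2 * (B * gegenbauer_mass \<mu>)"])
        fix u :: real assume u: "0 < u" "u < 2"
        have "B \<ge> 0" using B[of 0] by linarith
        then show "\<bar>u ^ (2 * j) * u * (B * gegenbauer_mass \<mu>)\<bar> \<le> 2 ^ (2 * j) * 2 * (B * gegenbauer_mass \<mu>)"
          using u gegenbauer_mass_pos[OF \<mu>]
          by (simp add: abs_mult power_abs) (intro mult_mono power_mono mult_nonneg_nonneg; simp)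
      qed measurable
      show "AE u in lborel. norm (\<integral>r. norm (?F (u, r)) \<partial>lborel) \<le>
         norm ((u ^ (2 * j) * u * (B * gegenbauer_mass \<mu>)) * pker \<mu> t u)"
      proof (rule AE_I2)
        fix u
        show "norm (\<integral>r. norm (?F (u, r)) \<partial>lborel) \<le>
         norm ((u ^ (2 * j) * u * (B * gegenbauer_mass \<mu>)) * pker \<mu> t u)"
        proof (cases "0 < u \<and> u < 2")
          case True
          let ?J = "LBINT z:{-1..1}. \<bar>\<phi> (1 + u\<^sup>2 + 2 * u * z)\<bar> * (1 - z\<^sup>2) powr \<mu>"
          have "(\<integral>r. norm (?F (u, r)) \<partial>lborel) = \<bar>k u\<bar> * (\<integral>r. norm (f r u) \<partial>lborel)"
            by (simp add: abs_mult)
          also have "\<dots> = \<bar>k u\<bar> * (u * (2 * u) powr (2 * \<mu>) * ?J)"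
            using fabs[of u] True by (simp add: has_bochner_integral_iff)
          also have "\<dots> = u ^ (2 * j) * (2 * u) powr (- 2 * \<mu>) * (u * (2 * u) powr (2 * \<mu>)) * \<bar>pker \<mu> t u\<bar> * ?J"
            using True by (simp add: k_def abs_mult)
          also have "\<dots> = u ^ (2 * j) * u * \<bar>pker \<mu> t u\<bar> * ?J" using pw[of u] True by simp
          finally have e: "(\<integral>r. norm (?F (u, r)) \<partial>lborel) = u ^ (2 * j) * u * \<bar>pker \<mu> t u\<bar> * ?J" .
          have "\<bar>?J\<bar> \<le> B * gegenbauer_mass \<mu>"
            using chord_integrable(2)[OF \<mu>, of "\<lambda>R. \<bar>\<phi> R\<bar>" B "1 + u\<^sup>2" "2 * u"] B by simp
          then have "u ^ (2 * j) * u * \<bar>pker \<mu> t u\<bar> * \<bar>?J\<bar> \<le> u ^ (2 * j) * u * \<bar>pker \<mu> t u\<bar> * \<bar>B * gegenbauer_mass \<mu>\<bar>"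
            using True by (intro mult_left_mono) auto
          then show ?thesis unfolding e using True by (simp add: abs_mult mult_ac)
        qed (use kz in auto)
      qed
      show "(\<lambda>u. \<integral>r. norm (?F (u, r)) \<partial>lborel) \<in> borel_measurable lborel"
        unfolding f_def by measurable
    qed
  qed
  have "mom \<mu> (\<lambda>u. u ^ (2 * j) * g u) t = (\<integral>u. c * (\<integral>r. ?F (u, r) \<partial>lborel) \<partial>lborel)"
    unfolding mom_def
  proof (intro Bochner_Integration.integral_cong refl)
    fix u :: real
    show "u * (u ^ (2 * j) * g u) * pker \<mu> t u = c * (\<integral>r. ?F (u, r) \<partial>lborel)"
    proof (cases "0 < u \<and> u < 2")
      case True
      have "(\<integral>r. ?F (u, r) \<partial>lborel) = k u * (u * (2 * u) powr (2 * \<mu>) * (LBINT z:{-1..1}. \<phi> (1 + u\<^sup>2 + 2 * u * z) * (1 - z\<^sup>2) powr \<mu>))"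
        using fint[of u] True by (simp add: has_bochner_integral_iff)
      also have "\<dots> = u ^ (2 * j) * (2 * u) powr (- 2 * \<mu>) * (u * (2 * u) powr (2 * \<mu>)) * pker \<mu> t u *
          (LBINT z:{-1..1}. \<phi> (1 + u\<^sup>2 + 2 * u * z) * (1 - z\<^sup>2) powr \<mu>)"
        by (simp add: k_def)
      finally show ?thesis using pw[of u] g[of u] True by simp
    qed (auto simp: kz pker_def)
  qed
  also have "\<dots> = c * (\<integral>u. (\<integral>r. ?F (u, r) \<partial>lborel) \<partial>lborel)" by simp
  also have "(\<integral>u. (\<integral>r. ?F (u, r) \<partial>lborel) \<partial>lborel) = (\<integral>r. (\<integral>u. ?F (u, r) \<partial>lborel) \<partial>lborel)"
    using lborel_pair.Fubini_integral[OF int] by simp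
  also have "\<dots> = (\<integral>r. (if j = 0 then 0 else gegenbauer_mass \<mu> *
     (indicator {t<..<1} r *\<^sub>R (r * \<phi> (r\<^sup>2) * (r\<^sup>2 - t\<^sup>2) powr (2 * \<mu> + 1)))) \<partial>lborel)"
  proof (intro Bochner_Integration.integral_cong refl)
    fix r :: real
    have "(\<integral>u. ?F (u, r) \<partial>lborel) = (\<integral>u. (2 powr (- 2 * \<mu>) * (r * \<phi> (r\<^sup>2))) *
        (u ^ (2 * j) * u powr (- 2 * \<mu>) * (pker \<mu> t u * kker \<mu> r u)) \<partial>lborel)"
      by (intro Bochner_Integration.integral_cong refl) (simp add: k_def f_def powr_mult mult_ac)
    also have "\<dots> = (2 powr (- 2 * \<mu>) * (r * \<phi> (r\<^sup>2))) * (\<integral>u. u ^ (2 * j) * u powr (- 2 * \<mu>) * (pker \<mu> t u * kker \<mu> r u) \<partial>lborel)"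
      by simp
    finally have e: "(\<integral>u. ?F (u, r) \<partial>lborel) = (2 powr (- 2 * \<mu>) * (r * \<phi> (r\<^sup>2))) *
      (\<integral>u. u ^ (2 * j) * u powr (- 2 * \<mu>) * (pker \<mu> t u * kker \<mu> r u) \<partial>lborel)" .
    consider "t < r" "r < 1" | "r \<le> t" | "1 \<le> r" by linarith
    then show "(\<integral>u. ?F (u, r) \<partial>lborel) = (if j = 0 then 0 else gegenbauer_mass \<mu> *
     (indicator {t<..<1} r *\<^sub>R (r * \<phi> (r\<^sup>2) * (r\<^sup>2 - t\<^sup>2) powr (2 * \<mu> + 1))))"
    proof cases
      case 1
      \<comment> \<open>The factor 2 left over here absorbs the 1/2 of
        \<open>kernel_integral\<close>.\<close>
      have "2 powr (- 2 * \<mu>) * (2 powr (2 * \<mu> + 1)) = (2::real)" by (simp flip: powr_add)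
      then have h: "2 powr (- 2 * \<mu>) * (gegenbauer_mass \<mu> / 2 * (2 * (r\<^sup>2 - t\<^sup>2)) powr (2 * \<mu> + 1)) =
         gegenbauer_mass \<mu> * (r\<^sup>2 - t\<^sup>2) powr (2 * \<mu> + 1)"
        unfolding powr_mult by (simp add: field_simps)
      have "(2 powr (- 2 * \<mu>) * x) * (gegenbauer_mass \<mu> / 2 * (2 * (r\<^sup>2 - t\<^sup>2)) powr (2 * \<mu> + 1)) =
         gegenbauer_mass \<mu> * (x * (r\<^sup>2 - t\<^sup>2) powr (2 * \<mu> + 1))" for x
        using arg_cong[OF h, of "\<lambda>y. x * y"] by (simp only: mult_ac)
      then show ?thesis unfolding e kernel_integral(2)[OF \<mu> t(1) 1 j] using 1 by auto
    next
      case 2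
      then have "u ^ (2 * j) * u powr (- 2 * \<mu>) * (pker \<mu> t u * kker \<mu> r u) = 0" for u
        by (auto simp: pker_def kker_def)
      then have z: "(\<lambda>u. u ^ (2 * j) * u powr (- 2 * \<mu>) * (pker \<mu> t u * kker \<mu> r u)) = (\<lambda>_. 0)" by blast
      show ?thesis unfolding e z using 2 by simp
    next
      case 3
      then have "\<phi> (r\<^sup>2) = 0" by (intro supp) simp
      then show ?thesis unfolding e using 3 by simp
    qed
  qed
  finally show ?thesis by (simp add: set_lebesgue_integral_def)
qed

section \<open>Spherical means of radial functions\<close>

text \<open>Both measures give a half-line up to r the volume of the ball of radius r. An index set
  is used instead of a Euclidean type because it will be applied to the coordinates orthogonal to a
  basis vector, which form a set of indices only.\<close>

lemma distr_euclidean_norm_PiM: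
  fixes I :: "'i set"
  assumes I: "finite I" "I \<noteq> {}"
  shows "distr (Pi\<^sub>M I (\<lambda>_. lborel)) borel (\<lambda>f. sqrt (\<Sum>i\<in>I. (f i)\<^sup>2)) =
    density lborel (\<lambda>\<rho>::real. ennreal (real (card I) * unit_ball_vol (card I) * \<rho> ^ (card I - 1)) * indicator {0..} \<rho>)"
    (is "?M = ?N")
proof -
  interpret product_sigma_finite "\<lambda>_::'i. lborel :: real measure" by standard
  define d where "d = card I"
  have d: "d > 0" using I by (simp add: d_def card_gt_0_iff)
  define \<omega> where "\<omega> = unit_ball_vol (real d)"
  have \<omega>: "\<omega> \<ge> 0" by (simp add: \<omega>_def)
  have [measurable]: "(\<lambda>f. sqrt (\<Sum>i\<in>I. (f i)\<^sup>2)) \<in> borel_measurable (Pi\<^sub>M I (\<lambda>_. lborel))"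
    by measurable
  have M: "emeasure ?M {..r} = ennreal (if 0 \<le> r then \<omega> * r ^ d else 0)" for r
  proof -
    have e: "emeasure ?M {..r} = emeasure (Pi\<^sub>M I (\<lambda>_. lborel))
        ({f. sqrt (\<Sum>i\<in>I. (f i)\<^sup>2) \<le> r} \<inter> space (Pi\<^sub>M I (\<lambda>_. lborel)))"
      by (subst emeasure_distr) (auto simp: vimage_def)
    consider "r < 0" | "r = 0" | "r > 0" by linarith
    then show ?thesis
    proof cases
      case 1
      have "0 \<le> sqrt (\<Sum>i\<in>I. (f i)\<^sup>2)" for f :: "'i \<Rightarrow> real" by (simp add: sum_nonneg)
      then have "\<not> sqrt (\<Sum>i\<in>I. (f i)\<^sup>2) \<le> r" for f :: "'i \<Rightarrow> real"
        using 1 by (meson not_le order_less_le_trans)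
      then show ?thesis unfolding e using 1 by simp
    next
      case 2
      have "sqrt (\<Sum>i\<in>I. (f i)\<^sup>2) \<le> 0 \<longleftrightarrow> (\<forall>i\<in>I. f i = 0)" for f :: "'i \<Rightarrow> real"
      proof -
        have "(\<Sum>i\<in>I. (f i)\<^sup>2) \<ge> 0" by (simp add: sum_nonneg)
        then have "sqrt (\<Sum>i\<in>I. (f i)\<^sup>2) \<le> 0 \<longleftrightarrow> (\<Sum>i\<in>I. (f i)\<^sup>2) = 0" by simp
        then show ?thesis using I by (simp add: sum_nonneg_eq_0_iff)
      qed
      then have "{f. sqrt (\<Sum>i\<in>I. (f i)\<^sup>2) \<le> r} \<inter> space (Pi\<^sub>M I (\<lambda>_. lborel)) = (\<Pi>\<^sub>E i\<in>I. {0::real})"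
        using 2 by (auto simp: space_PiM PiE_def extensional_def fun_eq_iff)
      then have "emeasure ?M {..r} = emeasure (Pi\<^sub>M I (\<lambda>_. lborel)) (\<Pi>\<^sub>E i\<in>I. {0::real})"
        unfolding e by (rule arg_cong)
      also have "\<dots> = (\<Prod>i\<in>I. emeasure lborel {0::real})"
        using I by (intro emeasure_PiM) auto
      finally have "emeasure ?M {..r} = (\<Prod>i\<in>I. emeasure lborel {0::real})" .
      then show ?thesis using 2 d I by (simp add: d_def[symmetric] power_0_left)
    next
      case 3
      then show ?thesis unfolding e using emeasure_cball_aux[OF I(1) 3] by (simp add: d_def \<omega>_def)
    qed
  qed
  have N: "emeasure ?N {..r} = ennreal (if 0 \<le> r then \<omega> * r ^ d else 0)" for r
  proof -
    have "emeasure ?N {..r} = (\<integral>\<^sup>+\<rho>. ennreal (real d * \<omega> * \<rho> ^ (d - 1)) * indicator {0..r} \<rho> \<partial>lborel)"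
      unfolding d_def[symmetric] \<omega>_def[symmetric]
      by (subst emeasure_density) (auto intro!: nn_integral_cong simp: indicator_def)
    also have "\<dots> = ennreal (if 0 \<le> r then \<omega> * r ^ d else 0)"
    proof (cases "0 \<le> r")
      case True
      have "(\<integral>\<^sup>+\<rho>. ennreal (real d * \<omega> * \<rho> ^ (d - 1)) * indicator {0..r} \<rho> \<partial>lborel) =
         ennreal (\<omega> * r ^ d - \<omega> * 0 ^ d)"
        using True \<omega> by (intro nn_integral_FTC_Icc) (auto intro!: derivative_eq_intros)
      then show ?thesis using True d by (simp add: zero_power)
    qed auto
    finally show ?thesis .
  qed
  have "?M = ?N"
  proof (rule measure_eqI_generator_eq[where E = "range atMost" and \<Omega> = UNIV and A = "\<lambda>i. {..real i}"])
    show "Int_stable (range (atMost :: real \<Rightarrow> real set))"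
      by (auto simp: Int_stable_def)
    show "sets ?M = sigma_sets UNIV (range atMost)" "sets ?N = sigma_sets UNIV (range atMost)"
      by (auto simp: borel_eq_atMost)
    show "(\<Union>i. {..real i}) = UNIV" by (auto intro: real_arch_simple)
    show "emeasure ?M {..real i} \<noteq> \<infinity>" for i unfolding M by simp
    show "emeasure ?M X = emeasure ?N X" if "X \<in> range atMost" for X
      using that M N by auto
  qed auto
  then show ?thesis .
qed

text \<open>A point at distance \<rho> from an axis, with coordinate y along it, has direction
  cosine z = y / sqrt (y^2 + \<rho>^2), so y = \<rho> z / sqrt (1 - z^2). Then y^2 + \<rho>^2 =
  \<rho>^2 / (1 - z^2), so the unit ball becomes z^2 + \<rho>^2 < 1, and dy/dz = \<rho> / (1 -
  z^2)^(3/2).\<close>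

lemma slice_emeasure:
  fixes \<rho> :: real
  assumes \<rho>: "0 < \<rho>" and Z[measurable]: "Z \<in> sets borel"
  shows "(\<integral>\<^sup>+y. indicator {y. y\<^sup>2 + \<rho>\<^sup>2 < 1 \<and> y / sqrt (y\<^sup>2 + \<rho>\<^sup>2) \<in> Z} y \<partial>lborel) =
    (\<integral>\<^sup>+z. ennreal (indicator Z z * (\<rho> / sqrt (1 - z\<^sup>2) ^ 3) * indicator {z. z\<^sup>2 + \<rho>\<^sup>2 \<le> 1} z) \<partial>lborel)"
proof (cases "\<rho> < 1")
  case False
  then have "1 \<le> \<rho>\<^sup>2" using \<rho> by (simp add: one_le_power)
  then have "\<not> y\<^sup>2 + \<rho>\<^sup>2 < 1" for y :: real using zero_le_power2[of y] by linarith
  moreover have nz: "indicator Z z * (\<rho> / sqrt (1 - z\<^sup>2) ^ 3) * indicator {z. z\<^sup>2 + \<rho>\<^sup>2 \<le> 1} z = (0::real)" if "z \<noteq> 0" for z :: real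
  proof -
    have "z\<^sup>2 > 0" using that by simp
    then have "\<not> z\<^sup>2 + \<rho>\<^sup>2 \<le> 1" using \<open>1 \<le> \<rho>\<^sup>2\<close> by linarith
    then show ?thesis by simp
  qed
  \<comment> \<open>For \<rho> = 1 the point z = 0 still satisfies the weak inequality, so the
    integrand vanishes only almost everywhere.\<close>
  have "AE z in lborel. ennreal (indicator Z z * (\<rho> / sqrt (1 - z\<^sup>2) ^ 3) * indicator {z. z\<^sup>2 + \<rho>\<^sup>2 \<le> 1} z) = 0"
    using AE_lborel_singleton[of "0::real"]
  proof eventually_elim
    case (elim z)
    show ?case unfolding nz[OF elim] by simp
  qed
  then have "(\<integral>\<^sup>+z. ennreal (indicator Z z * (\<rho> / sqrt (1 - z\<^sup>2) ^ 3) * indicator {z. z\<^sup>2 + \<rho>\<^sup>2 \<le> 1} z) \<partial>lborel) = 0"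
    by (subst nn_integral_0_iff_AE) auto
  ultimately show ?thesis by simp
next
  case True
  \<comment> \<open>The points s and -s are fixed by the substitution, so y and z range over the
    same interval.\<close>
  define s where "s = sqrt (1 - \<rho>\<^sup>2)"
  have r2: "\<rho>\<^sup>2 < 1" using \<rho> True by (simp add: power_less_one_iff)
  have s: "0 < s" "s\<^sup>2 = 1 - \<rho>\<^sup>2" using r2 by (auto simp: s_def)
  have sz: "z \<in> {-s..s} \<longleftrightarrow> z\<^sup>2 + \<rho>\<^sup>2 \<le> 1" for z
  proof -
    have "z \<in> {-s..s} \<longleftrightarrow> \<bar>z\<bar> \<le> \<bar>s\<bar>" using s by auto
    also have "\<dots> \<longleftrightarrow> z\<^sup>2 \<le> s\<^sup>2" by (simp add: abs_le_square_iff)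
    finally show ?thesis using s by auto
  qed
  have zpos: "1 - z\<^sup>2 > 0" if "z \<in> {-s..s}" for z
    using that \<rho> unfolding sz by (smt (verit) zero_less_power)
  define g where "g z = \<rho> * z / sqrt (1 - z\<^sup>2)" for z
  have gs: "g s = s" "g (-s) = -s" using s \<rho> by (simp_all add: g_def)
  have dg: "(g has_real_derivative \<rho> / sqrt (1 - z\<^sup>2) ^ 3) (at z)" if "z \<in> {-s..s}" for z
  proof -
    define q where "q = sqrt (1 - z\<^sup>2)"
    have q: "q > 0" "q\<^sup>2 = 1 - z\<^sup>2" using zpos[OF that] by (auto simp: q_def)
    have dq: "((\<lambda>z. sqrt (1 - z\<^sup>2)) has_real_derivative (- (2 * z) * (inverse q / 2))) (at z)"
      unfolding q_def using zpos[OF that]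
      by (auto intro!: derivative_eq_intros)
    have "(g has_real_derivative ((\<rho> * q - \<rho> * z * (- (2 * z) * (inverse q / 2))) / (q * q))) (at z)"
      unfolding g_def using DERIV_divide[OF DERIV_cmult[OF DERIV_ident, of \<rho>] dq] q(1)
      by (simp add: q_def[symmetric])
    moreover have "(\<rho> * q - \<rho> * z * (- (2 * z) * (inverse q / 2))) / (q * q) = \<rho> * (q\<^sup>2 + z\<^sup>2) / q ^ 3"
      using q(1) by (simp add: field_simps power2_eq_square power3_eq_cube)
    ultimately show ?thesis using q by (simp add: q_def)
  qed
  define f where "f y = (indicator {y. y / sqrt (y\<^sup>2 + \<rho>\<^sup>2) \<in> Z} y :: real)" for y
  have fm: "f \<in> borel_measurable borel" unfolding f_def by measurable
  have fg: "f (g z) = indicator Z z" if "z \<in> {-s..s}" for z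
  proof -
    define q where "q = sqrt (1 - z\<^sup>2)"
    have q: "q > 0" "q\<^sup>2 = 1 - z\<^sup>2" using zpos[OF that] by (auto simp: q_def)
    have gq: "g z = \<rho> * z / q" by (simp add: g_def q_def)
    have "(g z)\<^sup>2 + \<rho>\<^sup>2 = (\<rho> / q)\<^sup>2 * (z\<^sup>2 + q\<^sup>2)"
      unfolding gq using q(1) by (simp add: field_simps power2_eq_square)
    then have "sqrt ((g z)\<^sup>2 + \<rho>\<^sup>2) = \<rho> / q" using q \<rho> by simp
    then have "g z / sqrt ((g z)\<^sup>2 + \<rho>\<^sup>2) = z" using q \<rho> by (simp add: g_def q_def[symmetric])
    then show ?thesis by (simp add: f_def indicator_def)
  qed
  have "(\<integral>\<^sup>+y. indicator {y. y\<^sup>2 + \<rho>\<^sup>2 < 1 \<and> y / sqrt (y\<^sup>2 + \<rho>\<^sup>2) \<in> Z} y \<partial>lborel) =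
      (\<integral>\<^sup>+y. ennreal (f y * indicator {g (-s)..g s} y) \<partial>lborel)"
  proof (rule nn_integral_cong_AE)
    show "AE y in lborel. indicator {y. y\<^sup>2 + \<rho>\<^sup>2 < 1 \<and> y / sqrt (y\<^sup>2 + \<rho>\<^sup>2) \<in> Z} y =
        ennreal (f y * indicator {g (-s)..g s} y)"
      using AE_lborel_singleton[of s] AE_lborel_singleton[of "-s"]
    proof eventually_elim
      case (elim y)
      have "y\<^sup>2 + \<rho>\<^sup>2 < 1 \<longleftrightarrow> y \<in> {-s..s}"
      proof -
        have "y\<^sup>2 \<noteq> s\<^sup>2" using elim by (auto simp: power2_eq_iff)
        then show ?thesis unfolding sz using s by auto
      qed
      then show ?case unfolding gs by (auto simp: f_def indicator_def)
    qed
  qed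
  also have "\<dots> = (\<integral>\<^sup>+z. ennreal (f (g z) * (\<rho> / sqrt (1 - z\<^sup>2) ^ 3) * indicator {-s..s} z) \<partial>lborel)"
  proof (rule nn_integral_substitution)
    show "set_borel_measurable borel {g (- s)..g s} f"
      unfolding set_borel_measurable_def using fm by measurable
    have "sqrt (1 - z\<^sup>2) \<noteq> 0" if "z \<in> {-s..s}" for z using zpos[OF that] by simp
    then show "continuous_on {-s..s} (\<lambda>z. \<rho> / sqrt (1 - z\<^sup>2) ^ 3)"
      by (intro continuous_intros) auto
    show "0 \<le> \<rho> / sqrt (1 - z\<^sup>2) ^ 3" if "z \<in> {-s..s}" for z using zpos[OF that] \<rho> by simp
  qed (use dg s in auto)
  also have "\<dots> = (\<integral>\<^sup>+z. ennreal (indicator Z z * (\<rho> / sqrt (1 - z\<^sup>2) ^ 3) * indicator {z. z\<^sup>2 + \<rho>\<^sup>2 \<le> 1} z) \<partial>lborel)"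
    using fg sz by (intro nn_integral_cong) (auto simp: indicator_def)
  finally show ?thesis .
qed

text \<open>A point is described by its coordinate y along b and the length \<rho> of its other d
  coordinates; \<open>slice_emeasure\<close> trades y for the direction cosine z. Integrating
  \<rho>^d up to (1 - z^2)^(1/2) and dividing by (1 - z^2)^(3/2) leaves the exponent (d - 2) / 2,
  which is \<mu>.\<close>

lemma cone_emeasure_Basis:
  fixes b :: "'a::euclidean_space"
  assumes n: "DIM('a) \<ge> 2" and b: "b \<in> Basis" and Z[measurable]: "Z \<in> sets borel"
  defines "\<mu> \<equiv> (real DIM('a) - 3) / 2" and "d \<equiv> DIM('a) - 1"
  shows "emeasure lborel {x \<in> ball 0 1 - {0::'a}. (b \<bullet> x) / norm x \<in> Z} =
    (\<integral>\<^sup>+z. ennreal (real d * unit_ball_vol d / real (d + 1) * (indicator {-1..1} z * (1 - z\<^sup>2) powr \<mu>)) * indicator Z z \<partial>lborel)"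
proof -
  interpret product_sigma_finite "\<lambda>_::'a. lborel :: real measure" by standard
  define I where "I = Basis - {b}"
  have I: "finite I" "b \<notin> I" "Basis = insert b I" using b by (auto simp: I_def)
  have cI: "card I = d" using b by (simp add: I_def d_def)
  have d1: "d \<ge> 1" using n by (simp add: d_def)
  have Ine: "I \<noteq> {}" using cI d1 by auto
  define \<omega> where "\<omega> = real d * unit_ball_vol (real d)"
  have \<omega>: "\<omega> \<ge> 0" by (simp add: \<omega>_def)
  let ?C = "{x \<in> ball 0 1 - {0::'a}. (b \<bullet> x) / norm x \<in> Z}"
  let ?v = "\<lambda>f::'a \<Rightarrow> real. \<Sum>c\<in>Basis. f c *\<^sub>R c"
  have C[measurable]: "?C \<in> sets borel" by measurable
  define A where "A \<rho> = {y::real. y\<^sup>2 + \<rho>\<^sup>2 < 1 \<and> (y \<noteq> 0 \<or> \<rho> \<noteq> 0) \<and> y / sqrt (y\<^sup>2 + \<rho>\<^sup>2) \<in> Z}" for \<rho> :: real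
  define H where "H \<rho> = (\<integral>\<^sup>+y. indicator (A \<rho>) y \<partial>lborel)" for \<rho> :: real
  have Hm[measurable]: "H \<in> borel_measurable borel"
    unfolding H_def A_def by measurable
  have vm[measurable]: "?v \<in> borel_measurable (Pi\<^sub>M Basis (\<lambda>_. lborel))" by measurable
  have vim: "indicator ?C (?v (f(b := y))) = indicator (A (sqrt (\<Sum>i\<in>I. (f i)\<^sup>2))) y" for f y
  proof -
    let ?x = "?v (f(b := y))" and ?\<rho> = "sqrt (\<Sum>i\<in>I. (f i)\<^sup>2)"
    have co: "?x \<bullet> c = (f(b := y)) c" if "c \<in> Basis" for c using that by simp
    have "norm ?x = sqrt (\<Sum>c\<in>Basis. (?x \<bullet> c)\<^sup>2)"
      by (simp only: norm_eq_sqrt_inner euclidean_inner[of ?x ?x] power2_eq_square)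
    also have "(\<Sum>c\<in>Basis. (?x \<bullet> c)\<^sup>2) = (\<Sum>c\<in>Basis. ((f(b := y)) c)\<^sup>2)"
      by (intro sum.cong refl) (simp only: co)
    also have "\<dots> = y\<^sup>2 + (\<Sum>c\<in>I. ((f(b := y)) c)\<^sup>2)" unfolding I(3) using I(1,2) by simp
    also have "(\<Sum>c\<in>I. ((f(b := y)) c)\<^sup>2) = (\<Sum>c\<in>I. (f c)\<^sup>2)"
      using I(2) by (intro sum.cong) auto
    also have "\<dots> = ?\<rho>\<^sup>2" by (simp add: sum_nonneg)
    finally have nx: "norm ?x = sqrt (y\<^sup>2 + ?\<rho>\<^sup>2)" .
    have bx: "b \<bullet> ?x = y" using co[OF b] by (simp only: inner_commute) simp
    have "?x = 0 \<longleftrightarrow> y\<^sup>2 + ?\<rho>\<^sup>2 = 0" using nx by (metis norm_eq_zero real_sqrt_eq_zero_cancel_iff)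
    also have "\<dots> \<longleftrightarrow> y = 0 \<and> ?\<rho> = 0" by (simp add: sum_power2_eq_zero_iff del: real_sqrt_pow2_iff)
    finally have x0: "?x = 0 \<longleftrightarrow> y = 0 \<and> ?\<rho> = 0" .
    have x1: "norm ?x < 1 \<longleftrightarrow> y\<^sup>2 + ?\<rho>\<^sup>2 < 1" unfolding nx by simp
    have "?x \<in> ?C \<longleftrightarrow> y \<in> A ?\<rho>"
      unfolding A_def mem_Collect_eq Diff_iff mem_ball_0 x1 bx singleton_iff x0 nx using x1[unfolded nx] by blast
    then show ?thesis by (simp only: indicator_def)
  qed
  have "emeasure lborel ?C = emeasure (distr (Pi\<^sub>M Basis (\<lambda>_. lborel)) borel ?v) ?C"
    by (subst lborel_eq) simp
  also have "\<dots> = (\<integral>\<^sup>+x. indicator ?C x \<partial>distr (Pi\<^sub>M Basis (\<lambda>_. lborel)) borel ?v)"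
    by (subst nn_integral_indicator) auto
  also have "\<dots> = (\<integral>\<^sup>+f. indicator ?C (?v f) \<partial>Pi\<^sub>M Basis (\<lambda>_. lborel))"
    by (subst nn_integral_distr) auto
  also have "\<dots> = (\<integral>\<^sup>+f. (\<integral>\<^sup>+y. indicator ?C (?v (f(b := y))) \<partial>lborel) \<partial>Pi\<^sub>M I (\<lambda>_. lborel))"
    using product_nn_integral_insert[OF I(1,2), of "\<lambda>f. indicator ?C (?v f)"] unfolding I(3)[symmetric]
    by simp
  also have "\<dots> = (\<integral>\<^sup>+f. H (sqrt (\<Sum>i\<in>I. (f i)\<^sup>2)) \<partial>Pi\<^sub>M I (\<lambda>_. lborel))"
    unfolding vim H_def ..
  also have "\<dots> = (\<integral>\<^sup>+\<rho>. H \<rho> \<partial>distr (Pi\<^sub>M I (\<lambda>_. lborel)) borel (\<lambda>f. sqrt (\<Sum>i\<in>I. (f i)\<^sup>2)))"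
    by (subst nn_integral_distr) auto
  also have "\<dots> = (\<integral>\<^sup>+\<rho>. ennreal (\<omega> * \<rho> ^ (d - 1)) * indicator {0..} \<rho> * H \<rho> \<partial>lborel)"
    unfolding distr_euclidean_norm_PiM[OF I(1) Ine] cI \<omega>_def
    by (subst nn_integral_density) auto
  also have "\<dots> = (\<integral>\<^sup>+\<rho>. (\<integral>\<^sup>+z. ennreal (\<omega> * \<rho> ^ (d - 1) * indicator {0<..} \<rho> *
      (indicator Z z * (\<rho> / sqrt (1 - z\<^sup>2) ^ 3) * indicator {z. z\<^sup>2 + \<rho>\<^sup>2 \<le> 1} z)) \<partial>lborel) \<partial>lborel)"
  proof (rule nn_integral_cong_AE)
    show "AE \<rho> in lborel. ennreal (\<omega> * \<rho> ^ (d - 1)) * indicator {0..} \<rho> * H \<rho> =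
      (\<integral>\<^sup>+z. ennreal (\<omega> * \<rho> ^ (d - 1) * indicator {0<..} \<rho> *
      (indicator Z z * (\<rho> / sqrt (1 - z\<^sup>2) ^ 3) * indicator {z. z\<^sup>2 + \<rho>\<^sup>2 \<le> 1} z)) \<partial>lborel)"
      using AE_lborel_singleton[of "0::real"]
    proof eventually_elim
      case (elim \<rho>)
      show ?case
      proof (cases "\<rho> > 0")
        case True
        have A: "A \<rho> = {y. y\<^sup>2 + \<rho>\<^sup>2 < 1 \<and> y / sqrt (y\<^sup>2 + \<rho>\<^sup>2) \<in> Z}"
          using True by (auto simp: A_def)
        have "ennreal (\<omega> * \<rho> ^ (d - 1)) * indicator {0..} \<rho> * H \<rho> = ennreal (\<omega> * \<rho> ^ (d - 1)) *
           (\<integral>\<^sup>+z. ennreal (indicator Z z * (\<rho> / sqrt (1 - z\<^sup>2) ^ 3) * indicator {z. z\<^sup>2 + \<rho>\<^sup>2 \<le> 1} z) \<partial>lborel)"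
          unfolding H_def A slice_emeasure[OF True Z] using True by simp
        also have "\<dots> = (\<integral>\<^sup>+z. ennreal (\<omega> * \<rho> ^ (d - 1)) *
           ennreal (indicator Z z * (\<rho> / sqrt (1 - z\<^sup>2) ^ 3) * indicator {z. z\<^sup>2 + \<rho>\<^sup>2 \<le> 1} z) \<partial>lborel)"
          by (subst nn_integral_cmult) auto
        also have "\<dots> = (\<integral>\<^sup>+z. ennreal (\<omega> * \<rho> ^ (d - 1) * indicator {0<..} \<rho> *
          (indicator Z z * (\<rho> / sqrt (1 - z\<^sup>2) ^ 3) * indicator {z. z\<^sup>2 + \<rho>\<^sup>2 \<le> 1} z)) \<partial>lborel)"
          using True \<omega> by (intro nn_integral_cong) (subst ennreal_mult'[symmetric], auto)
        finally show ?thesis .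
      qed (use elim in auto)
    qed
  qed
  also have "\<dots> = (\<integral>\<^sup>+z. (\<integral>\<^sup>+\<rho>. ennreal (\<omega> * \<rho> ^ (d - 1) * indicator {0<..} \<rho> *
      (indicator Z z * (\<rho> / sqrt (1 - z\<^sup>2) ^ 3) * indicator {z. z\<^sup>2 + \<rho>\<^sup>2 \<le> 1} z)) \<partial>lborel) \<partial>lborel)"
    by (rule lborel_pair.Fubini') measurable
  also have "\<dots> = (\<integral>\<^sup>+z. ennreal (\<omega> / real (d + 1) * (indicator {-1..1} z * (1 - z\<^sup>2) powr \<mu>)) * indicator Z z \<partial>lborel)"
  proof (intro nn_integral_cong)
    fix z :: real
    show "(\<integral>\<^sup>+\<rho>. ennreal (\<omega> * \<rho> ^ (d - 1) * indicator {0<..} \<rho> *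
      (indicator Z z * (\<rho> / sqrt (1 - z\<^sup>2) ^ 3) * indicator {z. z\<^sup>2 + \<rho>\<^sup>2 \<le> 1} z)) \<partial>lborel) =
      ennreal (\<omega> / real (d + 1) * (indicator {-1..1} z * (1 - z\<^sup>2) powr \<mu>)) * indicator Z z"
    proof (cases "z\<^sup>2 < 1 \<and> z \<in> Z")
      case True
      define q where "q = sqrt (1 - z\<^sup>2)"
      have q: "q > 0" "q\<^sup>2 = 1 - z\<^sup>2" using True by (auto simp: q_def)
      have "(\<integral>\<^sup>+\<rho>. ennreal (\<omega> * \<rho> ^ (d - 1) * indicator {0<..} \<rho> *
        (indicator Z z * (\<rho> / sqrt (1 - z\<^sup>2) ^ 3) * indicator {z. z\<^sup>2 + \<rho>\<^sup>2 \<le> 1} z)) \<partial>lborel) =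
        (\<integral>\<^sup>+\<rho>. ennreal (\<omega> / q ^ 3 * \<rho> ^ d) * indicator {0..q} \<rho> \<partial>lborel)"
      proof (rule nn_integral_cong)
        fix \<rho> :: real
        have e: "z\<^sup>2 + \<rho>\<^sup>2 \<le> 1 \<longleftrightarrow> \<rho> \<le> q" if "\<rho> > 0"
        proof -
          have "\<rho> \<le> q \<longleftrightarrow> \<bar>\<rho>\<bar> \<le> \<bar>q\<bar>" using that q by simp
          also have "\<dots> \<longleftrightarrow> \<rho>\<^sup>2 \<le> q\<^sup>2" by (rule abs_le_square_iff)
          finally show ?thesis using q by auto
        qed
        have "\<rho> ^ d = \<rho> ^ (d - 1) * \<rho>" using d1 by (simp add: power_eq_if)
        then show "ennreal (\<omega> * \<rho> ^ (d - 1) * indicator {0<..} \<rho> *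
        (indicator Z z * (\<rho> / sqrt (1 - z\<^sup>2) ^ 3) * indicator {z. z\<^sup>2 + \<rho>\<^sup>2 \<le> 1} z)) =
          ennreal (\<omega> / q ^ 3 * \<rho> ^ d) * indicator {0..q} \<rho>"
          using True e d1 q by (cases "\<rho> > 0"; cases "\<rho> = 0") (auto simp: indicator_def q_def mult.assoc zero_power)
      qed
      also have "\<dots> = ennreal (\<omega> / q ^ 3 / real (d + 1) * q ^ (d + 1) - \<omega> / q ^ 3 / real (d + 1) * 0 ^ (d + 1))"
      proof (rule nn_integral_FTC_Icc)
        show "((\<lambda>\<rho>. \<omega> / q ^ 3 / real (d + 1) * \<rho> ^ (d + 1)) has_real_derivative \<omega> / q ^ 3 * \<rho> ^ d) (at \<rho>)" for \<rho>
          using DERIV_cmult[OF DERIV_pow[of "d + 1" \<rho>], of "\<omega> / q ^ 3 / real (d + 1)"] by simp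
      qed (use q \<omega> in auto)
      also have "\<omega> / q ^ 3 / real (d + 1) * q ^ (d + 1) - \<omega> / q ^ 3 / real (d + 1) * 0 ^ (d + 1) =
         \<omega> / real (d + 1) * (q ^ (d + 1) / q ^ 3)" by simp
      also have "q ^ (d + 1) / q ^ 3 = q powr (real (d + 1) - 3)"
        using powr_realpow[OF q(1), of "d + 1"] powr_realpow[OF q(1), of 3] by (simp only: powr_diff) simp
      also have "\<dots> = (1 - z\<^sup>2) powr \<mu>"
      proof -
        have "(1 - z\<^sup>2) powr \<mu> = (q powr 2) powr \<mu>" using q by simp
        also have "\<dots> = q powr (2 * \<mu>)" by (rule powr_powr)
        also have "2 * \<mu> = real (d + 1) - 3" using n by (simp add: \<mu>_def d_def of_nat_diff)
        finally show ?thesis by simp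
      qed
      finally have fin: "(\<integral>\<^sup>+\<rho>. ennreal (\<omega> * \<rho> ^ (d - 1) * indicator {0<..} \<rho> *
        (indicator Z z * (\<rho> / sqrt (1 - z\<^sup>2) ^ 3) * indicator {z. z\<^sup>2 + \<rho>\<^sup>2 \<le> 1} z)) \<partial>lborel) =
        ennreal (\<omega> / real (d + 1) * (1 - z\<^sup>2) powr \<mu>)" .
      have "\<bar>z\<bar> \<le> 1" using True by (simp add: abs_square_le_1[symmetric])
      then have "z \<in> {-1..1}" by auto
      then show ?thesis unfolding fin using True by simp
    next
      case False
      have "ennreal (\<omega> * \<rho> ^ (d - 1) * indicator {0<..} \<rho> *
        (indicator Z z * (\<rho> / sqrt (1 - z\<^sup>2) ^ 3) * indicator {z. z\<^sup>2 + \<rho>\<^sup>2 \<le> 1} z)) = 0" for \<rho>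
      proof (cases "\<rho> > 0 \<and> z \<in> Z")
        case True
        then have "\<rho>\<^sup>2 > 0" "1 \<le> z\<^sup>2" using False by auto
        then have "\<not> z\<^sup>2 + \<rho>\<^sup>2 \<le> 1" by linarith
        then show ?thesis by simp
      qed auto
      moreover have "indicator {-1..1} z * (1 - z\<^sup>2) powr \<mu> * indicator Z z = 0"
      proof (cases "z \<in> {-1..1} \<and> z \<in> Z")
        case True
        then have "\<bar>z\<bar> \<le> 1" by auto
        then have "z\<^sup>2 \<le> 1" by (simp add: abs_square_le_1)
        then have "1 - z\<^sup>2 = 0" using False True by auto
        then show ?thesis by simp
      qed auto
      ultimately show ?thesis by (cases "z \<in> Z") auto
    qed
  qed
  finally show ?thesis by (simp add: \<omega>_def)
qed

section \<open>Rotation invariance and the mean of a radial function\<close>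

text \<open>By the Vitali covering theorem an open set is a countable disjoint union of balls up to
  a null set; an orthogonal map sends balls to balls of equal radius and null sets to null sets.
  Open sets suffice because they generate the Borel sets and are stable under intersection.\<close>

lemma emeasure_orthogonal_image_open:
  fixes f :: "'a::euclidean_space \<Rightarrow> 'a"
  assumes f: "orthogonal_transformation f" and U: "open U"
  shows "emeasure lborel (f ` U) = emeasure lborel U"
proof -
  have lin: "linear f" and inj: "inj f"
    using f by (auto intro: orthogonal_transformation_linear orthogonal_transformation_inj)
  have fball: "f ` ball x r = ball (f x) r" for x r
    by (rule image_orthogonal_transformation_ball[OF f])
  have ofU: "open (f ` V)" if "open V" for V
    using that lin orthogonal_transformation_surj[OF f] by (rule open_surjective_linear_image)
  define K where "K = {(x, r). 0 < r \<and> ball x r \<subseteq> U}"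
  obtain C where C: "countable C" "C \<subseteq> K"
    and dis: "pairwise (\<lambda>i j. disjnt (ball (fst i) (snd i)) (ball (fst j) (snd j))) C"
    and neg: "negligible (U - (\<Union>i\<in>C. ball (fst i) (snd i)))"
  proof (rule Vitali_covering_theorem_balls[of U K fst snd])
    fix x and d :: real assume x: "x \<in> U" "0 < d"
    obtain e where e: "0 < e" "ball x e \<subseteq> U" using U x(1) by (meson openE)
    have "ball x (min e (d / 2)) \<subseteq> ball x e" by (intro subset_ball) simp
    then have "(x, min e (d / 2)) \<in> K" using e x by (auto simp: K_def)
    then show "\<exists>i. i \<in> K \<and> x \<in> ball (fst i) (snd i) \<and> snd i < d"
      using e x by (intro exI[of _ "(x, min e (d / 2))"]) auto
  qed
  define V where "V = (\<Union>i\<in>C. ball (fst i) (snd i))"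
  have VU: "V \<subseteq> U" using C(2) by (force simp: V_def K_def)
  have oV: "open V" unfolding V_def by auto
  have eq: "emeasure lborel B = emeasure lborel A"
    if "A \<subseteq> B" "open A" "open B" "negligible (B - A)" for A B :: "'a set"
  proof -
    have m: "B - A \<in> sets borel" "A \<in> sets borel" using that by auto
    have "emeasure lborel (B - A) = 0"
      using that(4) m by (simp add: negligible_iff_emeasure0)
    moreover have "B = A \<union> (B - A)" using that(1) by blast
    ultimately show ?thesis
      using emeasure_Un_null_set[of A lborel "B - A"] m by (simp add: null_sets_def)
  qed
  have dV: "disjoint_family_on (\<lambda>i. ball (fst i) (snd i)) C"
    using dis by (auto simp: disjoint_family_on_def pairwise_def disjnt_def)
  have dfV: "disjoint_family_on (\<lambda>i. f ` ball (fst i) (snd i)) C"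
    using dV unfolding disjoint_family_on_def by (metis image_Int[OF inj] image_empty)
  have fV: "f ` V = (\<Union>i\<in>C. f ` ball (fst i) (snd i))" unfolding V_def by blast
  have vol: "emeasure lborel (f ` ball x r) = emeasure lborel (ball x r)" for x r
    unfolding fball by (cases "0 \<le> r") (simp_all add: emeasure_ball ball_empty)
  have "negligible (f ` (U - V))"
    using neg lin unfolding V_def[symmetric]
    by (intro negligible_differentiable_image_negligible linear_imp_differentiable_on) auto
  moreover have "f ` (U - V) = f ` U - f ` V" using inj by (rule image_set_diff)
  ultimately have "emeasure lborel (f ` U) = emeasure lborel (f ` V)"
    using VU U oV ofU by (intro eq) auto
  also have "\<dots> = (\<integral>\<^sup>+i. emeasure lborel (f ` ball (fst i) (snd i)) \<partial>count_space C)"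
    unfolding fV using C(1) dfV by (intro emeasure_UN_countable) (auto simp: fball)
  also have "\<dots> = (\<integral>\<^sup>+i. emeasure lborel (ball (fst i) (snd i)) \<partial>count_space C)"
    by (simp only: vol)
  also have "\<dots> = emeasure lborel V"
    unfolding V_def using C(1) dV by (intro emeasure_UN_countable[symmetric]) auto
  also have "\<dots> = emeasure lborel U"
    using VU U oV neg unfolding V_def[symmetric] by (intro eq[symmetric]) auto
  finally show ?thesis .
qed

lemma lborel_distr_orthogonal_transformation:
  fixes f :: "'a::euclidean_space \<Rightarrow> 'a"
  assumes f: "orthogonal_transformation f"
  shows "distr lborel borel f = lborel"
proof -
  have bij: "bij f"
    using f by (simp add: bij_def orthogonal_transformation_inj orthogonal_transformation_surj)
  have fi: "orthogonal_transformation (inv f)"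
    using f by (rule orthogonal_transformation_inv)
  have fm: "f \<in> borel_measurable borel"
    using orthogonal_transformation_linear[OF f]
    by (intro borel_measurable_continuous_onI linear_continuous_on) (simp add: linear_conv_bounded_linear)
  show ?thesis
  proof (rule measure_eqI_generator_eq[where E = "{S. open S}" and \<Omega> = UNIV and A = "\<lambda>i. ball 0 (real i)"])
    fix X :: "'a set" assume "X \<in> {S. open S}"
    then have X: "open X" by simp
    have "emeasure (distr lborel borel f) X = emeasure lborel (f -` X)"
      using fm X by (subst emeasure_distr) auto
    also have "f -` X = inv f ` X" using bij by (rule bij_vimage_eq_inv_image)
    also have "emeasure lborel (inv f ` X) = emeasure lborel X"
      by (rule emeasure_orthogonal_image_open[OF fi X])
    finally show "emeasure (distr lborel borel f) X = emeasure lborel X" .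
  next
    show "(\<Union>i. ball (0::'a) (real i)) = UNIV" by (auto intro: reals_Archimedean2)
    show "emeasure (distr lborel borel f) (ball 0 (real i)) \<noteq> \<infinity>" for i
    proof -
      have "emeasure (distr lborel borel f) (ball 0 (real i)) = emeasure lborel (f -` ball 0 (real i))"
        using fm by (subst emeasure_distr) auto
      also have "f -` ball 0 (real i) = inv f ` ball 0 (real i)" using bij by (rule bij_vimage_eq_inv_image)
      also have "emeasure lborel (inv f ` ball 0 (real i)) = emeasure lborel (ball (0::'a) (real i))"
        by (rule emeasure_orthogonal_image_open[OF fi open_ball])
      finally show ?thesis by (simp add: emeasure_ball)
    qed
  qed (auto simp: Int_stable_def borel_def)
qed

text \<open>A rotation carries a coordinate vector to p and maps the cone about the one onto the
  cone about the other.\<close>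

lemma cone_emeasure:
  fixes p :: "real ^ 'n"
  assumes n: "CARD('n) \<ge> 2" and p: "norm p = 1" and Z[measurable]: "Z \<in> sets borel"
  defines "\<mu> \<equiv> (real CARD('n) - 3) / 2" and "d \<equiv> CARD('n) - 1"
  shows "emeasure lborel {x \<in> ball 0 1 - {0}. (p \<bullet> x) / norm x \<in> Z} =
    (\<integral>\<^sup>+z. ennreal (real d * unit_ball_vol d / real (d + 1) * (indicator {-1..1} z * (1 - z\<^sup>2) powr \<mu>)) * indicator Z z \<partial>lborel)"
proof -
  define b :: "real ^ 'n" where "b = axis (SOME k. True) 1"
  have b: "b \<in> Basis" "norm b = 1" by (auto simp: b_def axis_in_Basis_iff)
  obtain f where f: "orthogonal_transformation f" "f b = p"
    using orthogonal_transformation_exists_1[OF b(2) p] by blast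
  let ?C = "\<lambda>q. {x \<in> ball 0 1 - {0 :: real ^ 'n}. (q \<bullet> x) / norm x \<in> Z}"
  have bor: "?C q \<in> sets borel" for q by measurable
  have pre: "f -` ?C p = ?C b"
  proof -
    have in_f: "f x \<bullet> f y = x \<bullet> y" for x y using f(1) by (simp add: orthogonal_transformation_def)
    have nf: "norm (f x) = norm x" for x using f(1) by (simp add: orthogonal_transformation)
    have f0: "f x = 0 \<longleftrightarrow> x = 0" for x using nf[of x] norm_eq_zero[of x] norm_eq_zero[of "f x"] by simp
    have key: "f x \<in> ?C p \<longleftrightarrow> x \<in> ?C b" for x
      using in_f[of b x] by (simp add: f(2) nf f0)
    show ?thesis
    proof (rule set_eqI)
      fix x show "x \<in> f -` ?C p \<longleftrightarrow> x \<in> ?C b" using key[of x] by (simp only: vimage_eq)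
    qed
  qed
  have [measurable]: "f \<in> borel_measurable borel"
    using orthogonal_transformation_linear[OF f(1)]
    by (intro borel_measurable_continuous_onI linear_continuous_on linear_conv_bounded_linear[THEN iffD1])
  have "emeasure lborel (?C p) = emeasure (distr lborel borel f) (?C p)"
    by (simp only: lborel_distr_orthogonal_transformation[OF f(1)])
  also have "\<dots> = emeasure lborel (?C b)"
    using bor[of p] by (subst emeasure_distr) (simp_all only: pre space_lborel Int_UNIV_right, measurable)
  finally have "emeasure lborel (?C p) = emeasure lborel (?C b)" .
  then show ?thesis using cone_emeasure_Basis[of b Z] n b(1) Z by (simp add: \<mu>_def d_def)
qed

text \<open>For unit vectors p and \<theta>, |p + t \<theta>|^2 = 1 + t^2 + 2 t (p . \<theta>) sees
  \<theta> only through p . \<theta>, whose distribution under the surface measure is read off from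
  the volumes of cones.\<close>

lemma spherical_mean_radial:
  fixes \<phi> :: "real \<Rightarrow> real" and p :: "real ^ 'n"
  assumes n: "CARD('n) \<ge> 2" and p: "norm p = 1" and [measurable]: "\<phi> \<in> borel_measurable borel"
  defines "\<mu> \<equiv> (real CARD('n) - 3) / 2"
  shows "spherical_mean (\<lambda>x. \<phi> ((norm x)\<^sup>2)) p t =
    1 / gegenbauer_mass \<mu> * (LBINT z:{-1..1}. \<phi> (1 + t\<^sup>2 + 2 * t * z) * (1 - z\<^sup>2) powr \<mu>)"
proof -
  let ?S = "surface_measure :: (real ^ 'n) measure"
  define d where "d = CARD('n) - 1"
  define \<kappa> where "\<kappa> = real CARD('n) * (real d * unit_ball_vol d / real (d + 1))"
  have \<kappa>: "\<kappa> > 0" using n by (auto simp: \<kappa>_def d_def unit_ball_vol_pos intro!: mult_pos_pos divide_pos_pos)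
  define w where "w z = \<kappa> * (indicator {-1..1} z * (1 - z\<^sup>2) powr \<mu>)" for z :: real
  have wn: "w z \<ge> 0" for z using \<kappa> by (simp add: w_def)
  have wm[measurable]: "w \<in> borel_measurable borel" unfolding w_def by measurable
  have sS: "sets ?S = sets (restrict_space borel (sphere 0 1))" "space ?S = sphere 0 1"
    by (simp_all add: surface_measure_def space_restrict_space space_scale_measure)
  have dm[measurable]: "(\<lambda>\<theta>. p \<bullet> \<theta>) \<in> borel_measurable ?S"
  proof -
    have "(\<lambda>\<theta>. p \<bullet> \<theta>) \<in> borel_measurable (restrict_space borel (sphere 0 1))"
      by (intro measurable_restrict_space1) measurable
    then show ?thesis using sS(1) by (simp cong: measurable_cong_sets)
  qed
  have D: "distr ?S borel (\<lambda>\<theta>. p \<bullet> \<theta>) = density lborel (\<lambda>z. ennreal (w z))"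
  proof (rule measure_eqI)
    fix Z assume "Z \<in> sets (distr ?S borel (\<lambda>\<theta>. p \<bullet> \<theta>))"
    then have Z[measurable]: "Z \<in> sets borel" by simp
    let ?A = "{\<theta> \<in> sphere 0 1. p \<bullet> \<theta> \<in> Z}"
    have "(\<lambda>\<theta>. p \<bullet> \<theta>) -` Z \<inter> space ?S = ?A" unfolding sS(2) by blast
    then have "emeasure (distr ?S borel (\<lambda>\<theta>. p \<bullet> \<theta>)) Z = emeasure ?S ?A"
      using emeasure_distr[OF dm Z] by (simp only:)
    also have "\<dots> = of_nat CARD('n) * emeasure lborel {x \<in> ball 0 1 - {0}. x /\<^sub>R norm x \<in> ?A}"
      by (subst emeasure_surface_measure) (auto, measurable)
    also have "{x \<in> ball 0 1 - {0}. x /\<^sub>R norm x \<in> ?A} = {x \<in> ball 0 1 - {0}. (p \<bullet> x) / norm x \<in> Z}"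
      by (auto simp: divide_inverse mult.commute)
    also have "emeasure lborel \<dots> = (\<integral>\<^sup>+z. ennreal (real d * unit_ball_vol d / real (d + 1) * (indicator {-1..1} z * (1 - z\<^sup>2) powr \<mu>)) * indicator Z z \<partial>lborel)"
      using cone_emeasure[OF n p Z] by (simp add: \<mu>_def d_def)
    also have "of_nat CARD('n) * \<dots> = (\<integral>\<^sup>+z. ennreal (w z) * indicator Z z \<partial>lborel)"
    proof -
      have "ennreal (w z) * indicator Z z = of_nat CARD('n) * (ennreal (real d * unit_ball_vol d / real (d + 1) * (indicator {-1..1} z * (1 - z\<^sup>2) powr \<mu>)) * indicator Z z)" for z
        unfolding w_def \<kappa>_def ennreal_of_nat_eq_real_of_nat mult.assoc[of "ennreal _", symmetric]
        by (subst ennreal_mult'[symmetric]) (auto simp: mult_ac)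
      then show ?thesis by (simp add: nn_integral_cmult)
    qed
    also have "\<dots> = emeasure (density lborel (\<lambda>z. ennreal (w z))) Z"
      by (subst emeasure_density) auto
    finally show "emeasure (distr ?S borel (\<lambda>\<theta>. p \<bullet> \<theta>)) Z = emeasure (density lborel (\<lambda>z. ennreal (w z))) Z" .
  qed simp
  have mean: "(\<integral>\<theta>. \<psi> (p \<bullet> \<theta>) \<partial>?S) = \<kappa> * (LBINT z:{-1..1}. \<psi> z * (1 - z\<^sup>2) powr \<mu>)"
    if [measurable]: "\<psi> \<in> borel_measurable borel" for \<psi> :: "real \<Rightarrow> real"
  proof -
    have "(\<integral>\<theta>. \<psi> (p \<bullet> \<theta>) \<partial>?S) = (\<integral>z. \<psi> z \<partial>distr ?S borel (\<lambda>\<theta>. p \<bullet> \<theta>))"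
      by (rule integral_distr[symmetric]) measurable
    also have "\<dots> = (\<integral>z. w z *\<^sub>R \<psi> z \<partial>lborel)"
      unfolding D using wn by (intro integral_density) auto
    also have "\<dots> = (\<integral>z. \<kappa> * (indicator {-1..1} z *\<^sub>R (\<psi> z * (1 - z\<^sup>2) powr \<mu>)) \<partial>lborel)"
      by (intro Bochner_Integration.integral_cong) (auto simp: w_def)
    finally show ?thesis by (simp add: set_lebesgue_integral_def)
  qed
  \<comment> \<open>The same formula applied to the constant 1 gives the total surface, so that the
    ball volumes in \<kappa> cancel.\<close>
  have "(\<integral>\<theta>. 1 \<partial>?S) = measure ?S (sphere 0 1)"
    using sS(2) by simp
  then have tot: "measure ?S (sphere 0 1) = \<kappa> * gegenbauer_mass \<mu>"
    using mean[of "\<lambda>_. 1"] by (simp add: gegenbauer_mass_def)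
  have "(\<integral>\<theta>. \<phi> ((norm (p + t *\<^sub>R \<theta>))\<^sup>2) \<partial>?S) = (\<integral>\<theta>. \<phi> (1 + t\<^sup>2 + 2 * t * (p \<bullet> \<theta>)) \<partial>?S)"
  proof (rule Bochner_Integration.integral_cong[OF refl])
    fix \<theta> assume "\<theta> \<in> space ?S"
    then have "norm \<theta> = 1" using sS(2) by simp
    then have "(norm (p + t *\<^sub>R \<theta>))\<^sup>2 = 1 + t\<^sup>2 + 2 * t * (p \<bullet> \<theta>)"
      using p unfolding power2_norm_eq_inner
      by (simp add: inner_add_left inner_add_right inner_commute power2_eq_square norm_eq_1)
    then show "\<phi> ((norm (p + t *\<^sub>R \<theta>))\<^sup>2) = \<phi> (1 + t\<^sup>2 + 2 * t * (p \<bullet> \<theta>))" by simp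
  qed
  also have "\<dots> = \<kappa> * (LBINT z:{-1..1}. \<phi> (1 + t\<^sup>2 + 2 * t * z) * (1 - z\<^sup>2) powr \<mu>)"
    by (rule mean) measurable
  finally show ?thesis unfolding spherical_mean_def tot using \<kappa> by simp
qed

section \<open>Smooth radial profiles\<close>

text \<open>Derivatives are taken in the interior, but each must have a continuous extension to S.
  For S = \<open>{0..}\<close> this is smoothness up to the boundary point without one-sided
  derivatives, the right notion for a profile in |x|^2.\<close>

fun Cder :: "real set \<Rightarrow> nat \<Rightarrow> (real \<Rightarrow> real) \<Rightarrow> bool" where
  "Cder S 0 f \<longleftrightarrow> continuous_on S f"
| "Cder S (Suc k) f \<longleftrightarrow> continuous_on S f \<and>
     (\<exists>f'. (\<forall>x\<in>interior S. (f has_real_derivative f' x) (at x)) \<and> Cder S k f')"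

lemma Cder_continuous: "Cder S k f \<Longrightarrow> continuous_on S f"
  by (cases k) auto

lemma Cder_SucE:
  assumes "Cder S (Suc k) f"
  obtains f' where "continuous_on S f" "\<forall>x\<in>interior S. (f has_real_derivative f' x) (at x)" "Cder S k f'"
  using assms by auto

lemma Cder_SucI:
  assumes "continuous_on S f" "\<And>x. x \<in> interior S \<Longrightarrow> (f has_real_derivative f' x) (at x)" "Cder S k f'"
  shows "Cder S (Suc k) f"
  using assms by auto

lemma Cder_Suc_imp: "Cder S (Suc k) f \<Longrightarrow> Cder S k f"
proof (induction k arbitrary: f)
  case (Suc k)
  then obtain f' where f': "\<And>x. x \<in> interior S \<Longrightarrow> (f has_real_derivative f' x) (at x)" "Cder S (Suc k) f'"
    by auto
  then show ?case using Suc.IH[OF f'(2)] Suc.prems by auto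
qed auto

lemma Cder_cong:
  assumes "Cder S k f" "\<And>x. x \<in> S \<Longrightarrow> f x = g x"
  shows "Cder S k g"
proof (cases k)
  case 0
  then show ?thesis using assms by (simp cong: continuous_on_cong)
next
  case (Suc j)
  then obtain f' where f': "\<And>x. x \<in> interior S \<Longrightarrow> (f has_real_derivative f' x) (at x)" "Cder S j f'"
    and c: "continuous_on S f"
    using assms(1) by auto
  have "(g has_real_derivative f' x) (at x)" if "x \<in> interior S" for x
    using that assms(2) interior_subset[of S]
    by (intro has_field_derivative_transform_within_open[OF f'(1)[OF that] open_interior that]) auto
  moreover have "continuous_on S g" using c assms(2) by (simp cong: continuous_on_cong)
  ultimately show ?thesis using f'(2) Suc by auto
qed

lemma Cder_subset: "Cder T k f \<Longrightarrow> S \<subseteq> T \<Longrightarrow> Cder S k f"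
proof (induction k arbitrary: f)
  case (Suc k)
  then obtain f' where "\<And>x. x \<in> interior T \<Longrightarrow> (f has_real_derivative f' x) (at x)" "Cder T k f'"
    "continuous_on T f" by auto
  then show ?case using Suc interior_mono[of S T] continuous_on_subset by (auto intro!: exI[of _ f'])
qed (auto intro: continuous_on_subset)

lemma Cder_const: "Cder S k (\<lambda>_. c)"
proof (induction k arbitrary: c)
  case (Suc k)
  then show ?case by (auto intro!: exI[of _ "\<lambda>_. 0"])
qed auto

lemma Cder_ident: "Cder S k (\<lambda>x. x)"
  using Cder_const[of S _ 1] by (cases k) (auto intro!: exI[of _ "\<lambda>_. 1"])

lemma Cder_add: "Cder S k f \<Longrightarrow> Cder S k g \<Longrightarrow> Cder S k (\<lambda>x. f x + g x)"
proof (induction k arbitrary: f g)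
  case (Suc k)
  obtain f' where cf: "continuous_on S f"
    and f': "\<forall>x\<in>interior S. (f has_real_derivative f' x) (at x)" "Cder S k f'"
    using Suc.prems(1) by (rule Cder_SucE)
  obtain g' where cg: "continuous_on S g"
    and g': "\<forall>x\<in>interior S. (g has_real_derivative g' x) (at x)" "Cder S k g'"
    using Suc.prems(2) by (rule Cder_SucE)
  have "((\<lambda>x. f x + g x) has_real_derivative f' x + g' x) (at x)" if "x \<in> interior S" for x
    using bspec[OF f'(1) that] bspec[OF g'(1) that] by (rule DERIV_add)
  moreover have "continuous_on S (\<lambda>x. f x + g x)"
    using Suc.prems[THEN Cder_continuous] by (rule continuous_on_add)
  moreover have "Cder S k (\<lambda>x. f' x + g' x)" using f'(2) g'(2) by (rule Suc.IH)
  ultimately show ?case by (intro Cder_SucI)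
qed (auto intro: continuous_intros)

lemma Cder_mult: "Cder S k f \<Longrightarrow> Cder S k g \<Longrightarrow> Cder S k (\<lambda>x. f x * g x)"
proof (induction k arbitrary: f g)
  case (Suc k)
  obtain f' where cf: "continuous_on S f"
    and f': "\<forall>x\<in>interior S. (f has_real_derivative f' x) (at x)" "Cder S k f'"
    using Suc.prems(1) by (rule Cder_SucE)
  obtain g' where cg: "continuous_on S g"
    and g': "\<forall>x\<in>interior S. (g has_real_derivative g' x) (at x)" "Cder S k g'"
    using Suc.prems(2) by (rule Cder_SucE)
  note d = f' g'
  have "Cder S k (\<lambda>x. f' x * g x + f x * g' x)"
    by (intro Cder_add Suc.IH Suc.prems[THEN Cder_Suc_imp] d)
  moreover have "((\<lambda>x. f x * g x) has_real_derivative f' x * g x + f x * g' x) (at x)" if "x \<in> interior S" for x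
    using DERIV_mult[OF bspec[OF d(1) that] bspec[OF d(3) that]] by (simp add: mult.commute add.commute)
  moreover have "continuous_on S (\<lambda>x. f x * g x)"
    using Suc.prems[THEN Cder_continuous] by (rule continuous_on_mult)
  ultimately show ?case by (intro Cder_SucI)
qed (auto intro: continuous_intros)

lemma Cder_inverse: "Cder {0<..} k (\<lambda>x. 1 / x)"
proof (induction k)
  case (Suc k)
  have "Cder {0<..} k (\<lambda>x::real. (-1) * ((1 / x) * (1 / x)))"
    by (intro Cder_mult Cder_const Suc)
  then show ?case
    by (auto intro!: exI[of _ "\<lambda>x. - 1 * ((1 / x) * (1 / x))"] continuous_intros derivative_eq_intros
        simp: interior_open)
qed (auto intro!: continuous_intros)

lemma Cder_comp_sqrt: "Cder {0<..} k f \<Longrightarrow> Cder {0<..} k (\<lambda>x. f (sqrt x))"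
proof (induction k arbitrary: f)
  case 0
  then show ?case by (auto intro!: continuous_on_compose2[of "{0<..}" f] continuous_intros)
next
  case (Suc k)
  then obtain f' where f': "\<And>x. x > 0 \<Longrightarrow> (f has_real_derivative f' x) (at x)" "Cder {0<..} k f'"
    and c: "continuous_on {0<..} f"
    by (auto simp: interior_open)
  have "Cder {0<..} k (\<lambda>u. f' u * (1 / 2 * (1 / u)))"
    by (intro Cder_mult f' Cder_const Cder_inverse)
  then have "Cder {0<..} k (\<lambda>x. f' (sqrt x) * (1 / 2 * (1 / sqrt x)))" by (rule Suc.IH)
  moreover have "((\<lambda>x. f (sqrt x)) has_real_derivative f' (sqrt x) * (1 / 2 * (1 / sqrt x))) (at x)" if "x > 0" for x
    using DERIV_chain2[OF f'(1)[of "sqrt x"] DERIV_real_sqrt[OF that]] that by (simp add: field_simps)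
  moreover have "continuous_on {0<..} (\<lambda>x. f (sqrt x))"
    by (auto intro!: continuous_on_compose2[OF c] continuous_intros)
  ultimately show ?case
    by (auto simp: interior_open intro!: exI[of _ "\<lambda>x. f' (sqrt x) * (1 / 2 * (1 / sqrt x))"])
qed

lemma Cder_extend_zero_left:
  assumes "Cder {0<..} k f" "\<delta> > 0" "\<And>x. x < \<delta> \<Longrightarrow> f x = 0"
  shows "Cder UNIV k f"
proof -
  have cont: "continuous_on UNIV f" if "continuous_on {0<..} f" "\<And>x. x < \<delta> \<Longrightarrow> f x = 0" for f :: "real \<Rightarrow> real"
  proof -
    have "continuous_on {..<\<delta>} f"
      by (subst continuous_on_cong[of _ "{..<\<delta>}" _ "\<lambda>_. 0"]) (use that(2) in auto)
    then have "continuous_on ({0<..} \<union> {..<\<delta>}) f" using that(1) by (intro continuous_on_open_Un) auto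
    moreover have "{0<..} \<union> {..<\<delta>} = UNIV" using assms(2) by auto
    ultimately show ?thesis by simp
  qed
  show ?thesis using assms(1,3)
  proof (induction k arbitrary: f)
    case 0
    then show ?case using cont by simp
  next
    case (Suc k)
    then obtain f' where f': "\<And>x. x > 0 \<Longrightarrow> (f has_real_derivative f' x) (at x)" "Cder {0<..} k f'"
      and c: "continuous_on {0<..} f"
      by (auto simp: interior_open)
    have z: "(f has_real_derivative 0) (at x)" if "x < \<delta>" for x
      by (rule has_field_derivative_transform_within_open[of "\<lambda>_. 0" _ _ "{..<\<delta>}"])
        (use that Suc.prems in auto)
    define d where "d x = (if x > 0 then f' x else 0)" for x
    have d: "(f has_real_derivative d x) (at x)" for x
      using f'(1)[of x] z[of x] assms(2) by (auto simp: d_def)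
    have "d x = 0" if "x < \<delta>" for x using DERIV_unique[OF d z[OF that]] .
    moreover have "Cder {0<..} k d" using f'(2) by (rule Cder_cong) (auto simp: d_def)
    ultimately have "Cder UNIV k d" by (intro Suc.IH)
    then show ?case using d cont[OF c Suc.prems(2)] by auto
  qed
qed

text \<open>Made for b = 1: the expression for the second moment is known to vanish on a left
  neighbourhood of T = 1 but has no meaning as a moment beyond, where it is replaced by 0.\<close>

lemma Cder_cut_right:
  assumes "Cder {0..} k f" "a < b" "0 < a" "\<And>x. a < x \<Longrightarrow> x < b \<Longrightarrow> f x = 0"
  shows "Cder {0..} k (\<lambda>x. if x < b then f x else 0)"
proof -
  have cont: "continuous_on {0..} (\<lambda>x. if x < b then f x else 0)"
    if "continuous_on {0..} f" "\<And>x. a < x \<Longrightarrow> x < b \<Longrightarrow> f x = 0" for f :: "real \<Rightarrow> real"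
  proof -
    let ?f = "\<lambda>x. if x < b then f x else 0"
    have "continuous_on {0..<b} ?f" using that(1)
      by (subst continuous_on_cong[of _ "{0..<b}" _ f]) (auto intro: continuous_on_subset)
    moreover have "continuous_on {a<..} ?f"
      using that(2) by (subst continuous_on_cong[of _ "{a<..}" _ "\<lambda>_. 0"]) auto
    moreover have "openin (top_of_set {0..}) ({0..} \<inter> {..<b})" "openin (top_of_set {0..}) ({0..} \<inter> {a<..})"
      by (intro openin_open_Int; simp)+
    moreover have "{0..} \<inter> {..<b} = {0..<b}" "{0..} \<inter> {a<..} = {a<..}" using assms(2,3) by auto
    ultimately have "continuous_on ({0..<b} \<union> {a<..}) ?f"
      by (intro continuous_on_Un_local_open)
        (auto intro: openin_subset_trans)
    moreover have "{0..<b} \<union> {a<..} = {0..}" using assms(2,3) by auto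
    ultimately show ?thesis by simp
  qed
  show ?thesis using assms(1,4)
  proof (induction k arbitrary: f)
    case 0
    then show ?case using cont[of f] by simp
  next
    case (Suc k)
    then obtain f' where f': "\<And>x. x > 0 \<Longrightarrow> (f has_real_derivative f' x) (at x)" "Cder {0..} k f'"
      and c: "continuous_on {0..} f"
      by auto
    have z: "f' x = 0" if "a < x" "x < b" for x
    proof -
      have "(f has_real_derivative 0) (at x)"
        by (rule has_field_derivative_transform_within_open[of "\<lambda>_. 0" _ _ "{a<..<b}"])
          (use that Suc.prems in auto)
      then show ?thesis using DERIV_unique f'(1)[of x] that assms(3) by auto
    qed
    have "((\<lambda>x. if x < b then f x else 0) has_real_derivative (if x < b then f' x else 0)) (at x)" if "x > 0" for x
    proof (cases "x < b")
      case True
      have "((\<lambda>x. if x < b then f x else 0) has_real_derivative f' x) (at x)"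
        by (rule has_field_derivative_transform_within_open[OF f'(1)[OF that], of "{..<b}"]) (use True in auto)
      then show ?thesis using True by simp
    next
      case False
      then have "((\<lambda>x. if x < b then f x else 0) has_real_derivative 0) (at x)"
        by (intro has_field_derivative_transform_within_open[OF DERIV_const[of 0], of "{a<..}"])
          (use False assms(2) Suc.prems(2) in auto)
      then show ?thesis using False by simp
    qed
    then show ?case using cont[OF c Suc.prems(2)] Suc.IH[OF f'(2) z]
      by (intro Cder_SucI[of _ _ "\<lambda>x. if x < b then f' x else 0"]) (simp_all only: interior_real_atLeast greaterThan_iff)
  qed
qed

section \<open>Smooth radial functions on Euclidean space\<close>

lemma C_k_imp_Cder: "C_k k f \<Longrightarrow> Cder UNIV k f" for f :: "real \<Rightarrow> real"
proof (induction k arbitrary: f)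
  case (Suc k)
  let ?d = "\<lambda>x. frechet_derivative f (at x) 1"
  have d: "(f has_real_derivative ?d x) (at x)" for x
  proof -
    have h: "(f has_derivative frechet_derivative f (at x)) (at x)"
      using Suc.prems by (simp add: frechet_derivative_works)
    then have "linear (frechet_derivative f (at x))" by (rule has_derivative_linear)
    then have "frechet_derivative f (at x) y = ?d x * y" for y
      using linear_scale[of "frechet_derivative f (at x)" y 1] by (simp add: mult.commute[of y])
    then have "frechet_derivative f (at x) = (\<lambda>y. ?d x * y)" by (rule ext)
    then show ?thesis unfolding has_field_derivative_def using h by (simp only:)
  qed
  have "continuous_on UNIV f"
    by (rule DERIV_continuous_on[of _ _ ?d]) (use d in simp)
  then show ?case by (rule Cder_SucI[OF _ d]) (use Suc in auto)
qed auto

lemma C_k_continuous: "C_k k f \<Longrightarrow> continuous_on UNIV f"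
  by (cases k) (auto simp: continuous_on_eq_continuous_at intro: differentiable_imp_continuous_within)

lemma C_k_Suc_imp: "C_k (Suc k) f \<Longrightarrow> C_k k f"
proof (induction k arbitrary: f)
  case 0
  then show ?case using C_k_continuous by (metis C_k.simps(1))
qed auto

lemma C_k_add: "C_k k f \<Longrightarrow> C_k k g \<Longrightarrow> C_k k (\<lambda>x. f x + g x)"
proof (induction k arbitrary: f g)
  case (Suc k)
  have e: "frechet_derivative (\<lambda>x. f x + g x) (at x) = (\<lambda>v. frechet_derivative f (at x) v + frechet_derivative g (at x) v)" for x
    using Suc.prems by (intro frechet_derivative_at[symmetric] has_derivative_add) (auto simp: frechet_derivative_works)
  show ?case using Suc by (auto simp: e intro!: differentiable_add)
qed (auto intro: continuous_intros)

lemma C_k_mult: "C_k k f \<Longrightarrow> C_k k g \<Longrightarrow> C_k k (\<lambda>x. f x * g x)"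
proof (induction k arbitrary: f g)
  case (Suc k)
  have e: "frechet_derivative (\<lambda>x. f x * g x) (at x) =
      (\<lambda>v. f x * frechet_derivative g (at x) v + frechet_derivative f (at x) v * g x)" for x
    using Suc.prems by (intro frechet_derivative_at[symmetric] has_derivative_mult) (auto simp: frechet_derivative_works)
  have "C_k k (\<lambda>x. f x * frechet_derivative g (at x) v + frechet_derivative f (at x) v * g x)" for v
    using Suc.prems by (intro C_k_add Suc.IH Suc.prems[THEN C_k_Suc_imp]) auto
  then show ?case using Suc.prems by (auto simp: e intro!: differentiable_mult)
qed (auto intro: continuous_intros)

lemma C_k_const: "C_k k (\<lambda>_::'a::euclidean_space. c)"
proof (induction k arbitrary: c)
  case (Suc k)
  have "frechet_derivative (\<lambda>_::'a. c) (at x) = (\<lambda>_. 0)" for x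
    by (intro frechet_derivative_at[symmetric]) auto
  then show ?case using Suc by auto
qed auto

lemma C_k_inner: "C_k k (\<lambda>x::'a::euclidean_space. c * (x \<bullet> v))"
proof (cases k)
  case (Suc j)
  have h: "((\<lambda>x. c * (x \<bullet> v)) has_derivative (\<lambda>y. c * (y \<bullet> v))) (at x)" for x :: 'a
    by (auto intro!: derivative_eq_intros)
  then have "frechet_derivative (\<lambda>x. c * (x \<bullet> v)) (at x) = (\<lambda>y. c * (y \<bullet> v))" for x :: 'a
    by (intro frechet_derivative_at[symmetric])
  then show ?thesis using h Suc C_k_const by (auto simp: differentiable_def)
qed (auto intro!: continuous_intros)

text \<open>Differentiability at the origin only needs \<open>\<phi>'\<close> to be bounded near \<open>0\<close>, because
  \<open>\<bar>x\<bar>\<^sup>2\<close> vanishes to second order there.\<close>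

lemma C_k_radial: "Cder {0..} k \<phi> \<Longrightarrow> C_k k (\<lambda>x::'a::euclidean_space. \<phi> ((norm x)\<^sup>2))"
proof (induction k arbitrary: \<phi>)
  case 0
  then show ?case by (auto intro!: continuous_on_compose2[of "{0..}" \<phi>] continuous_intros)
next
  case (Suc k)
  then obtain \<phi>' where d: "\<And>x. x > 0 \<Longrightarrow> (\<phi> has_real_derivative \<phi>' x) (at x)" "Cder {0..} k \<phi>'"
    and c: "continuous_on {0..} \<phi>"
    by auto
  have h: "((\<lambda>x::'a. \<phi> ((norm x)\<^sup>2)) has_derivative (\<lambda>v. \<phi>' ((norm x)\<^sup>2) * (2 * (x \<bullet> v)))) (at x)" for x
  proof (cases "x = 0")
    case False
    have n: "((\<lambda>x::'a. (norm x)\<^sup>2) has_derivative (\<lambda>v. 2 * (x \<bullet> v))) (at x)"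
      unfolding power2_norm_eq_inner by (auto intro!: derivative_eq_intros simp: inner_commute)
    have "(\<phi> has_derivative (\<lambda>y. \<phi>' ((norm x)\<^sup>2) * y)) (at ((norm x)\<^sup>2))"
      using d(1)[of "(norm x)\<^sup>2"] False by (simp add: has_field_derivative_def)
    from has_derivative_compose[OF n this] show ?thesis .
  next
    case True
    have "bounded (\<phi>' ` {0..1})"
      using Cder_continuous[OF d(2)]
      by (intro compact_imp_bounded compact_continuous_image) (auto intro: continuous_on_subset)
    then obtain M where "\<forall>z\<in>\<phi>' ` {0..1}. norm z \<le> M" unfolding bounded_iff by blast
    then have M: "\<bar>\<phi>' R\<bar> \<le> M" if "0 \<le> R" "R \<le> 1" for R using that by auto
    have est: "\<bar>\<phi> R - \<phi> 0\<bar> \<le> M * R" if "0 \<le> R" "R \<le> 1" for R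
    proof (cases "R = 0")
      case False
      then have R: "0 < R" using that by simp
      obtain z where z: "0 < z" "z < R" "\<phi> R - \<phi> 0 = \<phi>' z * (R - 0)"
      proof (rule mvt[OF R, of \<phi> "\<lambda>x y. \<phi>' x * y"])
        show "continuous_on {0..R} \<phi>" using c by (rule continuous_on_subset) auto
        show "(\<phi> has_derivative (\<lambda>y. \<phi>' x * y)) (at x)" if "0 < x" "x < R" for x
          using d(1)[OF that(1)] by (simp add: has_field_derivative_def)
      qed blast
      then have "\<bar>\<phi> R - \<phi> 0\<bar> = R * \<bar>\<phi>' z\<bar>" using R by (simp add: abs_mult mult.commute)
      also have "\<dots> \<le> R * M" using z that R by (intro mult_left_mono M) auto
      finally show ?thesis by (simp add: mult.commute)
    qed auto
    have "((\<lambda>x::'a. \<phi> ((norm x)\<^sup>2)) has_derivative (\<lambda>v. 0)) (at 0)"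
      unfolding has_derivative_at_within
    proof (intro conjI)
      have "((\<lambda>y::'a. M * norm y) \<longlongrightarrow> M * norm (0::'a)) (at 0)" by (intro tendsto_intros)
      then have lim: "((\<lambda>y::'a. M * norm y) \<longlongrightarrow> 0) (at 0)" by simp
      have "\<forall>\<^sub>F y::'a in at 0. dist y 0 < 1"
        by (intro eventually_at[THEN iffD2]) (auto intro!: exI[of _ 1])
      then have ev: "\<forall>\<^sub>F y::'a in at 0. norm ((\<phi> ((norm y)\<^sup>2) - \<phi> ((norm (0::'a))\<^sup>2) - 0) /\<^sub>R norm (y - 0)) \<le> M * norm y"
      proof eventually_elim
        case (elim y)
        then have y: "norm y < 1" by (simp add: dist_norm)
        have "(norm y)\<^sup>2 \<le> 1" using y by (simp add: power_le_one)
        then have "\<bar>\<phi> ((norm y)\<^sup>2) - \<phi> 0\<bar> \<le> M * (norm y)\<^sup>2" by (intro est) auto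
        then show ?case
          by (cases "y = 0") (auto simp: divide_inverse_commute[symmetric] divide_le_eq power2_eq_square mult.assoc)
      qed
      show "((\<lambda>y::'a. (\<phi> ((norm y)\<^sup>2) - \<phi> ((norm (0::'a))\<^sup>2) - 0) /\<^sub>R norm (y - 0)) \<longlongrightarrow> 0) (at 0)"
        by (rule Lim_null_comparison[OF ev lim])
    qed auto
    then show ?thesis using True by simp
  qed
  then have e: "frechet_derivative (\<lambda>x::'a. \<phi> ((norm x)\<^sup>2)) (at x) = (\<lambda>v. \<phi>' ((norm x)\<^sup>2) * (2 * (x \<bullet> v)))" for x
    by (intro frechet_derivative_at[symmetric])
  \<comment> \<open>Each directional derivative is a function of |x|^2 times a linear form, so the
    induction hypothesis for \<open>\<phi>'\<close> closes the step.\<close>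
  have "C_k k (\<lambda>x::'a. \<phi>' ((norm x)\<^sup>2) * (2 * (x \<bullet> v)))" for v
    by (intro C_k_mult Suc.IH d C_k_inner)
  then show ?case using h by (auto simp: e differentiable_def)
qed

definition smooth_on :: "real set \<Rightarrow> (real \<Rightarrow> real) \<Rightarrow> bool" where
  "smooth_on S f \<longleftrightarrow> (\<forall>k. Cder S k f)"

lemma smooth_on_deriv:
  assumes "smooth_on S f" "open S"
  shows "x \<in> S \<Longrightarrow> (f has_real_derivative deriv f x) (at x)" and "smooth_on S (deriv f)"
proof -
  have *: "(\<forall>x\<in>S. (f has_real_derivative deriv f x) (at x)) \<and> Cder S k (deriv f)" for k
  proof -
    have "Cder S (Suc k) f" using assms(1) unfolding smooth_on_def by blast
    then obtain d where "continuous_on S f" "\<forall>x\<in>interior S. (f has_real_derivative d x) (at x)" "Cder S k d"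
      by (rule Cder_SucE)
    then have d: "\<forall>x\<in>S. (f has_real_derivative d x) (at x)" "Cder S k d"
      using assms(2) by (auto simp: interior_open)
    then have e: "d x = deriv f x" if "x \<in> S" for x using that by (auto intro: DERIV_imp_deriv[symmetric])
    then show ?thesis using d Cder_cong[OF d(2) e] by auto
  qed
  then show "x \<in> S \<Longrightarrow> (f has_real_derivative deriv f x) (at x)" "smooth_on S (deriv f)"
    unfolding smooth_on_def by blast+
qed

lemma smooth_onI:
  assumes "open S" "\<And>x. x \<in> S \<Longrightarrow> (f has_real_derivative d x) (at x)" "smooth_on S d"
  shows "smooth_on S f"
proof -
  have c: "continuous_on S f"
    using assms(2) by (intro continuous_at_imp_continuous_on ballI DERIV_isCont)
  have "Cder S k f" for k
  proof (cases k)
    case 0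
    then show ?thesis using c by simp
  next
    case (Suc j)
    have "Cder S (Suc j) f"
      by (rule Cder_SucI[OF c]) (use assms in \<open>auto simp: smooth_on_def interior_open\<close>)
    then show ?thesis using Suc by simp
  qed
  then show ?thesis by (simp add: smooth_on_def)
qed

lemma smooth_on_cong: "smooth_on S f \<Longrightarrow> (\<And>x. x \<in> S \<Longrightarrow> f x = g x) \<Longrightarrow> smooth_on S g"
  unfolding smooth_on_def using Cder_cong by blast

lemma smooth_on_add: "smooth_on S f \<Longrightarrow> smooth_on S g \<Longrightarrow> smooth_on S (\<lambda>x. f x + g x)"
  unfolding smooth_on_def using Cder_add by blast

lemma smooth_on_mult: "smooth_on S f \<Longrightarrow> smooth_on S g \<Longrightarrow> smooth_on S (\<lambda>x. f x * g x)"
  unfolding smooth_on_def using Cder_mult by blast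

lemma smooth_on_const: "smooth_on S (\<lambda>_. c)"
  unfolding smooth_on_def using Cder_const by blast

lemma smooth_on_power: "smooth_on S (\<lambda>x. x ^ n)"
proof (induction n)
  case (Suc n)
  have "smooth_on S (\<lambda>x. x)" unfolding smooth_on_def using Cder_ident by blast
  from smooth_on_mult[OF this Suc] show ?case by simp
qed (simp add: smooth_on_const)

lemma smooth_on_subset: "smooth_on T f \<Longrightarrow> S \<subseteq> T \<Longrightarrow> smooth_on S f"
  unfolding smooth_on_def using Cder_subset by blast

section \<open>The second moment as a smooth function of t^2\<close>

text \<open>With v = u^2 and T = t^2, \<open>Pq u t\<close> = (v - 1 - T)^2 - 4 T, so one y with y^2
  = \<open>Pq u t\<close> belongs to the two values v = 1 + T + sqrt (4 T + y^2) and v = 1 + T -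
  sqrt (4 T + y^2). The integral runs over the segment between them; the exponent i starts at 0 and
  grows with each differentiation in T.\<close>

definition Zint :: "nat \<Rightarrow> (real \<Rightarrow> real) \<Rightarrow> real \<Rightarrow> real \<Rightarrow> real" where
  "Zint i \<eta> T y = integral {-1..1} (\<lambda>x. (1 - x\<^sup>2) ^ i * \<eta> (1 + T + x * sqrt (4 * T + y\<^sup>2)))"

text \<open>The power y^m collects y^(2 \<mu>) from \<open>Pq u t powr \<mu>\<close> and a factor y
  from the substitution, so m = 2 \<mu> + 1 = n - 2. For u at most 2 in the range of integration
  \<open>Pq u t\<close> is at most 9, which explains the limit 3.\<close>

definition Yint :: "nat \<Rightarrow> nat \<Rightarrow> (real \<Rightarrow> real) \<Rightarrow> real \<Rightarrow> real" where
  "Yint m i \<eta> T = integral {0..3} (\<lambda>y. y ^ m * Zint i \<eta> T y)"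

lemma smooth_on_UNIV_continuous: "smooth_on UNIV \<eta> \<Longrightarrow> continuous_on A \<eta>"
  unfolding smooth_on_def by (metis Cder_continuous continuous_on_subset subset_UNIV)

lemma Zint_continuous:
  assumes \<eta>: "continuous_on UNIV \<eta>"
  shows "continuous_on UNIV (\<lambda>(T, y). Zint i \<eta> T y)"
proof -
  have "continuous_on (UNIV \<times> cbox (-1) 1) (\<lambda>(p, x::real). (1 - x\<^sup>2) ^ i * \<eta> (1 + fst p + x * sqrt (4 * fst p + (snd p)\<^sup>2)))"
    unfolding case_prod_beta
    by (intro continuous_intros continuous_on_compose2[OF \<eta>]) auto
  from integral_continuous_on_param[OF this]
  show ?thesis by (simp add: Zint_def case_prod_beta)
qed

lemma Yint_continuous:
  assumes \<eta>: "continuous_on UNIV \<eta>"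
  shows "continuous_on UNIV (Yint m i \<eta>)"
proof -
  have "continuous_on (UNIV \<times> cbox 0 3) (\<lambda>(T, y). y ^ m * Zint i \<eta> T y)"
    unfolding case_prod_beta
    by (intro continuous_intros continuous_on_subset[OF Zint_continuous[OF \<eta>, unfolded case_prod_beta]]) auto
  from integral_continuous_on_param[OF this]
  show ?thesis by (simp add: Yint_def[abs_def])
qed

text \<open>Integrating by parts in \<open>x\<close> turns the factor \<open>x / sqrt (4 * T + y\<^sup>2)\<close> that the chain rule
  produces into one more factor \<open>1 - x\<^sup>2\<close>, so that nothing is singular at \<open>T = 0\<close>.\<close>

lemma Zint_deriv:
  assumes T: "T > 0" and d1: "\<And>v. (\<eta> has_real_derivative \<eta>1 v) (at v)"
    and d2: "\<And>v. (\<eta>1 has_real_derivative \<eta>2 v) (at v)" and c2: "continuous_on UNIV \<eta>2"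
  shows "((\<lambda>T. Zint i \<eta> T y) has_real_derivative Zint i \<eta>1 T y + 1 / real (Suc i) * Zint (Suc i) \<eta>2 T y) (at T)"
proof -
  have c0: "continuous_on UNIV \<eta>"
    by (rule DERIV_continuous_on[of _ _ \<eta>1]) (use d1 in simp)
  have c1: "continuous_on UNIV \<eta>1"
    by (rule DERIV_continuous_on[of _ _ \<eta>2]) (use d2 in simp)
  let ?s = "\<lambda>T. sqrt (4 * T + y\<^sup>2)"
  have sp: "4 * T + y\<^sup>2 > 0" if "T > 0" for T using that by (simp add: add_pos_nonneg)
  define f where "f T x = (1 - x\<^sup>2) ^ i * \<eta> (1 + T + x * ?s T)" for T x
  define fx where "fx T x = (1 - x\<^sup>2) ^ i * (\<eta>1 (1 + T + x * ?s T) * (1 + x * (2 / ?s T)))" for T x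
  have "((\<lambda>T. integral (cbox (-1) 1) (f T)) has_real_derivative integral (cbox (-1) 1) (fx T)) (at T within {0<..})"
  proof (rule leibniz_rule_field_derivative)
    fix T x :: real assume "T \<in> {0<..}"
    then have T: "T > 0" by simp
    have "((\<lambda>T. ?s T) has_real_derivative 2 / ?s T) (at T)"
      using sp[OF T] by (auto intro!: derivative_eq_intros simp: field_simps)
    then have "((\<lambda>T. 1 + T + x * ?s T) has_real_derivative (1 + x * (2 / ?s T))) (at T)"
      by (rule DERIV_cong[OF DERIV_add[OF DERIV_add[OF DERIV_const DERIV_ident] DERIV_cmult]]) simp
    from DERIV_chain2[OF d1 this]
    have "((\<lambda>T. f T x) has_real_derivative fx T x) (at T)"
      unfolding f_def fx_def by (rule DERIV_cmult)
    then show "((\<lambda>T. f T x) has_real_derivative fx T x) (at T within {0<..})"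
      by (rule has_field_derivative_at_within)
  next
    fix T :: real
    show "f T integrable_on cbox (-1) 1" unfolding f_def
      by (intro integrable_continuous continuous_intros continuous_on_compose2[OF c0]) auto
  next
    have "sqrt (4 * fst p + y\<^sup>2) \<noteq> 0" if "p \<in> {0<..} \<times> cbox (-1) 1" for p :: "real \<times> real"
      using that sp[of "fst p"] by auto
    then show "continuous_on ({0<..} \<times> cbox (-1) 1) (\<lambda>(T, x). fx T x)"
      unfolding fx_def case_prod_beta
      by (intro continuous_intros continuous_on_compose2[OF c1]) auto
  qed (use T in auto)
  then have D: "((\<lambda>T. Zint i \<eta> T y) has_real_derivative integral {-1..1} (fx T)) (at T)"
    using T by (simp add: Zint_def f_def[abs_def] at_within_open[of T "{0<..}"])
  define s where "s = ?s T"
  have s: "s > 0" using sp[OF T] by (simp add: s_def)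
  define a where "a = 1 + T"
  let ?A = "\<lambda>x. (1 - x\<^sup>2) ^ i * \<eta>1 (a + x * s)"
  let ?B = "\<lambda>x. (1 - x\<^sup>2) ^ Suc i * \<eta>2 (a + x * s)"
  let ?J = "\<lambda>x. (1 - x\<^sup>2) ^ i * (x * \<eta>1 (a + x * s))"
  have iA: "?A integrable_on {-1..1}" and iB: "?B integrable_on {-1..1}" and iJ: "?J integrable_on {-1..1}"
    by (intro integrable_continuous_interval continuous_intros continuous_on_compose2[OF c1] continuous_on_compose2[OF c2]; simp)+
  have "((\<lambda>x. s * ?B x - 2 * real (Suc i) * ?J x) has_integral
      ((1 - 1\<^sup>2) ^ Suc i * \<eta>1 (a + 1 * s) - (1 - (-1)\<^sup>2) ^ Suc i * \<eta>1 (a + (-1) * s))) {-1..1}"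
  proof (rule fundamental_theorem_of_calculus)
    fix x :: real
    have e: "((\<lambda>x. \<eta>1 (a + x * s)) has_real_derivative \<eta>2 (a + x * s) * s) (at x)"
      by (rule DERIV_chain2[OF d2]) (auto intro!: derivative_eq_intros)
    have p: "((\<lambda>x. (1 - x\<^sup>2) ^ Suc i) has_real_derivative real (Suc i) * (1 - x\<^sup>2) ^ i * (- (2 * x))) (at x)"
      by (rule DERIV_power_Suc[THEN DERIV_cong]) (auto intro!: derivative_eq_intros)
    have "((\<lambda>x. (1 - x\<^sup>2) ^ Suc i * \<eta>1 (a + x * s)) has_real_derivative s * ?B x - 2 * real (Suc i) * ?J x) (at x)"
      by (rule DERIV_cong[OF DERIV_mult[OF p e]]) (simp add: algebra_simps)
    then show "((\<lambda>x. (1 - x\<^sup>2) ^ Suc i * \<eta>1 (a + x * s)) has_vector_derivative s * ?B x - 2 * real (Suc i) * ?J x) (at x within {-1..1})"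
      by (auto simp: has_real_derivative_iff_has_vector_derivative intro: has_vector_derivative_at_within)
  qed auto
  then have "integral {-1..1} (\<lambda>x. s * ?B x - 2 * real (Suc i) * ?J x) = 0"
    by (auto simp: integral_unique)
  moreover have "integral {-1..1} (\<lambda>x. s * ?B x - 2 * real (Suc i) * ?J x) =
     s * integral {-1..1} ?B - 2 * real (Suc i) * integral {-1..1} ?J"
    by (intro integral_unique has_integral_diff has_integral_mult_right integrable_integral iB iJ)
  ultimately have J: "integral {-1..1} ?J = s / (2 * real (Suc i)) * integral {-1..1} ?B"
    by (simp add: field_simps)
  have "integral {-1..1} (fx T) = integral {-1..1} (\<lambda>x. ?A x + 2 / s * ?J x)"
    by (intro integral_cong) (simp add: fx_def s_def a_def algebra_simps)
  also have "\<dots> = integral {-1..1} ?A + 2 / s * integral {-1..1} ?J"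
    by (intro integral_unique has_integral_add has_integral_mult_right integrable_integral iA iJ)
  also have "\<dots> = Zint i \<eta>1 T y + 1 / real (Suc i) * Zint (Suc i) \<eta>2 T y"
    unfolding J using s by (simp add: Zint_def a_def s_def field_simps)
  finally show ?thesis using D by simp
qed

lemma Yint_deriv:
  assumes T: "T > 0" and d1: "\<And>v. (\<eta> has_real_derivative \<eta>1 v) (at v)"
    and d2: "\<And>v. (\<eta>1 has_real_derivative \<eta>2 v) (at v)" and c2: "continuous_on UNIV \<eta>2"
  shows "(Yint m i \<eta> has_real_derivative Yint m i \<eta>1 T + 1 / real (Suc i) * Yint m (Suc i) \<eta>2 T) (at T)"
proof -
  have c0: "continuous_on UNIV \<eta>"
    by (rule DERIV_continuous_on[of _ _ \<eta>1]) (use d1 in simp)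
  have c1: "continuous_on UNIV \<eta>1"
    by (rule DERIV_continuous_on[of _ _ \<eta>2]) (use d2 in simp)
  let ?g = "\<lambda>T y. y ^ m * (Zint i \<eta>1 T y + 1 / real (Suc i) * Zint (Suc i) \<eta>2 T y)"
  have cz: "continuous_on A (\<lambda>y. Zint j \<theta> T y)" if "continuous_on UNIV \<theta>" for j \<theta> A and T :: real
  proof -
    have "continuous_on A (\<lambda>y. (T, y))" by (intro continuous_intros)
    then have "continuous_on A ((\<lambda>(T, y). Zint j \<theta> T y) \<circ> (\<lambda>y. (T, y)))"
      by (rule continuous_on_compose) (rule continuous_on_subset[OF Zint_continuous[OF that] subset_UNIV])
    then show ?thesis by (simp only: o_def prod.case)
  qed
  have "((\<lambda>T. integral (cbox 0 3) (\<lambda>y. y ^ m * Zint i \<eta> T y)) has_real_derivative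
     integral (cbox 0 3) (?g T)) (at T within {0<..})"
  proof (rule leibniz_rule_field_derivative)
    fix T y :: real assume "T \<in> {0<..}"
    then show "((\<lambda>T. y ^ m * Zint i \<eta> T y) has_real_derivative ?g T y) (at T within {0<..})"
      by (intro has_field_derivative_at_within[OF DERIV_cmult[OF Zint_deriv[OF _ d1 d2 c2]]]) simp
  next
    show "(\<lambda>y. y ^ m * Zint i \<eta> T y) integrable_on cbox 0 3" for T
      by (rule integrable_continuous) (rule continuous_on_mult[OF continuous_on_power[OF continuous_on_id] cz[OF c0]])
    show "continuous_on ({0<..} \<times> cbox 0 3) (\<lambda>(T, y). ?g T y)"
      unfolding case_prod_beta
      by (intro continuous_on_mult continuous_on_power continuous_on_add continuous_on_const continuous_on_snd continuous_on_id
        continuous_on_subset[OF Zint_continuous[OF c1, unfolded case_prod_beta] subset_UNIV]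
        continuous_on_subset[OF Zint_continuous[OF c2, unfolded case_prod_beta] subset_UNIV])
  qed (use T in auto)
  then have D: "(Yint m i \<eta> has_real_derivative integral {0..3} (?g T)) (at T)"
    using T by (simp add: Yint_def[abs_def] at_within_open[of T "{0<..}"])
  have "integral {0..3} (?g T) = integral {0..3} (\<lambda>y. y ^ m * Zint i \<eta>1 T y + 1 / real (Suc i) * (y ^ m * Zint (Suc i) \<eta>2 T y))"
    by (intro integral_cong) (simp add: algebra_simps)
  also have "\<dots> = Yint m i \<eta>1 T + 1 / real (Suc i) * Yint m (Suc i) \<eta>2 T"
    unfolding Yint_def
    by (intro integral_unique has_integral_add has_integral_mult_right integrable_integral
      integrable_continuous_interval continuous_on_mult continuous_on_power continuous_on_id cz c1 c2)
  finally show ?thesis using D by simp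
qed

text \<open>By \<open>Yint_deriv\<close> the T-derivative is again a combination of such integrals,
  with \<eta>' and \<eta>'' in place of \<eta> and i possibly raised; every member of the family is
  continuous at T = 0. Hence the induction is over all i and \<eta> at once.\<close>

lemma Cder_Yint: "smooth_on UNIV \<eta> \<Longrightarrow> Cder {0..} k (Yint m i \<eta>)"
proof (induction k arbitrary: i \<eta>)
  case 0
  then show ?case using continuous_on_subset[OF Yint_continuous[OF smooth_on_UNIV_continuous]] by auto
next
  case (Suc k)
  have s: "smooth_on UNIV (deriv \<eta>)" "smooth_on UNIV (deriv (deriv \<eta>))"
    using Suc.prems smooth_on_deriv(2)[OF _ open_UNIV] by blast+
  have "Cder {0..} k (\<lambda>T. Yint m i (deriv \<eta>) T + 1 / real (Suc i) * Yint m (Suc i) (deriv (deriv \<eta>)) T)"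
    by (intro Cder_add Cder_mult Cder_const Suc.IH s)
  moreover have "(Yint m i \<eta> has_real_derivative Yint m i (deriv \<eta>) T + 1 / real (Suc i) * Yint m (Suc i) (deriv (deriv \<eta>)) T) (at T)"
    if "T \<in> interior {0..}" for T
    using that Suc.prems s by (intro Yint_deriv smooth_on_deriv(1)[OF _ open_UNIV UNIV_I] smooth_on_UNIV_continuous) auto
  moreover have "continuous_on {0..} (Yint m i \<eta>)"
    using Suc.prems by (intro continuous_on_subset[OF Yint_continuous[OF smooth_on_UNIV_continuous]]) auto
  ultimately show ?case by (intro Cder_SucI)
qed

text \<open>The sign s selects the part u > 1 or u < 1. For s = -1 the variable is x = -u, so that
  the substitution is increasing in both cases and one argument serves both; \<open>Y\<close> keeps
  the value of v = u^2 positive.\<close>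

lemma half_moment_substitution:
  fixes g :: "real \<Rightarrow> real" and m :: nat
  assumes \<mu>: "real m = 2 * \<mu> + 1" and t: "0 < t" and s: "s = 1 \<or> s = -1" and Y: "0 \<le> Y"
    and pos: "\<And>y. 0 \<le> y \<Longrightarrow> y \<le> Y \<Longrightarrow> 1 + t\<^sup>2 + s * sqrt (4 * t\<^sup>2 + y\<^sup>2) > 0"
  defines "G \<equiv> \<lambda>y. s * sqrt (1 + t\<^sup>2 + s * sqrt (4 * t\<^sup>2 + y\<^sup>2))"
    and "F \<equiv> \<lambda>x. (s * x) ^ 3 * g (s * x) * Pq (s * x) t powr \<mu>"
    and "\<eta> \<equiv> \<lambda>v. 1 / 2 * v * g (sqrt v)"
  assumes int: "set_integrable lborel {G 0..G Y} F"
  shows "set_integrable lborel {0..Y} (\<lambda>y. y ^ m * (\<eta> (1 + t\<^sup>2 + s * sqrt (4 * t\<^sup>2 + y\<^sup>2)) / sqrt (4 * t\<^sup>2 + y\<^sup>2)))"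
    and "(LBINT x:{G 0..G Y}. F x) =
      (LBINT y:{0..Y}. y ^ m * (\<eta> (1 + t\<^sup>2 + s * sqrt (4 * t\<^sup>2 + y\<^sup>2)) / sqrt (4 * t\<^sup>2 + y\<^sup>2)))"
proof -
  define w where "w y = sqrt (4 * t\<^sup>2 + y\<^sup>2)" for y
  have w: "w y > 0" "(w y)\<^sup>2 = 4 * t\<^sup>2 + y\<^sup>2" for y
    using t by (auto simp: w_def add_pos_nonneg)
  have dw: "(w has_real_derivative y / w y) (at y)" for y
    unfolding w_def[abs_def] using w(1)[of y] t
    by (auto intro!: derivative_eq_intros simp: w_def field_simps add_pos_nonneg)
  have cw: "continuous_on A w" for A unfolding w_def[abs_def] by (intro continuous_intros)
  define v where "v y = 1 + t\<^sup>2 + s * w y" for y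
  have vp: "v y > 0" if "y \<in> {0..Y}" for y using pos[of y] that by (simp add: v_def w_def)
  have G: "G y = s * sqrt (v y)" for y by (simp add: G_def v_def w_def)
  have ss: "s * s = 1" using s by auto
  define G' where "G' y = (y / w y) / (2 * sqrt (v y))" for y
  have dG: "(G has_real_derivative G' y) (at y)" if "y \<in> {0..Y}" for y
  proof -
    have "(v has_real_derivative s * (y / w y)) (at y)"
      unfolding v_def[abs_def] by (auto intro!: derivative_eq_intros dw)
    from DERIV_cmult[OF DERIV_chain2[OF DERIV_real_sqrt[OF vp[OF that]] this], of s]
    have "(G has_real_derivative s * (inverse (sqrt (v y)) / 2 * (s * (y / w y)))) (at y)"
      unfolding G[abs_def] .
    moreover have "s * (inverse (sqrt (v y)) / 2 * (s * (y / w y))) = (s * s) * (inverse (sqrt (v y)) / 2 * (y / w y))"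
      by (simp only: mult_ac)
    moreover have "inverse (sqrt (v y)) / 2 * (y / w y) = G' y"
      using w(1)[of y] vp[OF that] by (simp add: G'_def field_simps)
    ultimately show ?thesis by (simp only: ss mult_1_left)
  qed
  have cG': "continuous_on {0..Y} G'"
  proof -
    have "w y \<noteq> 0" for y using w(1)[of y] by simp
    moreover have "2 * sqrt (v y) \<noteq> 0" if "y \<in> {0..Y}" for y using vp[OF that] by simp
    ultimately show ?thesis unfolding G'_def
      by (intro continuous_intros cw) (auto simp: v_def intro!: continuous_intros cw)
  qed
  have nn: "0 \<le> G' y" if "y \<in> {0..Y}" for y using that w(1)[of y] vp[OF that] by (simp add: G'_def)
  \<comment> \<open>At y = 0 the left side is 0 because \<open>Pq\<close> vanishes there, while for
    m = 0 the right side need not be.\<close>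
  have FG: "F (G y) * G' y = y ^ m * (\<eta> (v y) / w y)" if "y \<in> {0..Y}" "y \<noteq> 0" for y
  proof -
    have y: "y > 0" using that by auto
    define q where "q = sqrt (v y)"
    have q: "q > 0" "q\<^sup>2 = v y" using vp[OF that(1)] by (auto simp: q_def less_imp_le)
    have sG: "s * G y = q" using ss by (simp add: G q_def mult.assoc[symmetric])
    have "Pq q t = (q\<^sup>2 - 1 - t\<^sup>2)\<^sup>2 - 4 * t\<^sup>2" unfolding Pq_def by algebra
    also have "q\<^sup>2 - 1 - t\<^sup>2 = s * w y" by (simp add: q v_def)
    also have "(s * w y)\<^sup>2 = 4 * t\<^sup>2 + y\<^sup>2" using ss w(2)[of y] by (simp only: power_mult_distrib power2_eq_square[of s]) simp
    finally have "Pq q t = y\<^sup>2" by simp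
    also have "y\<^sup>2 = y powr 2" using y by simp
    finally have P: "Pq q t powr \<mu> = y powr (2 * \<mu>)" by (simp only: powr_powr)
    have "y powr (2 * \<mu>) * y = y ^ m"
      using y \<mu> powr_realpow[OF y, of m] by (simp add: powr_add)
    then have "F (G y) * G' y = q ^ 3 * g q * (y ^ m / w y) / (2 * q)"
      unfolding F_def sG P G'_def q_def[symmetric] by (simp add: mult_ac)
    also have "\<dots> = y ^ m * (1 / 2 * q\<^sup>2 * g q / w y)"
      using q(1) by (simp add: field_simps power2_eq_square power3_eq_cube)
    finally show ?thesis by (simp add: \<eta>_def q q_def[symmetric] del: real_sqrt_pow2_iff)
  qed
  note sub = integral_substitution[of G 0 Y F G', OF int dG cG' nn Y]
  let ?H = "\<lambda>y. y ^ m * (\<eta> (v y) / w y)"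
  have ae: "AE y in lborel. indicator {0..Y} y *\<^sub>R (F (G y) * G' y) = indicator {0..Y} y *\<^sub>R ?H y"
    using AE_lborel_singleton[of "0::real"]
  proof eventually_elim
    case (elim y)
    then show ?case using FG[of y] by (cases "y \<in> {0..Y}") auto
  qed
  have "has_bochner_integral lborel (\<lambda>y. indicator {0..Y} y *\<^sub>R (F (G y) * G' y)) (LBINT x:{G 0..G Y}. F x)"
    using sub by (simp add: has_bochner_integral_iff set_integrable_def set_lebesgue_integral_def mult.commute)
  moreover have m1: "(\<lambda>y. indicator {0..Y} y *\<^sub>R (F (G y) * G' y)) \<in> borel_measurable lborel"
    using sub(1) by (auto simp: set_integrable_def dest: borel_measurable_integrable)
  moreover have m2: "(\<lambda>y. indicator {0..Y} y *\<^sub>R ?H y) \<in> borel_measurable lborel"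
  proof -
    have eq: "(\<lambda>y. indicator {0..Y} y *\<^sub>R ?H y) =
       (\<lambda>y. if y = 0 then indicator {0..Y} 0 *\<^sub>R ?H 0 else indicator {0..Y} y *\<^sub>R (F (G y) * G' y))"
    proof
      fix y
      show "indicator {0..Y} y *\<^sub>R ?H y = (if y = 0 then indicator {0..Y} 0 *\<^sub>R ?H 0 else indicator {0..Y} y *\<^sub>R (F (G y) * G' y))"
        using FG[of y] by (cases "y \<in> {0..Y}") auto
    qed
    show ?thesis unfolding eq by (rule measurable_If[OF _ m1]) measurable
  qed
  ultimately have "has_bochner_integral lborel (\<lambda>y. indicator {0..Y} y *\<^sub>R ?H y) (LBINT x:{G 0..G Y}. F x)"
    using has_bochner_integral_cong_AE[OF m1 m2 ae] by blast
  then show "set_integrable lborel {0..Y} (\<lambda>y. y ^ m * (\<eta> (1 + t\<^sup>2 + s * sqrt (4 * t\<^sup>2 + y\<^sup>2)) / sqrt (4 * t\<^sup>2 + y\<^sup>2)))"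
    and "(LBINT x:{G 0..G Y}. F x) =
      (LBINT y:{0..Y}. y ^ m * (\<eta> (1 + t\<^sup>2 + s * sqrt (4 * t\<^sup>2 + y\<^sup>2)) / sqrt (4 * t\<^sup>2 + y\<^sup>2)))"
    by (simp_all add: has_bochner_integral_iff set_integrable_def set_lebesgue_integral_def v_def w_def)
qed

text \<open>Since u^3 du = v dv / 2, the u-integrand in terms of v is \<eta>. The parts u > 1 and u
  < 1 give \<eta>(1 + T + w) / w and \<eta>(1 + T - w) / w with w = sqrt (4 T + y^2), and the moment
  is their difference.\<close>

lemma second_moment_Yint:
  fixes g :: "real \<Rightarrow> real" and m :: nat
  assumes \<mu>: "real m = 2 * \<mu> + 1" and t: "0 < t" "t < 1" and g: "tame g"
  defines "\<eta> \<equiv> \<lambda>v. 1 / 2 * v * g (sqrt v)"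
  assumes \<eta>1: "\<And>v. (\<eta> has_real_derivative \<eta>1 v) (at v)" and c1: "continuous_on UNIV \<eta>1"
  shows "mom \<mu> (\<lambda>u. u\<^sup>2 * g u) t = Yint m 0 \<eta>1 (t\<^sup>2)"
proof -
  have \<mu>1: "\<mu> > -1" using \<mu> by linarith
  obtain \<epsilon> where \<epsilon>: "\<epsilon> > 0" "\<And>u. g u \<noteq> 0 \<Longrightarrow> \<epsilon> \<le> u \<and> u \<le> 2 - \<epsilon>"
    using g unfolding tame_def by blast
  \<comment> \<open>Negative arguments occur below; there \<open>sqrt v\<close> is negative as well,
    and g vanishes.\<close>
  have \<eta>0: "\<eta> v = 0" if "v \<le> 0 \<or> v < \<epsilon>\<^sup>2 \<or> 4 \<le> v" for v
  proof (cases "v \<le> 0 \<or> v < \<epsilon>\<^sup>2")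
    case True
    then have "sqrt v < \<epsilon>"
    proof
      assume "v \<le> 0"
      then have "sqrt v \<le> 0" by simp
      then show ?thesis using \<epsilon>(1) by linarith
    next
      assume "v < \<epsilon>\<^sup>2"
      then show ?thesis using real_sqrt_less_mono[of v "\<epsilon>\<^sup>2"] \<epsilon>(1) by simp
    qed
    then show ?thesis using \<epsilon>(2)[of "sqrt v"] by (auto simp: \<eta>_def)
  next
    case False
    then have "2 \<le> sqrt v" using that by (intro real_le_rsqrt) auto
    then show ?thesis using \<epsilon>(2)[of "sqrt v"] \<epsilon>(1) by (auto simp: \<eta>_def)
  qed
  define w where "w y = sqrt (4 * t\<^sup>2 + y\<^sup>2)" for y
  have w: "w y > 0" "(w y)\<^sup>2 = 4 * t\<^sup>2 + y\<^sup>2" for y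
    using t by (auto simp: w_def add_pos_nonneg)
  have w0: "w 0 = 2 * t" using t by (simp add: w_def real_sqrt_mult)
  define f where "f u = u ^ 3 * g u * Pq u t powr \<mu>" for u
  have fint: "integrable lborel (\<lambda>u. u * (u\<^sup>2 * g u) * pker \<mu> t u)"
    by (intro mom_integrable[OF \<mu>1 t] tame_mult[OF g] continuous_intros)
  have fup: "indicator {1+t..} u * f u = indicator {1..} u * (u * (u\<^sup>2 * g u) * pker \<mu> t u)" for u
  proof -
    consider "u < 1 + t" | "u = 1 + t" | "1 + t < u" "u < 2" | "2 \<le> u" by linarith
    then show ?thesis
    proof cases
      case 2
      then show ?thesis using t by (simp add: f_def Pq_def pker_def)
    next
      case 4
      then have "g u = 0" using \<epsilon> by force
      then show ?thesis by (simp add: f_def)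
    qed (use t in \<open>auto simp: f_def pker_def power2_eq_square power3_eq_cube indicator_def\<close>)
  qed
  have flo: "indicator {0..1-t} u * f u = - (indicator {..<1} u * (u * (u\<^sup>2 * g u) * pker \<mu> t u))" for u
  proof -
    consider "1 - t < u" | "u = 1 - t" | "0 < u" "u < 1 - t" | "u \<le> 0" by linarith
    then show ?thesis
    proof cases
      case 2
      then show ?thesis using t by (simp add: f_def Pq_def pker_def)
    next
      case 4
      then have "g u = 0" using \<epsilon> by force
      then show ?thesis by (simp add: f_def)
    qed (use t in \<open>auto simp: f_def pker_def power2_eq_square power3_eq_cube indicator_def sgn_if\<close>)
  qed
  have iup: "integrable lborel (\<lambda>u. indicator {1+t..} u * f u)"
    unfolding fup using integrable_mult_indicator[OF _ fint, of "{1..}"] by simp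
  have ilo: "integrable lborel (\<lambda>u. indicator {0..1-t} u * f u)"
    unfolding flo using integrable_mult_indicator[OF _ fint, of "{..<1}"] by simp
  have momsplit: "mom \<mu> (\<lambda>u. u\<^sup>2 * g u) t = (\<integral>u. indicator {1+t..} u * f u \<partial>lborel) - (\<integral>u. indicator {0..1-t} u * f u \<partial>lborel)"
  proof -
    have "u * (u\<^sup>2 * g u) * pker \<mu> t u = indicator {1+t..} u * f u - indicator {0..1-t} u * f u" for u
      unfolding fup flo by (auto simp: indicator_def)
    then show ?thesis unfolding mom_def
      using Bochner_Integration.integral_diff[OF iup ilo] by presburger
  qed
  have up: "has_bochner_integral lborel (\<lambda>y. indicator {0..3} y * (y ^ m * (\<eta> (1 + t\<^sup>2 + w y) / w y))) (\<integral>u. indicator {1+t..} u * f u \<partial>lborel)"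
  proof -
    let ?G = "\<lambda>y. 1 * sqrt (1 + t\<^sup>2 + 1 * sqrt (4 * t\<^sup>2 + y\<^sup>2))"
    let ?F = "\<lambda>x. (1 * x) ^ 3 * g (1 * x) * Pq (1 * x) t powr \<mu>"
    have "1 + t\<^sup>2 + 2 * t = (1 + t)\<^sup>2" by algebra
    then have G0: "?G 0 = 1 + t" using w0 t by (simp add: w_def)
    \<comment> \<open>At y = 3 the substituted u is at least 2, hence beyond the support of
      g.\<close>
    have "3 \<le> w 3" unfolding w_def by (intro real_le_rsqrt) simp
    then have "4 \<le> 1 + t\<^sup>2 + w 3" using zero_le_power2[of t] by linarith
    then have G3: "2 \<le> ?G 3" by (simp add: w_def real_le_rsqrt)
    have e: "indicator {?G 0..?G 3} u *\<^sub>R ?F u = indicator {1+t..} u * f u" for u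
    proof (cases "u \<le> ?G 3")
      case False
      then have "g u = 0" using G3 \<epsilon> by force
      then show ?thesis by (simp add: f_def)
    next
      case True
      then show ?thesis unfolding G0 by (simp only: indicator_def f_def mult_1_left atLeastAtMost_iff atLeast_iff) simp
    qed
    have int: "set_integrable lborel {?G 0..?G 3} ?F"
      unfolding set_integrable_def e by (rule iup)
    have pos: "1 + t\<^sup>2 + 1 * sqrt (4 * t\<^sup>2 + y\<^sup>2) > 0" for y
      using w(1)[of y] by (simp add: w_def add_pos_pos add_pos_nonneg)
    note H = half_moment_substitution[OF \<mu> t(1), of 1 3 g, OF _ _ pos int]
    have "set_integrable lborel {0..3} (\<lambda>y. y ^ m * (\<eta> (1 + t\<^sup>2 + w y) / w y))"
      using H(1) by (simp add: \<eta>_def w_def)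
    moreover have "(\<integral>u. indicator {1+t..} u * f u \<partial>lborel) = (LBINT y:{0..3}. y ^ m * (\<eta> (1 + t\<^sup>2 + w y) / w y))"
      using H(2) unfolding set_lebesgue_integral_def[of _ "{_.._}" ?F] e by (simp add: \<eta>_def w_def)
    ultimately show ?thesis by (simp add: has_bochner_integral_iff set_integrable_def set_lebesgue_integral_def)
  qed
  have lo: "has_bochner_integral lborel (\<lambda>y. indicator {0..3} y * (y ^ m * (\<eta> (1 + t\<^sup>2 - w y) / w y))) (\<integral>u. indicator {0..1-t} u * f u \<partial>lborel)"
  proof -
    \<comment> \<open>The lower part stops at u = e instead of u = 0, because the square root in the
      substitution must stay positive. Nothing is lost since g vanishes below \<epsilon>, and
      \<open>Y\<close> is the value of y at u = e.\<close>
    define e where "e = min \<epsilon> (1 - t)"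
    have e: "0 < e" "e \<le> \<epsilon>" "e \<le> 1 - t" using \<epsilon> t by (auto simp: e_def)
    define Y where "Y = sqrt (Pq e t)"
    have e2: "e\<^sup>2 \<le> (1 - t)\<^sup>2" using e by (intro power_mono) auto
    have "Pq e t = (1 + t\<^sup>2 - e\<^sup>2)\<^sup>2 - 4 * t\<^sup>2" unfolding Pq_def by algebra
    moreover have c: "2 * t \<le> 1 + t\<^sup>2 - e\<^sup>2" using e2 by (simp add: power2_diff)
    then have "(2 * t)\<^sup>2 \<le> (1 + t\<^sup>2 - e\<^sup>2)\<^sup>2" using t by (intro power_mono) auto
    ultimately have Y: "0 \<le> Y" "Y\<^sup>2 = (1 + t\<^sup>2 - e\<^sup>2)\<^sup>2 - 4 * t\<^sup>2"
      by (auto simp: Y_def power_mult_distrib)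
    have wY: "w Y = 1 + t\<^sup>2 - e\<^sup>2" unfolding w_def Y(2) using c t by simp
    have "Y \<le> 3"
    proof -
      have "(1 + t\<^sup>2 - e\<^sup>2)\<^sup>2 \<le> 2\<^sup>2"
      proof (rule power_mono)
        have "t\<^sup>2 \<le> 1" using t by (simp add: power_le_one)
        then show "1 + t\<^sup>2 - e\<^sup>2 \<le> 2" using zero_le_power2[of e] by linarith
      qed (use c t in linarith)
      then have "(1 + t\<^sup>2 - e\<^sup>2)\<^sup>2 \<le> 4" by simp
      then have "(1 + t\<^sup>2 - e\<^sup>2)\<^sup>2 - 4 * t\<^sup>2 \<le> 9" using zero_le_power2[of t] by linarith
      then have "Y\<^sup>2 \<le> 3\<^sup>2" unfolding Y(2) by simp
      then show ?thesis by (rule power2_le_imp_le) simp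
    qed
    have wmono: "w y \<le> w z" if "0 \<le> y" "y \<le> z" for y z
      unfolding w_def using that by (intro real_sqrt_le_mono add_left_mono power_mono)
    let ?G = "\<lambda>y. -1 * sqrt (1 + t\<^sup>2 + -1 * sqrt (4 * t\<^sup>2 + y\<^sup>2))"
    let ?F = "\<lambda>x. (-1 * x) ^ 3 * g (-1 * x) * Pq (-1 * x) t powr \<mu>"
    have "1 + t\<^sup>2 - 2 * t = (1 - t)\<^sup>2" by algebra
    then have G0: "?G 0 = - (1 - t)" using w0 t by (simp add: w_def)
    have GY: "?G Y = - e" using wY e(1) by (simp add: w_def)
    have eF: "indicator {?G 0..?G Y} x *\<^sub>R ?F x = (\<lambda>u. indicator {0..1-t} u * f u) (0 + (-1) * x)"
      if "x \<noteq> - e" for x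
    proof (cases "- x < e")
      case True
      then have "f (- x) = 0" using \<epsilon>(2)[of "- x"] e by (auto simp: f_def)
      then show ?thesis using True unfolding G0 GY by auto
    next
      case False
      then show ?thesis unfolding G0 GY using that e by (auto simp: f_def indicator_def)
    qed
    have eF': "indicator {?G 0..?G Y} x *\<^sub>R ?F x = (\<lambda>u. indicator {0..1-t} u * f u) (0 + (-1) * x)" for x
    proof (cases "x = - e")
      case True
      then show ?thesis unfolding G0 GY using e by (simp add: f_def)
    qed (rule eF)
    have int: "set_integrable lborel {?G 0..?G Y} ?F"
      unfolding set_integrable_def eF' by (rule lborel_integrable_real_affine[OF ilo]) simp
    have val: "(LBINT x:{?G 0..?G Y}. ?F x) = (\<integral>u. indicator {0..1-t} u * f u \<partial>lborel)"
      unfolding set_lebesgue_integral_def eF'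
      using lborel_integral_real_affine[of "-1" "\<lambda>u. indicator {0..1-t} u * f u" 0] by simp
    have pos: "1 + t\<^sup>2 + -1 * sqrt (4 * t\<^sup>2 + y\<^sup>2) > 0" if "0 \<le> y" "y \<le> Y" for y
      using wmono[OF that] wY e(1) zero_less_power[OF e(1), of 2] unfolding w_def[symmetric] by linarith
    note H = half_moment_substitution[OF \<mu> t(1), of "-1" Y g, OF _ Y(1) pos int]
    \<comment> \<open>Beyond \<open>Y\<close> the argument of \<eta> is below \<epsilon>^2, so both
      parts can share the limits 0 and 3.\<close>
    have ext: "indicator {0..Y} y * (y ^ m * (\<eta> (1 + t\<^sup>2 - w y) / w y)) = indicator {0..3} y * (y ^ m * (\<eta> (1 + t\<^sup>2 - w y) / w y))"
      if "y \<noteq> Y" for y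
    proof (cases "0 \<le> y \<and> Y < y")
      case True
      have "w Y < w y" unfolding w_def using True Y(1) by (intro real_sqrt_less_mono add_strict_left_mono power_strict_mono) auto
      then have *: "1 + t\<^sup>2 - w y < e\<^sup>2" using wY by simp
      have "\<eta> (1 + t\<^sup>2 - w y) = 0"
      proof (rule \<eta>0)
        have "e\<^sup>2 \<le> \<epsilon>\<^sup>2" using e by (intro power_mono) auto
        then show "1 + t\<^sup>2 - w y \<le> 0 \<or> 1 + t\<^sup>2 - w y < \<epsilon>\<^sup>2 \<or> 4 \<le> 1 + t\<^sup>2 - w y" using * by linarith
      qed
      then show ?thesis by simp
    next
      case False
      then show ?thesis using that \<open>Y \<le> 3\<close> by (auto simp: indicator_def)
    qed
    have ext': "indicator {0..Y} y * (y ^ m * (\<eta> (1 + t\<^sup>2 - w y) / w y)) = indicator {0..3} y * (y ^ m * (\<eta> (1 + t\<^sup>2 - w y) / w y))" for y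
    proof (cases "y = Y")
      case True
      then show ?thesis using \<open>Y \<le> 3\<close> Y(1) by simp
    qed (rule ext)
    have "has_bochner_integral lborel (\<lambda>y. indicator {0..Y} y * (y ^ m * (\<eta> (1 + t\<^sup>2 - w y) / w y))) (\<integral>u. indicator {0..1-t} u * f u \<partial>lborel)"
      using H val by (simp add: \<eta>_def w_def has_bochner_integral_iff set_integrable_def set_lebesgue_integral_def)
    then show ?thesis unfolding ext' .
  qed
  \<comment> \<open>The difference quotient of \<eta> over a segment of length 2 w is written as an
    integral of \<eta>', which removes the division by w.\<close>
  have zint: "(\<eta> (1 + t\<^sup>2 + w y) / w y) - (\<eta> (1 + t\<^sup>2 - w y) / w y) = Zint 0 \<eta>1 (t\<^sup>2) y" for y
  proof -
    have "((\<lambda>x. \<eta>1 (1 + t\<^sup>2 + x * w y)) has_integral (\<eta> (1 + t\<^sup>2 + 1 * w y) / w y - \<eta> (1 + t\<^sup>2 + (-1) * w y) / w y)) {-1..1}"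
    proof (rule fundamental_theorem_of_calculus)
      fix x :: real
      have "((\<lambda>x. \<eta> (1 + t\<^sup>2 + x * w y)) has_real_derivative \<eta>1 (1 + t\<^sup>2 + x * w y) * w y) (at x)"
        by (rule DERIV_chain2[OF \<eta>1]) (auto intro!: derivative_eq_intros)
      from DERIV_cdivide[OF this, of "w y"]
      have "((\<lambda>x. \<eta> (1 + t\<^sup>2 + x * w y) / w y) has_real_derivative \<eta>1 (1 + t\<^sup>2 + x * w y)) (at x)"
        using w(1)[of y] by simp
      then show "((\<lambda>x. \<eta> (1 + t\<^sup>2 + x * w y) / w y) has_vector_derivative \<eta>1 (1 + t\<^sup>2 + x * w y)) (at x within {-1..1})"
        by (auto simp: has_real_derivative_iff_has_vector_derivative intro: has_vector_derivative_at_within)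
    qed simp
    then show ?thesis by (simp add: Zint_def w_def integral_unique)
  qed
  have "has_bochner_integral lborel (\<lambda>y. indicator {0..3} y * (y ^ m * (\<eta> (1 + t\<^sup>2 + w y) / w y)) - indicator {0..3} y * (y ^ m * (\<eta> (1 + t\<^sup>2 - w y) / w y)))
      (mom \<mu> (\<lambda>u. u\<^sup>2 * g u) t)"
    unfolding momsplit by (rule has_bochner_integral_diff[OF up lo])
  moreover have "indicator {0..3} y * (y ^ m * (\<eta> (1 + t\<^sup>2 + w y) / w y)) - indicator {0..3} y * (y ^ m * (\<eta> (1 + t\<^sup>2 - w y) / w y)) =
     indicator {0..3} y *\<^sub>R (y ^ m * Zint 0 \<eta>1 (t\<^sup>2) y)" for y
    unfolding zint[symmetric] by (simp add: algebra_simps)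
  ultimately have "set_integrable lborel {0..3} (\<lambda>y. y ^ m * Zint 0 \<eta>1 (t\<^sup>2) y)"
      and "mom \<mu> (\<lambda>u. u\<^sup>2 * g u) t = (LBINT y:{0..3}. y ^ m * Zint 0 \<eta>1 (t\<^sup>2) y)"
    by (simp_all add: has_bochner_integral_iff set_integrable_def set_lebesgue_integral_def)
  then show ?thesis by (simp add: set_borel_integral_eq_integral(2) Yint_def)
qed

section \<open>The range characterization\<close>

lemma test_function_tame:
  assumes "test_function_on {0<..<2} g"
  shows "tame g"
proof -
  define C where "C = closure {x. g x \<noteq> 0}"
  have C: "compact C" "C \<subseteq> {0<..<2}" and sm: "smooth g"
    using assms by (auto simp: test_function_on_def C_def)
  have "C_k 0 g" using sm unfolding smooth_def by blast
  then have c: "continuous_on UNIV g" by simp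
  have inC: "x \<in> C" if "g x \<noteq> 0" for x using that closure_subset by (force simp: C_def)
  have "\<exists>\<epsilon>>0. \<forall>u. g u \<noteq> 0 \<longrightarrow> \<epsilon> \<le> u \<and> u \<le> 2 - \<epsilon>"
  proof (cases "C = {}")
    case True
    then show ?thesis using inC by (intro exI[of _ 1]) auto
  next
    case False
    obtain a where a: "a \<in> C" "\<And>x. x \<in> C \<Longrightarrow> a \<le> x" using compact_attains_inf[OF C(1) False] by blast
    obtain b where b: "b \<in> C" "\<And>x. x \<in> C \<Longrightarrow> x \<le> b" using compact_attains_sup[OF C(1) False] by blast
    have "0 < a" "b < 2" using a(1) b(1) C(2) by auto
    then show ?thesis using a(2) b(2) inC by (intro exI[of _ "min a (2 - b)"]) fastforce
  qed
  then show ?thesis using c by (simp add: tame_def)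
qed

text \<open>The square root is not smooth at 0, but g vanishes near 0.\<close>

lemma test_function_eta_smooth:
  assumes "test_function_on {0<..<2} g"
  shows "smooth_on UNIV (\<lambda>v. 1 / 2 * v * g (sqrt v))"
proof -
  obtain \<epsilon> where \<epsilon>: "\<epsilon> > 0" "\<And>u. g u \<noteq> 0 \<Longrightarrow> \<epsilon> \<le> u \<and> u \<le> 2 - \<epsilon>"
    using test_function_tame[OF assms] unfolding tame_def by blast
  have "Cder UNIV k (\<lambda>v. 1 / 2 * v * g (sqrt v))" for k
  proof (rule Cder_extend_zero_left)
    have "C_k k g" using assms by (simp add: test_function_on_def smooth_def)
    then have "Cder {0<..} k g" using Cder_subset[OF C_k_imp_Cder] by blast
    then show "Cder {0<..} k (\<lambda>v. 1 / 2 * v * g (sqrt v))"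
      by (intro Cder_mult Cder_const Cder_ident Cder_comp_sqrt)
    show "1 / 2 * v * g (sqrt v) = 0" if "v < \<epsilon>\<^sup>2" for v
    proof -
      have "sqrt v < \<epsilon>" using real_sqrt_less_mono[OF that] \<epsilon>(1) by simp
      then show ?thesis using \<epsilon>(2)[of "sqrt v"] by fastforce
    qed
  qed (use \<epsilon> in simp)
  then show ?thesis by (simp add: smooth_on_def)
qed

text \<open>\<open>Cder\<close> provides a derivative for each order k separately. They agree on the
  open half-line by uniqueness and at 0 by continuity, so a single function serves all
  orders.\<close>

lemma half_line_derivative:
  assumes "\<forall>k. Cder {0..} k f"
  obtains f' where "\<And>x. x > 0 \<Longrightarrow> (f has_real_derivative f' x) (at x)" "\<forall>k. Cder {0..} k f'"
proof -
  have ex: "\<exists>f'. (\<forall>x\<in>interior {0..}. (f has_real_derivative f' x) (at x)) \<and> Cder {0..} k f'" for k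
  proof -
    have "Cder {0..} (Suc k) f" using assms by blast
    then show ?thesis by (rule Cder_SucE) blast
  qed
  obtain d where d: "\<forall>x\<in>interior {0..}. (f has_real_derivative d x) (at x)" "Cder {0..} 0 d"
    using ex[of 0] by blast
  have "Cder {0..} k d" for k
  proof -
    obtain e where e: "\<forall>x\<in>interior {0..}. (f has_real_derivative e x) (at x)" "Cder {0..} k e"
      using ex[of k] by blast
    have eq: "e x - d x = 0" if "x \<in> {0<..}" for x
      using DERIV_unique[of f "e x" x "d x"] e(1) d(1) that by simp
    have "closure {0<..} = {0::real..}" by simp
    moreover have "continuous_on {0..} (\<lambda>x. e x - d x)"
      using Cder_continuous[OF e(2)] Cder_continuous[OF d(2)] by (rule continuous_on_diff)
    ultimately have "e x - d x = 0" if "x \<in> {0..}" for x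
      using continuous_constant_on_closure[of "{0<..}" "\<lambda>x. e x - d x" 0 x] eq that by simp
    then show ?thesis by (intro Cder_cong[OF e(2)]) simp
  qed
  then show ?thesis using d(1) by (intro that[of d]) auto
qed

section \<open>Inversion of the Abel type integral\<close>

text \<open>Taylor's formula with integral remainder, taken at the point 1 where everything
  vanishes: p is (-1)^(m + 1) / m! times the derivative of X of order m + 1. Integration by parts
  passes from m to m + 1.\<close>

lemma Taylor_density:
  assumes "\<forall>k. Cder {0..} k X" and a: "0 < a" "a < 1" and z: "\<And>T. a < T \<Longrightarrow> X T = 0"
  shows "\<exists>p. (\<forall>k. Cder {0..} k p) \<and> (\<forall>R>a. p R = 0) \<and>
     (\<forall>T. 0 < T \<and> T < 1 \<longrightarrow> ((\<lambda>R. (R - T) ^ m * p R) has_integral X T) {T..1})"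
proof -
  have dz: "f' R = 0" if "(f has_real_derivative f' R) (at R)" "\<And>T. a < T \<Longrightarrow> f T = 0" "a < R"
    for f f' :: "real \<Rightarrow> real" and R
  proof -
    have "(f has_real_derivative 0) (at R)"
      by (rule has_field_derivative_transform_within_open[OF DERIV_const[of 0], of "{a<..}"])
        (use that in auto)
    then show ?thesis using DERIV_unique that(1) by blast
  qed
  show ?thesis
  proof (induction m)
    case 0
    obtain d where d: "\<And>x. x > 0 \<Longrightarrow> (X has_real_derivative d x) (at x)" "\<forall>k. Cder {0..} k d"
      using half_line_derivative[OF assms(1)] by blast
    have "((\<lambda>R. (R - T) ^ 0 * (- 1 * d R)) has_integral X T) {T..1}" if "0 < T" "T < 1" for T
    proof -
      have "((\<lambda>R. - d R) has_integral (- X 1 - - X T)) {T..1}"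
      proof (rule fundamental_theorem_of_calculus)
        fix x assume "x \<in> {T..1}"
        then show "((\<lambda>R. - X R) has_vector_derivative - d x) (at x within {T..1})"
          using that DERIV_minus[OF d(1)[of x]]
          by (auto simp: has_real_derivative_iff_has_vector_derivative intro: has_vector_derivative_at_within)
      qed (use that in simp)
      then show ?thesis using z[of 1] a by simp
    qed
    moreover have "\<forall>k. Cder {0..} k (\<lambda>R. - 1 * d R)"
      using Cder_mult[OF Cder_const] d(2) by blast
    moreover have "\<forall>R>a. - 1 * d R = 0"
    proof (intro allI impI)
      fix R assume R: "a < R"
      then have "d R = 0" using a by (intro dz[of X d R] d(1) z) auto
      then show "- 1 * d R = 0" by simp
    qed
    ultimately show ?case by blast
  next
    case (Suc m)
    then obtain p where p: "\<forall>k. Cder {0..} k p" "\<And>R. a < R \<Longrightarrow> p R = 0"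
      "\<And>T. 0 < T \<Longrightarrow> T < 1 \<Longrightarrow> ((\<lambda>R. (R - T) ^ m * p R) has_integral X T) {T..1}" by blast
    obtain d where d: "\<And>x. x > 0 \<Longrightarrow> (p has_real_derivative d x) (at x)" "\<forall>k. Cder {0..} k d"
      using half_line_derivative[OF p(1)] by blast
    let ?q = "\<lambda>R. - 1 / real (Suc m) * d R"
    have "((\<lambda>R. (R - T) ^ Suc m * ?q R) has_integral X T) {T..1}" if T: "0 < T" "T < 1" for T
    proof -
      have "((\<lambda>R. (R - T) ^ m * p R + (R - T) ^ Suc m * (1 / real (Suc m) * d R)) has_integral
         ((1 - T) ^ Suc m * (1 / real (Suc m) * p 1) - (T - T) ^ Suc m * (1 / real (Suc m) * p T))) {T..1}"
      proof (rule fundamental_theorem_of_calculus)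
        fix x assume x: "x \<in> {T..1}"
        have e: "((\<lambda>R. (R - T) ^ Suc m) has_real_derivative real (Suc m) * (x - T) ^ m) (at x)"
          by (rule DERIV_cong[OF DERIV_power_Suc[where D = 1]]) (auto intro!: derivative_eq_intros)
        have f: "((\<lambda>R. 1 / real (Suc m) * p R) has_real_derivative 1 / real (Suc m) * d x) (at x)"
          using x T by (intro DERIV_cmult d(1)) auto
        have "((\<lambda>R. (R - T) ^ Suc m * (1 / real (Suc m) * p R)) has_real_derivative
          (x - T) ^ m * p x + (x - T) ^ Suc m * (1 / real (Suc m) * d x)) (at x)"
          by (rule DERIV_cong[OF DERIV_mult[OF e f]]) (simp add: mult_ac del: of_nat_Suc)
        then show "((\<lambda>R. (R - T) ^ Suc m * (1 / real (Suc m) * p R)) has_vector_derivative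
          (x - T) ^ m * p x + (x - T) ^ Suc m * (1 / real (Suc m) * d x)) (at x within {T..1})"
          by (auto simp: has_real_derivative_iff_has_vector_derivative intro: has_vector_derivative_at_within)
      qed (use T in simp)
      then have "((\<lambda>R. (R - T) ^ m * p R + (R - T) ^ Suc m * (1 / real (Suc m) * d R)) has_integral 0) {T..1}"
        using p(2)[of 1] a by simp
      from has_integral_diff[OF p(3)[OF T] this] show ?thesis by simp
    qed
    moreover have "\<forall>k. Cder {0..} k ?q"
      using Cder_mult[OF Cder_const] d(2) by blast
    moreover have "\<forall>R>a. ?q R = 0"
    proof (intro allI impI)
      fix R assume R: "a < R"
      then have "d R = 0" using a by (intro dz[of p d R] d(1) p(2)) auto
      then show "?q R = 0" by simp
    qed
    ultimately show ?case by blast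
  qed
qed

lemma mean_continuous:
  assumes \<mu>: "\<mu> > -1" and \<phi>: "continuous_on UNIV \<phi>" and B: "\<And>R. \<bar>\<phi> R\<bar> \<le> B"
  shows "continuous_on UNIV (\<lambda>u::real. LBINT z:{-1..1}. \<phi> (1 + u\<^sup>2 + 2 * u * z) * (1 - z\<^sup>2) powr \<mu>)"
  unfolding continuous_on_sequentially
proof (intro allI ballI impI, elim conjE)
  fix x :: "nat \<Rightarrow> real" and a assume x: "x \<longlonglongrightarrow> a"
  have [measurable]: "\<phi> \<in> borel_measurable borel" using \<phi> by (rule borel_measurable_continuous_onI)
  have i: "integrable lborel (\<lambda>z. B * (indicator {-1..1} z *\<^sub>R (1 - z\<^sup>2) powr \<mu>))"
    using set_integrable_one_minus_square_powr[OF \<mu>] by (intro integrable_mult_right) (simp add: set_integrable_def)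
  have "(\<lambda>n. \<integral>z. indicator {-1..1} z *\<^sub>R (\<phi> (1 + (x n)\<^sup>2 + 2 * x n * z) * (1 - z\<^sup>2) powr \<mu>) \<partial>lborel) \<longlonglongrightarrow>
     (\<integral>z. indicator {-1..1} z *\<^sub>R (\<phi> (1 + a\<^sup>2 + 2 * a * z) * (1 - z\<^sup>2) powr \<mu>) \<partial>lborel)"
  proof (rule integral_dominated_convergence[OF _ _ i])
    show "AE z in lborel. (\<lambda>n. indicator {-1..1} z *\<^sub>R (\<phi> (1 + (x n)\<^sup>2 + 2 * x n * z) * (1 - z\<^sup>2) powr \<mu>)) \<longlonglongrightarrow>
        indicator {-1..1} z *\<^sub>R (\<phi> (1 + a\<^sup>2 + 2 * a * z) * (1 - z\<^sup>2) powr \<mu>)"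
    proof (rule AE_I2)
      fix z
      have "(\<lambda>n. 1 + (x n)\<^sup>2 + 2 * x n * z) \<longlonglongrightarrow> 1 + a\<^sup>2 + 2 * a * z"
        by (intro tendsto_intros x)
      then have "(\<lambda>n. \<phi> (1 + (x n)\<^sup>2 + 2 * x n * z)) \<longlonglongrightarrow> \<phi> (1 + a\<^sup>2 + 2 * a * z)"
        by (rule continuous_on_tendsto_compose[OF \<phi>]) auto
      then show "(\<lambda>n. indicator {-1..1} z *\<^sub>R (\<phi> (1 + (x n)\<^sup>2 + 2 * x n * z) * (1 - z\<^sup>2) powr \<mu>)) \<longlonglongrightarrow>
        indicator {-1..1} z *\<^sub>R (\<phi> (1 + a\<^sup>2 + 2 * a * z) * (1 - z\<^sup>2) powr \<mu>)"
        by (intro tendsto_scaleR tendsto_mult tendsto_const)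
    qed
    show "AE z in lborel. norm (indicator {-1..1} z *\<^sub>R (\<phi> (1 + (x n)\<^sup>2 + 2 * x n * z) * (1 - z\<^sup>2) powr \<mu>)) \<le>
        B * (indicator {-1..1} z *\<^sub>R (1 - z\<^sup>2) powr \<mu>)" for n
      using B by (intro AE_I2) (auto simp: abs_mult indicator_def intro!: mult_right_mono)
  qed measurable
  then show "((\<lambda>u. LBINT z:{-1..1}. \<phi> (1 + u\<^sup>2 + 2 * u * z) * (1 - z\<^sup>2) powr \<mu>) \<circ> x) \<longlonglongrightarrow>
     (LBINT z:{-1..1}. \<phi> (1 + a\<^sup>2 + 2 * a * z) * (1 - z\<^sup>2) powr \<mu>)"
    by (simp only: o_def set_lebesgue_integral_def)
qed

lemma mean_tame:
  assumes \<mu>: "\<mu> > -1" and \<phi>: "continuous_on UNIV \<phi>" and B: "\<And>R. \<bar>\<phi> R\<bar> \<le> B"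
    and a: "0 < a" "a < 1" and z: "\<And>R. a < R \<Longrightarrow> \<phi> R = 0"
  shows "tame (\<lambda>u. if 0 < u then c * (LBINT z:{-1..1}. \<phi> (1 + u\<^sup>2 + 2 * u * z) * (1 - z\<^sup>2) powr \<mu>) else 0)"
proof -
  let ?M = "\<lambda>u. LBINT z:{-1..1}. \<phi> (1 + u\<^sup>2 + 2 * u * z) * (1 - z\<^sup>2) powr \<mu>"
  let ?g = "\<lambda>u. if 0 < u then c * ?M u else 0"
  \<comment> \<open>A sphere of radius u about a unit vector meets the ball of radius sqrt a only if
    |1 - u| is at most sqrt a.\<close>
  define \<epsilon> where "\<epsilon> = 1 - sqrt a"
  have \<epsilon>: "\<epsilon> > 0" using a by (simp add: \<epsilon>_def)
  have M0: "?M u = 0" if u: "0 \<le> u" "sqrt a < \<bar>1 - u\<bar>" for u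
  proof -
    have "\<phi> (1 + u\<^sup>2 + 2 * u * z) = 0" if "z \<in> {-1..1}" for z
    proof (rule z)
      have "a < (1 - u)\<^sup>2"
        using power_strict_mono[OF u(2), of 2] a by simp
      also have "\<dots> = 1 + u\<^sup>2 + 2 * u * (-1)" by algebra
      also have "\<dots> \<le> 1 + u\<^sup>2 + 2 * u * z" using that u(1) by (intro add_left_mono mult_left_mono) auto
      finally show "a < 1 + u\<^sup>2 + 2 * u * z" .
    qed
    then have "(\<lambda>z. indicator {-1..1} z *\<^sub>R (\<phi> (1 + u\<^sup>2 + 2 * u * z) * (1 - z\<^sup>2) powr \<mu>)) = (\<lambda>_. 0)"
      by (auto simp: indicator_def fun_eq_iff)
    then show ?thesis by (simp add: set_lebesgue_integral_def)
  qed
  have "continuous_on {0<..} ?g"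
    by (subst continuous_on_cong[of _ "{0<..}" _ "\<lambda>u. c * ?M u"])
      (auto intro!: continuous_intros continuous_on_subset[OF mean_continuous[OF \<mu> \<phi> B]])
  moreover have "continuous_on {..<\<epsilon>} ?g"
    by (subst continuous_on_cong[of _ "{..<\<epsilon>}" _ "\<lambda>_. 0"]) (auto simp: \<epsilon>_def intro!: M0)
  ultimately have "continuous_on ({0<..} \<union> {..<\<epsilon>}) ?g" by (intro continuous_on_open_Un) auto
  moreover have "{0<..} \<union> {..<\<epsilon>} = UNIV" using \<epsilon> by auto
  ultimately have "continuous_on UNIV ?g" by simp
  moreover have "\<epsilon> \<le> u \<and> u \<le> 2 - \<epsilon>" if "?g u \<noteq> 0" for u
  proof -
    have "0 < u" "?M u \<noteq> 0" using that by (auto split: if_splits)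
    then have "\<not> sqrt a < \<bar>1 - u\<bar>" using M0[of u] by auto
    then show ?thesis by (auto simp: \<epsilon>_def)
  qed
  ultimately show ?thesis using \<epsilon> unfolding tame_def by blast
qed

section \<open>The integral identity and the two directions\<close>

text \<open>The factor u^(n - 2) in h cancels \<open>u powr (2 * \<alpha>)\<close>, and \<alpha> -
  1/2 = \<mu>. What remains on the two sides are, up to sign, the parts u < 1 and u > 1 of the
  moment.\<close>

lemma integral_identity_iff_mom:
  fixes n :: nat
  assumes n: "n \<ge> 2" and g: "tame g" and \<alpha>: "\<alpha> = (real n - 2) / 2" and h: "h = (\<lambda>t. t ^ (n - 2) * g t)"
  shows "integral_identity \<alpha> h \<longleftrightarrow> (\<forall>t. 0 < t \<and> t < 1 \<longrightarrow> mom ((real n - 3) / 2) g t = 0)"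
proof -
  define \<mu> where "\<mu> = (real n - 3) / 2"
  have \<mu>: "\<mu> > -1" "\<alpha> - 1 / 2 = \<mu>" using n \<alpha> by (auto simp: \<mu>_def field_simps)
  have ii: "identity_integrand \<alpha> h t u = u * g u * Pq u t powr \<mu>" if "u \<ge> 0" for t u
  proof (cases "u = 0")
    case False
    then have u: "u > 0" using that by simp
    have "2 * \<alpha> = real (n - 2)" using n \<alpha> by (simp add: of_nat_diff)
    then have "u powr (2 * \<alpha>) = u ^ (n - 2)" using powr_realpow[OF u, of "n - 2"] by simp
    then show ?thesis using u \<mu>(2) by (simp add: identity_integrand_def h Pq_def)
  qed (simp add: identity_integrand_def)
  have "integral {0..1 - t} (identity_integrand \<alpha> h t) = integral {1 + t..2} (identity_integrand \<alpha> h t) \<longleftrightarrow>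
     mom \<mu> g t = 0" if t: "0 < t" "t < 1" for t
  proof -
    let ?k = "\<lambda>u. u * g u * pker \<mu> t u"
    have int: "integrable lborel ?k" by (rule mom_integrable[OF \<mu>(1) t g])
    have 1: "indicator {0..1-t} u *\<^sub>R identity_integrand \<alpha> h t u = - (indicator {..<1} u *\<^sub>R ?k u)" for u
    proof -
      consider "1 - t < u" | "u = 1 - t" | "0 < u" "u < 1 - t" | "u = 0" | "u < 0" by linarith
      then show ?thesis
      proof cases
        case 2
        then show ?thesis using t by (simp add: ii Pq_def pker_def)
      next
        case 3
        then show ?thesis using t by (simp add: ii pker_def)
      qed (use t in \<open>auto simp: ii pker_def indicator_def\<close>)
    qed
    have 2: "indicator {1+t..2} u *\<^sub>R identity_integrand \<alpha> h t u = indicator {1..} u *\<^sub>R ?k u" for u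
    proof -
      consider "u < 1 + t" | "u = 1 + t" | "1 + t < u" "u < 2" | "u = 2" | "2 < u" by linarith
      then show ?thesis
      proof cases
        case 2
        then show ?thesis using t by (simp add: ii Pq_def pker_def)
      next
        case 3
        then show ?thesis using t by (simp add: ii pker_def)
      next
        case 4
        have "g 2 = 0" using g unfolding tame_def by fastforce
        then show ?thesis using 4 t by (simp add: ii pker_def)
      qed (use t in \<open>auto simp: ii pker_def indicator_def\<close>)
    qed
    have i1: "integrable lborel (\<lambda>u. indicator {..<1} u *\<^sub>R ?k u)" and i2: "integrable lborel (\<lambda>u. indicator {1..} u *\<^sub>R ?k u)"
      using integrable_mult_indicator[OF _ int] by simp_all
    have s1: "set_integrable lborel {0..1-t} (identity_integrand \<alpha> h t)"
      unfolding set_integrable_def 1 using i1 by (rule integrable_minus)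
    have s2: "set_integrable lborel {1+t..2} (identity_integrand \<alpha> h t)"
      unfolding set_integrable_def 2 by (rule i2)
    have v1: "integral {0..1 - t} (identity_integrand \<alpha> h t) = - (\<integral>u. indicator {..<1} u *\<^sub>R ?k u \<partial>lborel)"
      unfolding set_borel_integral_eq_integral(2)[OF s1, symmetric] set_lebesgue_integral_def 1 by simp
    have v2: "integral {1 + t..2} (identity_integrand \<alpha> h t) = (\<integral>u. indicator {1..} u *\<^sub>R ?k u \<partial>lborel)"
      unfolding set_borel_integral_eq_integral(2)[OF s2, symmetric] set_lebesgue_integral_def 2 ..
    have "mom \<mu> g t = (\<integral>u. indicator {..<1} u *\<^sub>R ?k u + indicator {1..} u *\<^sub>R ?k u \<partial>lborel)"
      unfolding mom_def by (intro Bochner_Integration.integral_cong) (auto simp: indicator_def)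
    also have "\<dots> = (\<integral>u. indicator {..<1} u *\<^sub>R ?k u \<partial>lborel) + (\<integral>u. indicator {1..} u *\<^sub>R ?k u \<partial>lborel)"
      by (rule Bochner_Integration.integral_add[OF i1 i2])
    finally show ?thesis unfolding v1 v2 by linarith
  qed
  then show ?thesis unfolding integral_identity_def \<mu>_def by blast
qed

lemma radial_profile_moment:
  fixes m :: nat
  assumes p: "continuous_on {0..} p" and t: "0 < t" "t < 1"
    and hi: "((\<lambda>R. (R - t\<^sup>2) ^ m * p R) has_integral X) {t\<^sup>2..1}"
  shows "(LBINT r:{t<..<1}. r * (2 * p (r\<^sup>2)) * (r\<^sup>2 - t\<^sup>2) powr (real m)) = X"
proof -
  let ?f = "\<lambda>R. (R - t\<^sup>2) ^ m * p R"
  have t2: "0 < t\<^sup>2" "t\<^sup>2 < 1" using t by (auto simp: power_less_one_iff)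
  have "((\<lambda>r. (2 * r) *\<^sub>R ?f (r\<^sup>2)) has_integral integral {t\<^sup>2..1\<^sup>2} ?f) {t..1}"
  proof (rule has_integral_substitution[where c = "t\<^sup>2" and d = 1])
    show "(\<lambda>r. r\<^sup>2) ` {t..1} \<subseteq> {t\<^sup>2..1}" using t by (auto intro: power_mono simp: power_le_one_iff)
    show "continuous_on {t\<^sup>2..1} ?f"
      using t2 by (intro continuous_intros continuous_on_subset[OF p]) auto
    show "((\<lambda>r. r\<^sup>2) has_real_derivative 2 * x) (at x within {t..1})" for x
      by (auto intro!: derivative_eq_intros)
  qed (use t t2 in auto)
  then have h: "((\<lambda>r. 2 * r * ?f (r\<^sup>2)) has_integral X) {t..1}"
    using hi by (simp add: integral_unique)
  have c: "continuous_on {t..1} (\<lambda>r. 2 * r * ?f (r\<^sup>2))"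
    by (intro continuous_intros continuous_on_compose2[OF p]) auto
  have "set_integrable lborel {t..1} (\<lambda>r. 2 * r * ?f (r\<^sup>2))"
    using c by (rule borel_integrable_atLeastAtMost')
  then have s: "set_integrable lborel {t<..<1} (\<lambda>r. 2 * r * ?f (r\<^sup>2))"
    by (rule set_integrable_subset) auto
  have "(LBINT r:{t<..<1}. r * (2 * p (r\<^sup>2)) * (r\<^sup>2 - t\<^sup>2) powr (real m)) = (LBINT r:{t<..<1}. 2 * r * ?f (r\<^sup>2))"
  proof (rule set_lebesgue_integral_cong)
    show "\<forall>r. r \<in> {t<..<1} \<longrightarrow> r * (2 * p (r\<^sup>2)) * (r\<^sup>2 - t\<^sup>2) powr (real m) = 2 * r * ?f (r\<^sup>2)"
    proof (intro allI impI)
      fix r assume "r \<in> {t<..<1}"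
      then have "r\<^sup>2 - t\<^sup>2 > 0" using t by (auto intro: power_strict_mono)
      then show "r * (2 * p (r\<^sup>2)) * (r\<^sup>2 - t\<^sup>2) powr (real m) = 2 * r * ?f (r\<^sup>2)"
        by (simp add: powr_realpow)
    qed
  qed simp
  also have "\<dots> = integral {t<..<1} (\<lambda>r. 2 * r * ?f (r\<^sup>2))"
    by (rule set_borel_integral_eq_integral(2)[OF s])
  also have "\<dots> = integral {t..1} (\<lambda>r. 2 * r * ?f (r\<^sup>2))" by (rule integral_open_interval_real[symmetric])
  also have "\<dots> = X" using h by (rule integral_unique)
  finally show ?thesis .
qed

lemma range_imp_mom_zero:
  fixes f :: "real ^ 'n \<Rightarrow> real"
  assumes n: "CARD('n) \<ge> 2" and f: "test_function_on (ball 0 1) f" "radial f"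
    and g: "tame g" and mean: "\<And>p t. norm p = 1 \<Longrightarrow> 0 < t \<Longrightarrow> t < 2 \<Longrightarrow> spherical_mean f p t = g t"
    and t: "0 < t" "t < 1"
  shows "mom ((real CARD('n) - 3) / 2) g t = 0"
proof -
  define \<mu> where "\<mu> = (real CARD('n) - 3) / 2"
  have \<mu>: "\<mu> > -1" using n by (simp add: \<mu>_def)
  define e :: "real ^ 'n" where "e = axis (SOME k. True) 1"
  have e: "norm e = 1" by (simp add: e_def)
  define \<phi> where "\<phi> R = f (sqrt (max 0 R) *\<^sub>R e)" for R
  have fx: "f = (\<lambda>x. \<phi> ((norm x)\<^sup>2))"
  proof
    fix x :: "real ^ 'n"
    have "norm x = norm (sqrt (max 0 ((norm x)\<^sup>2)) *\<^sub>R e)" using e by (simp add: max_def)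
    then show "f x = \<phi> ((norm x)\<^sup>2)"
      unfolding \<phi>_def by (rule f(2)[unfolded radial_def, rule_format])
  qed
  have "C_k 0 f" using f(1) unfolding test_function_on_def smooth_def by blast
  then have cf: "continuous_on UNIV f" by simp
  have c: "continuous_on UNIV \<phi>" unfolding \<phi>_def[abs_def]
    by (intro continuous_on_compose2[OF cf] continuous_intros) auto
  have supp: "\<phi> R = 0" if "R \<ge> 1" for R
  proof (rule ccontr)
    assume "\<phi> R \<noteq> 0"
    then have "sqrt (max 0 R) *\<^sub>R e \<in> closure {x. f x \<noteq> 0}"
      unfolding \<phi>_def by (intro closure_subset[THEN subsetD]) simp
    then have "norm (sqrt (max 0 R) *\<^sub>R e) < 1"
      using f(1) unfolding test_function_on_def by (auto simp: subset_iff)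
    then show False using that e by (simp add: max_def)
  qed
  have "bounded (\<phi> ` {0..1})"
    by (intro compact_imp_bounded compact_continuous_image continuous_on_subset[OF c]) auto
  then obtain B where "\<forall>z\<in>\<phi> ` {0..1}. norm z \<le> B" unfolding bounded_iff by blast
  then have B1: "\<bar>\<phi> R\<bar> \<le> B" if "0 \<le> R" "R \<le> 1" for R using that by auto
  have B: "\<bar>\<phi> R\<bar> \<le> B" for R
  proof -
    have "\<phi> R = \<phi> 0" if "R < 0" using that by (simp add: \<phi>_def)
    moreover have "0 \<le> B" using B1[of 0] by linarith
    ultimately show ?thesis using B1[of R] B1[of 0] supp[of R] by (cases "R < 0"; cases "R \<le> 1") auto
  qed
  have m: "\<phi> \<in> borel_measurable borel" using c by (rule borel_measurable_continuous_onI)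
  have gu: "g u = 1 / gegenbauer_mass \<mu> * (LBINT z:{-1..1}. \<phi> (1 + u\<^sup>2 + 2 * u * z) * (1 - z\<^sup>2) powr \<mu>)"
    if "0 < u" "u < 2" for u
    using mean[OF e that] spherical_mean_radial[OF n e m, of u] unfolding fx[symmetric] \<mu>_def by simp
  have "mom \<mu> (\<lambda>u. u ^ (2 * 0) * g u) t = 0"
    using range_moments[OF \<mu> t, of 0 \<phi> B g "1 / gegenbauer_mass \<mu>", OF _ m B supp gu] by simp
  then show ?thesis by (simp add: \<mu>_def)
qed

text \<open>Smoothness of f is read off from its profile, whereas its mean \<open>G\<close> enters
  only as a continuous function; equality with g comes from the two moments.\<close>

lemma mom_zero_imp_range:
  fixes g :: "real \<Rightarrow> real"
  assumes n: "CARD('n::finite) \<ge> 2" and g: "test_function_on {0<..<2} g"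
    and z: "\<And>t. 0 < t \<Longrightarrow> t < 1 \<Longrightarrow> mom ((real CARD('n) - 3) / 2) g t = 0"
  shows "\<exists>f :: real ^ 'n \<Rightarrow> real. test_function_on (ball 0 1) f \<and> radial f \<and>
    (\<forall>p\<in>sphere 0 1. \<forall>t\<in>{0<..<2}. spherical_mean f p t = g t)"
proof -
  define \<mu> where "\<mu> = (real CARD('n) - 3) / 2"
  define m where "m = CARD('n) - 2"
  have \<mu>: "\<mu> > -1" "real m = 2 * \<mu> + 1" using n by (simp_all add: \<mu>_def m_def of_nat_diff field_simps)
  have tg: "tame g" using g by (rule test_function_tame)
  obtain \<epsilon> where \<epsilon>: "\<epsilon> > 0" "\<And>u. g u \<noteq> 0 \<Longrightarrow> \<epsilon> \<le> u \<and> u \<le> 2 - \<epsilon>"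
    using tg unfolding tame_def by blast
  \<comment> \<open>As g lives on |u - 1| at most 1 - \<epsilon>, its moments vanish for t > b, and
    b becomes the radius of a ball containing the support of f. The minimum keeps b
    positive.\<close>
  define b where "b = 1 - min \<epsilon> (1 / 2)"
  have b: "0 < b" "b < 1" "1 - \<epsilon> \<le> b" using \<epsilon>(1) by (auto simp: b_def)
  define a where "a = b\<^sup>2"
  have a: "0 < a" "a < 1" using b by (auto simp: a_def power_less_one_iff)
  define \<eta> where "\<eta> = (\<lambda>v. 1 / 2 * v * g (sqrt v))"
  have \<eta>: "smooth_on UNIV \<eta>" unfolding \<eta>_def using g by (rule test_function_eta_smooth)
  define X where "X = Yint m 0 (deriv \<eta>)"
  have Xm: "mom \<mu> (\<lambda>u. u\<^sup>2 * g u) t = X (t\<^sup>2)" if "0 < t" "t < 1" for t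
    unfolding X_def
  proof (rule second_moment_Yint[OF \<mu>(2) that tg])
    show "((\<lambda>v. 1 / 2 * v * g (sqrt v)) has_real_derivative deriv \<eta> v) (at v)" for v
      using smooth_on_deriv(1)[OF \<eta> open_UNIV UNIV_I] unfolding \<eta>_def .
    show "continuous_on UNIV (deriv \<eta>)" using smooth_on_deriv(2)[OF \<eta> open_UNIV] by (rule smooth_on_UNIV_continuous)
  qed
  have X0: "X T = 0" if T: "a < T" "T < 1" for T
  proof -
    have t: "0 < sqrt T" "sqrt T < 1" "b < sqrt T" "(sqrt T)\<^sup>2 = T"
    proof -
      have T0: "0 < T" using T(1) a(1) by linarith
      show "0 < sqrt T" "sqrt T < 1" "(sqrt T)\<^sup>2 = T" using T0 T(2) by auto
      show "b < sqrt T" using T(1) by (intro real_less_rsqrt) (simp add: a_def)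
    qed
    have kz: "u * (u\<^sup>2 * g u) * pker \<mu> (sqrt T) u = 0" for u
    proof (cases "g u = 0")
      case False
      then have "\<bar>u - 1\<bar> \<le> 1 - \<epsilon>" using \<epsilon>(2)[of u] by auto
      then have "\<not> sqrt T < \<bar>u - 1\<bar>" using t b by linarith
      then show ?thesis by (simp add: pker_def)
    qed simp
    have "mom \<mu> (\<lambda>u. u\<^sup>2 * g u) (sqrt T) = 0" unfolding mom_def kz by simp
    then show ?thesis using Xm[OF t(1,2)] t(4) by simp
  qed
  define X1 where "X1 T = (if T < 1 then X T else 0)" for T
  have "\<forall>k. Cder {0..} k X1"
  proof
    fix k
    have "Cder {0..} k X" unfolding X_def by (intro Cder_Yint smooth_on_deriv(2)[OF \<eta> open_UNIV])
    then show "Cder {0..} k X1" unfolding X1_def[abs_def] by (rule Cder_cut_right[OF _ a(2,1)]) (rule X0)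
  qed
  moreover have "X1 T = 0" if "a < T" for T using X0[of T] that by (simp add: X1_def)
  ultimately obtain p where p: "\<forall>k. Cder {0..} k p" "\<And>R. a < R \<Longrightarrow> p R = 0"
    "\<And>T. 0 < T \<Longrightarrow> T < 1 \<Longrightarrow> ((\<lambda>R. (R - T) ^ m * p R) has_integral X1 T) {T..1}"
    using Taylor_density[of X1 a m] a by blast
  have pc: "continuous_on {0..} p" using p(1) Cder_continuous by blast
  \<comment> \<open>The factor 2 compensates R = r^2, dR = 2 r dr; the maximum with 0 extends the
    profile continuously to the whole line.\<close>
  define \<phi> where "\<phi> R = 2 * p (max 0 R)" for R
  have \<phi>c: "continuous_on UNIV \<phi>" unfolding \<phi>_def[abs_def]
    by (intro continuous_on_mult continuous_on_const continuous_on_compose2[OF pc] continuous_intros) auto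
  have \<phi>0: "\<phi> R = 0" if "a < R" for R using p(2)[of R] that a by (simp add: \<phi>_def)
  have \<phi>m: "\<phi> \<in> borel_measurable borel" using \<phi>c by (rule borel_measurable_continuous_onI)
  have "bounded (\<phi> ` {0..1})"
    by (intro compact_imp_bounded compact_continuous_image continuous_on_subset[OF \<phi>c]) auto
  then obtain B where "\<forall>z\<in>\<phi> ` {0..1}. norm z \<le> B" unfolding bounded_iff by blast
  then have B1: "\<bar>\<phi> R\<bar> \<le> B" if "0 \<le> R" "R \<le> 1" for R using that by auto
  have B: "\<bar>\<phi> R\<bar> \<le> B" for R
  proof -
    have "\<phi> R = \<phi> 0" if "R < 0" using that by (simp add: \<phi>_def)
    moreover have "0 \<le> B" using B1[of 0] by linarith
    ultimately show ?thesis using B1[of R] B1[of 0] \<phi>0[of R] a by (cases "R < 0"; cases "R \<le> 1") auto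
  qed
  let ?M = "\<lambda>u. LBINT z:{-1..1}. \<phi> (1 + u\<^sup>2 + 2 * u * z) * (1 - z\<^sup>2) powr \<mu>"
  define G where "G u = (if 0 < u then 1 / gegenbauer_mass \<mu> * ?M u else 0)" for u
  have tG: "tame G" unfolding G_def[abs_def] by (rule mean_tame[OF \<mu>(1) \<phi>c B a \<phi>0])
  have GM: "G u = 1 / gegenbauer_mass \<mu> * ?M u" if "0 < u" "u < 2" for u using that by (simp add: G_def)
  have supp1: "\<phi> R = 0" if "R \<ge> 1" for R using \<phi>0[of R] that a by simp
  define \<delta> where "\<delta> u = g u - G u" for u
  have t\<delta>: "tame \<delta>" unfolding \<delta>_def[abs_def] using tg tG by (rule tame_diff)
  have sub: "mom \<mu> (\<lambda>u. c u * \<delta> u) t = mom \<mu> (\<lambda>u. c u * g u) t - mom \<mu> (\<lambda>u. c u * G u) t"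
    if "0 < t" "t < 1" "continuous_on UNIV c" for c t
  proof -
    have "integrable lborel (\<lambda>u. u * (c u * g u) * pker \<mu> t u)" "integrable lborel (\<lambda>u. u * (c u * G u) * pker \<mu> t u)"
      using that by (auto intro!: mom_integrable \<mu>(1) tame_mult tg tG)
    from Bochner_Integration.integral_diff[OF this]
    show ?thesis unfolding mom_def \<delta>_def by (simp add: algebra_simps)
  qed
  \<comment> \<open>The first moment vanishes by hypothesis for g and by
    \<open>range_moments\<close> for \<open>G\<close>; the second moments agree by the choice of
    p.\<close>
  have mz: "mom \<mu> \<delta> t = 0 \<and> mom \<mu> (\<lambda>u. u\<^sup>2 * \<delta> u) t = 0" if t: "0 < t" "t < 1" for t
  proof
    have "mom \<mu> G t = 0"
      using range_moments[OF \<mu>(1) t, of 0 \<phi> B G "1 / gegenbauer_mass \<mu>", OF _ \<phi>m B supp1 GM] by simp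
    then show "mom \<mu> \<delta> t = 0" using sub[OF t, of "\<lambda>_. 1"] z[OF t] by (simp add: \<mu>_def)
    have "mom \<mu> (\<lambda>u. u\<^sup>2 * G u) t = (LBINT r:{t<..<1}. r * \<phi> (r\<^sup>2) * (r\<^sup>2 - t\<^sup>2) powr (real m))"
      using range_moments[OF \<mu>(1) t, of 1 \<phi> B G "1 / gegenbauer_mass \<mu>", OF _ \<phi>m B supp1 GM]
        gegenbauer_mass_pos[OF \<mu>(1)] \<mu>(2) by simp
    also have "\<dots> = (LBINT r:{t<..<1}. r * (2 * p (r\<^sup>2)) * (r\<^sup>2 - t\<^sup>2) powr (real m))"
      by (simp add: \<phi>_def max_def)
    also have "\<dots> = X1 (t\<^sup>2)"
      using t by (intro radial_profile_moment[OF pc t] p(3)) (auto simp: power_less_one_iff)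
    also have "\<dots> = mom \<mu> (\<lambda>u. u\<^sup>2 * g u) t"
      using Xm[OF t] t by (simp add: X1_def power_less_one_iff)
    finally show "mom \<mu> (\<lambda>u. u\<^sup>2 * \<delta> u) t = 0"
      using sub[OF t, of "\<lambda>u. u\<^sup>2"] by (simp add: continuous_intros)
  qed
  have \<delta>1: "\<delta> u = 0" if "u \<noteq> 1" for u using mom_zero_imp_zero[OF \<mu>(1) t\<delta> mz that] .
  \<comment> \<open>The moments do not see the point 1; continuity settles it.\<close>
  have "\<delta> 1 = 0"
  proof -
    have "continuous_on (closure (UNIV - {1})) \<delta>"
      using t\<delta> unfolding tame_def by (auto intro: continuous_on_subset)
    moreover have "(1::real) \<in> closure (UNIV - {1})"
      using islimpt_UNIV[of "1::real"] by (simp only: islimpt_in_closure)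
    ultimately show ?thesis
      using continuous_constant_on_closure[of "UNIV - {1}" \<delta> 0 1] \<delta>1 by blast
  qed
  then have gG: "g u = G u" for u using \<delta>1[of u] by (cases "u = 1") (auto simp: \<delta>_def)
  define f :: "real ^ 'n \<Rightarrow> real" where "f = (\<lambda>x. \<phi> ((norm x)\<^sup>2))"
  have "smooth f"
    unfolding smooth_def
  proof
    fix k
    have "Cder {0..} k (\<lambda>R. 2 * p R)" using p(1) by (intro Cder_mult Cder_const) blast
    then have "Cder {0..} k \<phi>" by (rule Cder_cong) (simp add: \<phi>_def)
    then show "C_k k f" unfolding f_def by (rule C_k_radial)
  qed
  moreover have cl: "closure {x. f x \<noteq> 0} \<subseteq> cball 0 b"
  proof (rule closure_minimal)
    show "{x. f x \<noteq> 0} \<subseteq> cball 0 b"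
    proof
      fix x assume "x \<in> {x. f x \<noteq> 0}"
      then have "\<phi> ((norm x)\<^sup>2) \<noteq> 0" by (simp add: f_def)
      then have "\<not> a < (norm x)\<^sup>2" using \<phi>0[of "(norm x)\<^sup>2"] by blast
      then have "(norm x)\<^sup>2 \<le> b\<^sup>2" unfolding a_def by (rule leI)
      then have "norm x \<le> b" by (rule power2_le_imp_le) (use b(1) in simp)
      then show "x \<in> cball 0 b" by simp
    qed
  qed simp
  moreover have "compact (closure {x. f x \<noteq> 0})"
    using cl by (meson bounded_cball bounded_subset closed_closure compact_eq_bounded_closed)
  moreover have "cball (0 :: real ^ 'n) b \<subseteq> ball 0 1" using b by auto
  ultimately have "test_function_on (ball 0 1) f" unfolding test_function_on_def by blast
  moreover have "radial f" by (simp add: radial_def f_def)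
  moreover have "spherical_mean f q t = g t" if "q \<in> sphere 0 1" "t \<in> {0<..<2}" for q t
    using spherical_mean_radial[OF n _ \<phi>m, of q t] that gG[of t] GM[of t] by (simp add: f_def \<mu>_def)
  ultimately show ?thesis by blast
qed

section \<open>The operator of order k\<close>

text \<open>These are the coefficients of the reverse Bessel polynomial of degree k. The value 0
  beyond k allows sums up to k and up to k + 1 to be merged.\<close>

definition acoef :: "nat \<Rightarrow> nat \<Rightarrow> real" where
  "acoef k j = (if j \<le> k then fact (2 * k - j) / (fact j * fact (k - j) * 2 ^ (k - j)) else 0)"

text \<open>This is the differential equation x B'' - 2 (x + k) B' + 2 k B = 0 of the polynomial B
  with these coefficients, read off coefficientwise.\<close>

lemma acoef_ratio: "real (Suc j) * (2 * real k - real j) * acoef k (Suc j) = 2 * (real k - real j) * acoef k j"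
proof -
  consider d where "k = j + Suc d" | "k = j" | "k < j"
    by (metis add_Suc_right less_imp_Suc_add linorder_neqE_nat)
  then show ?thesis
  proof cases
    case 1
    have e: "2 * k - Suc j = Suc (j + 2 * d)" "2 * k - j = Suc (Suc (j + 2 * d))" "k - Suc j = d" "k - j = Suc d"
      "Suc j \<le> k" "j \<le> k" using 1 by auto
    have r: "2 * real k - real j = real j + 2 + 2 * real d" "real k - real j = real d + 1" using 1 by auto
    show ?thesis unfolding acoef_def e(1-4) r using e(5,6)
      by (simp add: divide_simps del: of_nat_Suc) (simp add: algebra_simps)
  qed (auto simp: acoef_def)
qed

text \<open>For the polynomials B_k with these coefficients this reads B_(k+1) = (x + 2 k + 1) B_k -
  x B_k'.\<close>

lemma acoef_Suc: "acoef (Suc k) j = (if j = 0 then 0 else acoef k (j - 1)) + (2 * real k + 1 - real j) * acoef k j"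
proof -
  consider "j = 0" | i d where "j = Suc i" "k = Suc i + d" | "j = Suc k" | "j > Suc k"
  proof -
    show thesis if "j = 0 \<Longrightarrow> thesis" "\<And>i d. j = Suc i \<Longrightarrow> k = Suc i + d \<Longrightarrow> thesis"
      "j = Suc k \<Longrightarrow> thesis" "Suc k < j \<Longrightarrow> thesis" for thesis
    proof (cases j)
      case (Suc i)
      show thesis
      proof (cases "Suc i \<le> k")
        case True
        then show thesis using that(2)[OF Suc, of "k - Suc i"] by simp
      next
        case False
        then show thesis using that(3,4) Suc by linarith
      qed
    qed (rule that(1))
  qed
  then show ?thesis
  proof cases
    case 1
    have "2 * Suc k = Suc (Suc (2 * k))" by simp
    then show ?thesis using 1 unfolding acoef_def by (simp add: divide_simps del: mult_Suc_right mult_Suc) (simp add: algebra_simps)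
  next
    case 2
    have e: "2 * Suc k - j = Suc (Suc (Suc (i + 2 * d)))" "2 * k - i = Suc (Suc (i + 2 * d))" "2 * k - j = Suc (i + 2 * d)"
      "Suc k - j = Suc d" "k - i = Suc d" "k - j = d" "j - 1 = i" "j \<noteq> 0" "j \<le> Suc k" "i \<le> k" "j \<le> k"
      using 2 by auto
    have r: "2 * real k + 1 - real j = real i + 2 * real d + 2" using 2 by auto
    define F where "F = (fact (i + 2 * d) :: real)"
    have A: "acoef (Suc k) j = (real i + 2 * real d + 3) * ((real i + 2 * real d + 2) * ((real i + 2 * real d + 1) * F)) /
       ((real i + 1) * fact i * ((real d + 1) * fact d) * (2 * 2 ^ d))"
      using e 2(1) by (simp add: acoef_def F_def algebra_simps)
    have B: "acoef k i = (real i + 2 * real d + 2) * ((real i + 2 * real d + 1) * F) /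
       (fact i * ((real d + 1) * fact d) * (2 * 2 ^ d))"
      using e by (simp add: acoef_def F_def algebra_simps)
    have C: "acoef k j = (real i + 2 * real d + 1) * F / ((real i + 1) * fact i * fact d * 2 ^ d)"
      using e 2(1) by (simp add: acoef_def F_def algebra_simps)
    have E: "(if j = 0 then 0 else acoef k (j - 1)) = acoef k i" using e(7,8) by simp
    show ?thesis unfolding E r A B C by (simp add: divide_simps) (simp add: algebra_simps)
  qed (auto simp: acoef_def)
qed

lemma sum_shift_up:
  fixes a y :: "nat \<Rightarrow> real"
  shows "(\<Sum>j\<le>k. a j * y (Suc j)) = (\<Sum>j\<le>Suc k. (if j = 0 then 0 else a (j - 1)) * y j)"
  by (subst sum.atMost_Suc_shift) simp

lemma sum_shift_down:
  fixes a y :: "nat \<Rightarrow> real"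
  assumes "a 0 = 0"
  shows "(\<Sum>j\<le>Suc k. a j * y (j - 1)) = (\<Sum>j\<le>k. a (Suc j) * y j)"
  using assms by (subst sum.atMost_Suc_shift) simp

text \<open>Here \<open>y j\<close> stands for \<open>x\<^sup>j (D\<^sup>j H)(1 - x)\<close>.\<close>

lemma recursion_identity:
  fixes x :: real and y :: "nat \<Rightarrow> real" and k :: nat
  defines "u \<equiv> 1 - x"
  defines "S \<equiv> (\<Sum>j\<le>k. acoef k j * y j)"
    and "S' \<equiv> (\<Sum>j\<le>k. acoef k j * (real j * y j - u * y (Suc j)))"
    and "Q \<equiv> \<lambda>j. u\<^sup>2 * y j + 2 * real j * x * y (j - 1)"
  shows "(1 - x\<^sup>2) * (S' - (2 * real k + 1) * S) - 4 * (real k + 1) * x\<^sup>2 * S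
     + ((\<Sum>j\<le>k. acoef k j * (real j * Q j - u * Q (Suc j))) - (2 * real k + 1) * (\<Sum>j\<le>k. acoef k j * Q j)) =
     - 2 * (\<Sum>j\<le>Suc k. acoef (Suc k) j * Q j)"
proof -
  let ?a = "acoef k" and ?b = "acoef (Suc k)"
  \<comment> \<open>All sums are rewritten as sums over j up to k + 1 of a coefficient times
    \<open>y j\<close>, after which the claim holds coefficient by coefficient.\<close>
  define a' where "a' j = (if j = 0 then 0 else ?a (j - 1))" for j
  have a0: "?a (Suc k) = 0" "?a (Suc (Suc k)) = 0" and b0: "?b (Suc (Suc k)) = 0" by (simp_all add: acoef_def)
  have ext: "(\<Sum>j\<le>k. ?a j * z j) = (\<Sum>j\<le>Suc k. ?a j * z j)" for z using a0 by simp
  have up: "(\<Sum>j\<le>k. ?a j * y (Suc j)) = (\<Sum>j\<le>Suc k. a' j * y j)"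
    unfolding a'_def by (rule sum_shift_up)
  have down: "(\<Sum>j\<le>Suc k. (c j * real j) * y (j - 1)) = (\<Sum>j\<le>Suc k. (c (Suc j) * real (Suc j)) * y j)"
    if "c (Suc (Suc k)) = 0" for c :: "nat \<Rightarrow> real"
    by (subst sum_shift_down[where a = "\<lambda>j. c j * real j"]) (use that in simp_all)
  have S: "S = (\<Sum>j\<le>Suc k. ?a j * y j)" unfolding S_def by (rule ext)
  have dist: "(\<Sum>j\<in>A. ?a j * (p j - u * q j)) = (\<Sum>j\<in>A. ?a j * p j) - u * (\<Sum>j\<in>A. ?a j * q j)" for p q A
    by (simp add: sum_subtractf sum_distrib_left algebra_simps)
  have S': "S' = (\<Sum>j\<le>Suc k. ?a j * (real j * y j)) - u * (\<Sum>j\<le>Suc k. a' j * y j)"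
    unfolding S'_def dist up ext ..
  have Qs: "(\<Sum>j\<le>Suc k. c j * Q j) = (\<Sum>j\<le>Suc k. (u\<^sup>2 * c j + 2 * x * (c (Suc j) * real (Suc j))) * y j)"
    if c: "c (Suc (Suc k)) = 0" for c :: "nat \<Rightarrow> real"
  proof -
    have "(\<Sum>j\<le>Suc k. c j * Q j) = (\<Sum>j\<le>Suc k. u\<^sup>2 * c j * y j) + 2 * x * (\<Sum>j\<le>Suc k. (c j * real j) * y (j - 1))"
      unfolding Q_def by (simp only: sum_distrib_left sum.distrib[symmetric]) (rule sum.cong; simp add: algebra_simps)
    also have "\<dots> = (\<Sum>j\<le>Suc k. (u\<^sup>2 * c j + 2 * x * (c (Suc j) * real (Suc j))) * y j)"
      unfolding down[of c, OF c] by (simp only: sum_distrib_left sum.distrib[symmetric]) (rule sum.cong; simp add: algebra_simps)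
    finally show ?thesis .
  qed
  have Q1: "(\<Sum>j\<le>k. ?a j * Q j) = (\<Sum>j\<le>Suc k. (u\<^sup>2 * ?a j + 2 * x * (?a (Suc j) * real (Suc j))) * y j)"
    unfolding ext by (rule Qs[of ?a, OF a0(2)])
  have Q2: "(\<Sum>j\<le>k. ?a j * (real j * Q j)) = (\<Sum>j\<le>Suc k. (u\<^sup>2 * (?a j * real j) + 2 * x * ((?a (Suc j) * real (Suc j)) * real (Suc j))) * y j)"
    using Qs[of "\<lambda>j. ?a j * real j"] a0(2) unfolding ext by (simp add: mult.assoc)
  have Q3: "(\<Sum>j\<le>k. ?a j * Q (Suc j)) = (\<Sum>j\<le>Suc k. (u\<^sup>2 * a' j + 2 * x * (?a j * real (Suc j))) * y j)"
  proof -
    have "(\<Sum>j\<le>k. ?a j * Q (Suc j)) = u\<^sup>2 * (\<Sum>j\<le>k. ?a j * y (Suc j)) + (\<Sum>j\<le>k. ?a j * (2 * x * real (Suc j) * y j))"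
      unfolding Q_def by (simp only: sum_distrib_left sum.distrib[symmetric]) (rule sum.cong; simp add: algebra_simps)
    also have "\<dots> = (\<Sum>j\<le>Suc k. (u\<^sup>2 * a' j + 2 * x * (?a j * real (Suc j))) * y j)"
      unfolding up ext by (simp only: sum_distrib_left sum.distrib[symmetric]) (rule sum.cong; simp add: algebra_simps)
    finally show ?thesis .
  qed
  have B: "(\<Sum>j\<le>Suc k. ?b j * Q j) = (\<Sum>j\<le>Suc k. (u\<^sup>2 * ?b j + 2 * x * (?b (Suc j) * real (Suc j))) * y j)"
    by (rule Qs[of ?b, OF b0])
  let ?L = "\<lambda>j. (1 - x\<^sup>2) * (?a j * real j - u * a' j - (2 * real k + 1) * ?a j) - 4 * (real k + 1) * x\<^sup>2 * ?a j
     + ((u\<^sup>2 * (?a j * real j) + 2 * x * ((?a (Suc j) * real (Suc j)) * real (Suc j))) - u * (u\<^sup>2 * a' j + 2 * x * (?a j * real (Suc j)))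
     - (2 * real k + 1) * (u\<^sup>2 * ?a j + 2 * x * (?a (Suc j) * real (Suc j))))"
  have "(1 - x\<^sup>2) * (S' - (2 * real k + 1) * S) - 4 * (real k + 1) * x\<^sup>2 * S
     + ((\<Sum>j\<le>k. ?a j * (real j * Q j - u * Q (Suc j))) - (2 * real k + 1) * (\<Sum>j\<le>k. ?a j * Q j)) =
     (\<Sum>j\<le>Suc k. ?L j * y j)"
    unfolding dist Q1 Q2 Q3 S S'
    by (simp only: sum_distrib_left sum.distrib[symmetric] sum_subtractf[symmetric]) (rule sum.cong; simp add: algebra_simps)
  also have "\<dots> = (\<Sum>j\<le>Suc k. - 2 * ((u\<^sup>2 * ?b j + 2 * x * (?b (Suc j) * real (Suc j))) * y j))"
  proof (intro sum.cong refl)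
    fix j
    have bj: "?b j = a' j + (2 * real k + 1 - real j) * ?a j" unfolding a'_def by (rule acoef_Suc)
    have bj1: "?b (Suc j) = ?a j + (2 * real k - real j) * ?a (Suc j)"
      using acoef_Suc[of k "Suc j"] by simp
    \<comment> \<open>With \<open>acoef (Suc k)\<close> expressed through \<open>acoef k\<close>,
      the relation between two neighbouring coefficients in \<open>acoef_ratio\<close> is what
      remains to be used.\<close>
    have L: "?L j = - 2 * (u\<^sup>2 * ?b j + 2 * x * (?b (Suc j) * real (Suc j)))"
      using acoef_ratio[of j k] unfolding bj bj1 u_def of_nat_Suc by algebra
    show "?L j * y j = - 2 * ((u\<^sup>2 * ?b j + 2 * x * (?b (Suc j) * real (Suc j))) * y j)"
      unfolding L by (rule mult.assoc)
  qed
  also have "\<dots> = - 2 * (\<Sum>j\<le>Suc k. ?b j * Q j)" unfolding B by (simp only: sum_distrib_left)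
  finally show ?thesis .
qed

lemma opL_altdef: "opL k h s = (\<Sum>j\<le>k. acoef k j * (1 - s) ^ j * (opD ^^ j) h s)"
proof -
  have "(\<Sum>j\<le>k. acoef k j * (1 - s) ^ j * (opD ^^ j) h s) =
     (\<Sum>l\<le>k. acoef k (k - l) * (1 - s) ^ (k - l) * (opD ^^ (k - l)) h s)"
    by (rule sum.reindex_bij_witness[of _ "\<lambda>l. k - l" "\<lambda>l. k - l"]) auto
  also have "\<dots> = opL k h s" unfolding opL_def atMost_atLeast0
  proof (intro sum.cong refl)
    fix l assume "l \<in> {0..k}"
    then have "2 * k - (k - l) = k + l" "k - (k - l) = l" "k - l \<le> k" by auto
    then show "acoef k (k - l) * (1 - s) ^ (k - l) * (opD ^^ (k - l)) h s =
      fact (k + l) / (fact (k - l) * fact l * 2 ^ l) * (1 - s) ^ (k - l) * (opD ^^ (k - l)) h s"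
      by (simp add: acoef_def)
  qed
  finally show ?thesis ..
qed

lemma Cder_affine: "Cder UNIV k f \<Longrightarrow> Cder UNIV k (\<lambda>x. f (a + b * x))"
proof (induction k arbitrary: f)
  case 0
  then show ?case by (auto intro!: continuous_on_compose2[of UNIV f] continuous_intros)
next
  case (Suc k)
  obtain d where d: "continuous_on UNIV f" "\<forall>x\<in>interior UNIV. (f has_real_derivative d x) (at x)" "Cder UNIV k d"
    using Suc.prems by (rule Cder_SucE)
  show ?case
  proof (rule Cder_SucI)
    show "continuous_on UNIV (\<lambda>x. f (a + b * x))"
      by (rule continuous_on_compose2[OF d(1)]) (auto intro!: continuous_intros)
    show "((\<lambda>x. f (a + b * x)) has_real_derivative d (a + b * x) * b) (at x)" for x
      by (rule DERIV_chain2) (use d(2) in \<open>auto intro!: derivative_eq_intros\<close>)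
    show "Cder UNIV k (\<lambda>x. d (a + b * x) * b)"
      by (rule Cder_mult[OF Suc.IH[OF d(3)] Cder_const])
  qed
qed

section \<open>Calculus of the operator D\<close>

lemma opD_cong:
  assumes "open S" "\<And>x. x \<in> S \<Longrightarrow> f x = g x" "x \<in> S"
  shows "opD f x = opD g x"
proof -
  have "deriv f x = deriv g x"
    using assms by (intro deriv_cong_ev eventually_nhds[THEN iffD2] exI[of _ S]) auto
  then show ?thesis by (simp add: opD_def)
qed

lemma opD_pow_cong:
  assumes "open S" "\<And>x. x \<in> S \<Longrightarrow> f x = g x" "x \<in> S"
  shows "(opD ^^ j) f x = (opD ^^ j) g x"
  using assms(3)
proof (induction j arbitrary: x)
  case (Suc j)
  then show ?case using opD_cong[OF assms(1), of "(opD ^^ j) f" "(opD ^^ j) g"] by simp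
qed (use assms in auto)

lemma opD_smooth:
  assumes "smooth_on S f" "open S" "S \<subseteq> {0<..}"
  shows "smooth_on S (opD f)" and "x \<in> S \<Longrightarrow> (f has_real_derivative x * opD f x) (at x)"
proof -
  have "smooth_on {0<..} (\<lambda>x. 1 / x)" unfolding smooth_on_def using Cder_inverse by blast
  then have "smooth_on S (\<lambda>x. 1 / x)" using assms(3) by (rule smooth_on_subset)
  from smooth_on_mult[OF this smooth_on_deriv(2)[OF assms(1,2)]]
  show "smooth_on S (opD f)" by (simp add: opD_def[abs_def])
  assume x: "x \<in> S"
  then have "x \<noteq> 0" using assms(3) by auto
  then show "(f has_real_derivative x * opD f x) (at x)"
    using smooth_on_deriv(1)[OF assms(1,2) x] by (simp add: opD_def)
qed

lemma opD_eqI: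
  assumes "(f has_real_derivative x * d) (at x)" "x \<noteq> 0"
  shows "opD f x = d"
  using DERIV_imp_deriv[OF assms(1)] assms(2) by (simp add: opD_def)

lemma opD_pow_smooth:
  assumes "smooth_on S f" "open S" "S \<subseteq> {0<..}"
  shows "smooth_on S ((opD ^^ j) f)"
  using assms by (induction j) (auto intro: opD_smooth(1))

lemma opD_pow_linear:
  assumes f: "smooth_on S f" and g: "smooth_on S g" and S: "open S" "S \<subseteq> {0<..}" and x: "x \<in> S"
  shows "(opD ^^ j) (\<lambda>x. a * f x + b * g x) x = a * (opD ^^ j) f x + b * (opD ^^ j) g x"
  using x
proof (induction j arbitrary: x)
  case (Suc j)
  have "opD ((opD ^^ j) (\<lambda>x. a * f x + b * g x)) x = opD (\<lambda>x. a * (opD ^^ j) f x + b * (opD ^^ j) g x) x"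
    using Suc.IH Suc.prems by (intro opD_cong[OF S(1)])
  also have "\<dots> = a * opD ((opD ^^ j) f) x + b * opD ((opD ^^ j) g) x"
  proof (rule opD_eqI)
    have df: "((opD ^^ j) f has_real_derivative x * opD ((opD ^^ j) f) x) (at x)"
      by (rule opD_smooth(2)[OF opD_pow_smooth[OF f S] S Suc.prems])
    have dg: "((opD ^^ j) g has_real_derivative x * opD ((opD ^^ j) g) x) (at x)"
      by (rule opD_smooth(2)[OF opD_pow_smooth[OF g S] S Suc.prems])
    show "((\<lambda>x. a * (opD ^^ j) f x + b * (opD ^^ j) g x) has_real_derivative
       x * (a * opD ((opD ^^ j) f) x + b * opD ((opD ^^ j) g) x)) (at x)"
      by (rule DERIV_cong[OF DERIV_add[OF DERIV_cmult[OF df] DERIV_cmult[OF dg]]]) (simp add: algebra_simps)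
    show "x \<noteq> 0" using Suc.prems S by auto
  qed
  finally show ?case by simp
qed simp

text \<open>D is a derivation with D(x^2) = 2, so the Leibniz formula stops after two terms. For j =
  0 the truncated index \<open>j - 1\<close> is harmless because of the factor j.\<close>

lemma opD_pow_square_mult:
  assumes f: "smooth_on S f" and S: "open S" "S \<subseteq> {0<..}" and x: "x \<in> S"
  shows "(opD ^^ j) (\<lambda>x. x\<^sup>2 * f x) x = x\<^sup>2 * (opD ^^ j) f x + 2 * real j * (opD ^^ (j - 1)) f x"
  using x
proof (induction j arbitrary: x)
  case (Suc j)
  have "opD ((opD ^^ j) (\<lambda>x. x\<^sup>2 * f x)) x = opD (\<lambda>x. x\<^sup>2 * (opD ^^ j) f x + 2 * real j * (opD ^^ (j - 1)) f x) x"
    using Suc.IH Suc.prems by (intro opD_cong[OF S(1)])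
  also have "\<dots> = x\<^sup>2 * opD ((opD ^^ j) f) x + 2 * real (Suc j) * (opD ^^ j) f x"
  proof (rule opD_eqI)
    have d: "((opD ^^ i) f has_real_derivative x * opD ((opD ^^ i) f) x) (at x)" for i
      by (rule opD_smooth(2)[OF opD_pow_smooth[OF f S] S Suc.prems])
    have p: "((\<lambda>x. x\<^sup>2) has_real_derivative 2 * x) (at x)" by (auto intro!: derivative_eq_intros)
    have j: "real j * opD ((opD ^^ (j - 1)) f) x = real j * (opD ^^ j) f x" by (cases j) auto
    show "((\<lambda>x. x\<^sup>2 * (opD ^^ j) f x + 2 * real j * (opD ^^ (j - 1)) f x) has_real_derivative
       x * (x\<^sup>2 * opD ((opD ^^ j) f) x + 2 * real (Suc j) * (opD ^^ j) f x)) (at x)"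
    proof (rule DERIV_cong[OF DERIV_add[OF DERIV_mult[OF p d] DERIV_cmult[OF d]]])
      have "2 * real j * (x * opD ((opD ^^ (j - 1)) f) x) = 2 * x * (real j * (opD ^^ j) f x)"
        unfolding j[symmetric] by simp
      then show "2 * x * (opD ^^ j) f x + x * opD ((opD ^^ j) f) x * x\<^sup>2 + 2 * real j * (x * opD ((opD ^^ (j - 1)) f) x) =
        x * (x\<^sup>2 * opD ((opD ^^ j) f) x + 2 * real (Suc j) * (opD ^^ j) f x)"
        by (simp only: of_nat_Suc) (simp add: algebra_simps)
    qed
    show "x \<noteq> 0" using Suc.prems S by auto
  qed
  finally show ?case by simp
qed simp

lemma opD_pow_zero_imp:
  assumes f: "smooth_on {0<..<1} f" and b: "0 < b" "b < 1" and z: "\<And>t. b < t \<Longrightarrow> t < 1 \<Longrightarrow> f t = 0"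
    and D: "\<And>t. 0 < t \<Longrightarrow> t < 1 \<Longrightarrow> (opD ^^ j) f t = 0" and t: "0 < t" "t < 1"
  shows "f t = 0"
  using f z D t
proof (induction j arbitrary: f t)
  case (Suc j)
  have S: "open {0<..<1::real}" "{0<..<1::real} \<subseteq> {0<..}" by auto
  have "opD f s = 0" if "b < s" "s < 1" for s
  proof -
    have "opD f s = opD (\<lambda>_. 0) s"
      using Suc.prems(2) that by (intro opD_cong[of "{b<..<1}"]) auto
    then show ?thesis by (simp add: opD_def)
  qed
  moreover have "(opD ^^ j) (opD f) s = 0" if "0 < s" "s < 1" for s
    using Suc.prems(3)[OF that] by (simp only: funpow_Suc_right o_def)
  ultimately have D0: "opD f s = 0" if "0 < s" "s < 1" for s
    using Suc.IH[OF opD_smooth(1)[OF Suc.prems(1) S] _ _ that] by blast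
  \<comment> \<open>A point to the right of t inside the region where f is known to vanish; it fixes
    the constant of integration.\<close>
  define c where "c = (max t b + 1) / 2"
  have c: "t < c" "b < c" "c < 1" using Suc.prems(5) b by (auto simp: c_def max_def)
  have "f t = f c"
  proof (rule DERIV_isconst_end[symmetric, OF c(1)])
    have der: "(f has_real_derivative 0) (at s)" if "0 < s" "s < 1" for s
      using opD_smooth(2)[OF Suc.prems(1) S, of s] D0[OF that] that by simp
    show "continuous_on {t..c} f"
    proof (intro continuous_at_imp_continuous_on ballI)
      fix s assume "s \<in> {t..c}"
      then have "0 < s" "s < 1" using Suc.prems(4) c by auto
      then show "isCont f s" by (rule DERIV_isCont[OF der])
    qed
    show "(f has_real_derivative 0) (at s)" if "t < s" "s < c" for s
      using der that Suc.prems(4) c by auto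
  qed
  then show ?case using Suc.prems(2)[OF c(2,3)] by simp
qed simp

section \<open>Derivatives of the moments of integer exponent\<close>

text \<open>The integrand is controlled only inside the open interval, so near t the tail is written
  as a constant minus an integral from a base point a < t, to which the fundamental theorem
  applies.\<close>

lemma tail_integral_deriv:
  assumes I: "\<And>t. 0 < t \<Longrightarrow> t < 1 \<Longrightarrow> has_bochner_integral lborel (\<lambda>\<tau>. indicator {t<..<1} \<tau> * \<phi> \<tau>) (\<Phi> t)"
    and c: "continuous_on {0<..<1} \<phi>" and t: "0 < t" "t < 1"
  shows "(\<Phi> has_real_derivative - \<phi> t) (at t)"
proof -
  define a b where "a = t / 2" and "b = (t + 1) / 2"
  have ab: "0 < a" "a < t" "t < b" "b < 1" using t by (auto simp: a_def b_def)
  have eq: "\<Phi> s = \<Phi> a - integral {a..s} \<phi>" if s: "s \<in> {a..b}" for s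
  proof -
    have "0 < s" "s < 1" "a < 1" using s ab by auto
    have "has_bochner_integral lborel (\<lambda>\<tau>. indicator {a<..<1} \<tau> * \<phi> \<tau> - indicator {s<..<1} \<tau> * \<phi> \<tau>) (\<Phi> a - \<Phi> s)"
      using I[of a] I[of s] ab \<open>0 < s\<close> \<open>s < 1\<close> by (intro has_bochner_integral_diff) auto
    moreover have "indicator {a<..<1} \<tau> * \<phi> \<tau> - indicator {s<..<1} \<tau> * \<phi> \<tau> = indicator {a<..s} \<tau> *\<^sub>R \<phi> \<tau>" for \<tau>
      using s \<open>s < 1\<close> by (auto simp: indicator_def)
    ultimately have hb: "has_bochner_integral lborel (\<lambda>\<tau>. indicator {a<..s} \<tau> *\<^sub>R \<phi> \<tau>) (\<Phi> a - \<Phi> s)"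
      by simp
    then have "set_integrable lborel {a<..s} \<phi>" by (auto simp: set_integrable_def has_bochner_integral_iff)
    from set_borel_integral_eq_integral(2)[OF this]
    have "integral {a<..s} \<phi> = \<Phi> a - \<Phi> s"
      using hb by (simp add: set_lebesgue_integral_def has_bochner_integral_iff)
    moreover have "integral {a<..s} \<phi> = integral {a..s} \<phi>"
    proof (rule integral_subset_negligible)
      have "{a..s} - {a<..s} \<subseteq> {a}" by auto
      then show "negligible ({a..s} - {a<..s})" by (rule negligible_subset[rotated]) simp
    qed auto
    ultimately show ?thesis by linarith
  qed
  have "continuous_on {a..b} \<phi>" using ab by (intro continuous_on_subset[OF c]) auto
  then have "((\<lambda>s. integral {a..s} \<phi>) has_real_derivative \<phi> t) (at t within {a..b})"
    using ab by (intro integral_has_real_derivative) auto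
  then have "((\<lambda>s. integral {a..s} \<phi>) has_real_derivative \<phi> t) (at t)"
    using ab at_within_interior[of t "{a..b}"] by simp
  then have "((\<lambda>s. \<Phi> a - integral {a..s} \<phi>) has_real_derivative - \<phi> t) (at t)"
    by (auto intro!: derivative_eq_intros)
  then show ?thesis
  proof (rule has_field_derivative_transform_within_open)
    show "\<Phi> a - integral {a..s} \<phi> = \<Phi> s" if "s \<in> {a<..<b}" for s using eq[of s] that by simp
  qed (use ab in auto)
qed

text \<open>For exponent 0 the kernel is just the sign, and u = 1 + \<tau> and u = 1 - \<tau> fold
  its two parts onto one interval.\<close>

lemma mom_0_tail:
  assumes g: "tame g" and t: "0 < t" "t < 1"
  shows "has_bochner_integral lborel (\<lambda>\<tau>. indicator {t<..<1} \<tau> * ((1 + \<tau>) * g (1 + \<tau>) - (1 - \<tau>) * g (1 - \<tau>))) (mom 0 g t)"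
proof -
  define q where "q u = u * g u" for u
  define A where "A \<tau> = indicator {t<..<1} \<tau> * q (1 + \<tau>)" for \<tau>
  define B where "B \<tau> = indicator {-1<..<-t} \<tau> * q (1 + \<tau>)" for \<tau>
  have int: "integrable lborel (\<lambda>u. u * g u * pker 0 t u)" by (rule mom_integrable) (use g t in auto)
  have K: "(1 + 1 * \<tau>) * g (1 + 1 * \<tau>) * pker 0 t (1 + 1 * \<tau>) = A \<tau> - B \<tau>" for \<tau>
  proof (cases "t < \<bar>\<tau>\<bar> \<and> -1 < \<tau> \<and> \<tau> < 1")
    case True
    then have "Pq (1 + \<tau>) t > 0" using t by (intro Pq_pos) auto
    then show ?thesis using True t by (auto simp: A_def B_def q_def pker_def indicator_def sgn_if)
  qed (use t in \<open>auto simp: A_def B_def pker_def indicator_def\<close>)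
  have iK: "integrable lborel (\<lambda>\<tau>. A \<tau> - B \<tau>)"
    using lborel_integrable_real_affine[OF int, of 1 1] unfolding K by simp
  have mK: "mom 0 g t = (\<integral>\<tau>. A \<tau> - B \<tau> \<partial>lborel)"
    unfolding mom_def using lborel_integral_real_affine[of 1 "\<lambda>u. u * g u * pker 0 t u" 1] unfolding K by simp
  have "A \<tau> = indicator {0<..} \<tau> *\<^sub>R (A \<tau> - B \<tau>)" "- B \<tau> = indicator {..<0} \<tau> *\<^sub>R (A \<tau> - B \<tau>)" for \<tau>
    using t by (auto simp: A_def B_def indicator_def)
  then have iA: "integrable lborel A" and iB': "integrable lborel (\<lambda>\<tau>. - B \<tau>)"
    using integrable_mult_indicator[OF _ iK, of "{0<..}"] integrable_mult_indicator[OF _ iK, of "{..<0}"]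
    by (simp_all cong: Bochner_Integration.integrable_cong)
  then have iB: "integrable lborel B" using integrable_minus[OF iB'] by simp
  have "has_bochner_integral lborel (\<lambda>\<tau>. B (0 + (-1) * \<tau>)) (\<integral>\<tau>. B \<tau> \<partial>lborel)"
    using lborel_integrable_real_affine[OF iB, of "-1" 0] lborel_integral_real_affine[of "-1" B 0]
    by (simp add: has_bochner_integral_iff)
  moreover have "has_bochner_integral lborel A (\<integral>\<tau>. A \<tau> \<partial>lborel)" using iA by (simp add: has_bochner_integral_iff)
  ultimately have "has_bochner_integral lborel (\<lambda>\<tau>. A \<tau> - B (0 + (-1) * \<tau>)) (mom 0 g t)"
    unfolding mK Bochner_Integration.integral_diff[OF iA iB] by (intro has_bochner_integral_diff)
  moreover have "A \<tau> - B (0 + (-1) * \<tau>) = indicator {t<..<1} \<tau> * ((1 + \<tau>) * g (1 + \<tau>) - (1 - \<tau>) * g (1 - \<tau>))" for \<tau>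
    by (auto simp: A_def B_def q_def indicator_def)
  ultimately show ?thesis by simp
qed

lemma mom_deriv_zero:
  assumes g: "tame g" and t: "0 < t" "t < 1"
  shows "(mom 0 g has_real_derivative - ((1 + t) * g (1 + t) - (1 - t) * g (1 - t))) (at t)"
proof (rule tail_integral_deriv[OF mom_0_tail[OF g] _ t])
  have c: "continuous_on UNIV g" using g by (simp add: tame_def)
  show "continuous_on {0<..<1} (\<lambda>t. (1 + t) * g (1 + t) - (1 - t) * g (1 - t))"
    by (intro continuous_intros continuous_on_compose2[OF c]) auto
qed

text \<open>\<open>mom_0_tail\<close> starts the induction and \<open>mom_raise\<close> continues
  it, since the functions considered are closed under multiplication by u^2. Divided by t, the
  derivative formula reads D mom_(k+1) g = -4 (k + 1) ((1 - t^2) mom_k g + mom_k (u^2 g)).\<close>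

lemma mom_smooth:
  assumes "tame g" "smooth_on UNIV g"
  shows "smooth_on {0<..<1} (mom (real k) g)"
    and "0 < t \<Longrightarrow> t < 1 \<Longrightarrow> (mom (real (Suc k)) g has_real_derivative
      - (4 * (real k + 1) * t * ((1 - t\<^sup>2) * mom (real k) g t + mom (real k) (\<lambda>u. u\<^sup>2 * g u) t))) (at t)"
proof -
  have I: "open {0<..<1::real}" by simp
  have rsm: "smooth_on S (\<lambda>t. t)" for S using smooth_on_power[of S 1] by simp
  have sq: "tame (\<lambda>u. u\<^sup>2 * g u) \<and> smooth_on UNIV (\<lambda>u. u\<^sup>2 * g u)" if "tame g" "smooth_on UNIV g" for g
    using that by (intro conjI tame_mult smooth_on_mult smooth_on_power continuous_intros)
  have der: "(mom (real (Suc k)) g has_real_derivative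
      - (4 * (real k + 1) * t * ((1 - t\<^sup>2) * mom (real k) g t + mom (real k) (\<lambda>u. u\<^sup>2 * g u) t))) (at t)"
    if g: "tame g" and c: "continuous_on {0<..<1} (mom (real k) g)" "continuous_on {0<..<1} (mom (real k) (\<lambda>u. u\<^sup>2 * g u))"
      and t: "0 < t" "t < 1" for g k t
  proof (rule tail_integral_deriv[OF _ _ t])
    fix t :: real assume "0 < t" "t < 1"
    then show "has_bochner_integral lborel (\<lambda>\<tau>. indicator {t<..<1} \<tau> * (4 * (real k + 1) * \<tau> * ((1 - \<tau>\<^sup>2) * mom (real k) g \<tau> + mom (real k) (\<lambda>u. u\<^sup>2 * g u) \<tau>))) (mom (real (Suc k)) g t)"
      using mom_raise[of "real k" t g] g by (simp add: add.commute)
  next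
    show "continuous_on {0<..<1} (\<lambda>\<tau>. 4 * (real k + 1) * \<tau> * ((1 - \<tau>\<^sup>2) * mom (real k) g \<tau> + mom (real k) (\<lambda>u. u\<^sup>2 * g u) \<tau>))"
      by (intro continuous_intros c)
  qed
  have sm: "smooth_on {0<..<1} (mom (real k) g)" if "tame g" "smooth_on UNIV g" for g k
    using that
  proof (induction k arbitrary: g)
    case 0
    have aff: "smooth_on {0<..<1} (\<lambda>t. g (1 + b * t))" for b
      using Cder_affine[of _ g 1 b] 0(2) smooth_on_subset[of UNIV _ "{0<..<1}"] unfolding smooth_on_def by blast
    have "smooth_on {0<..<1} (\<lambda>t. (- 1 + - 1 * t) * g (1 + 1 * t) + (1 + - 1 * t) * g (1 + - 1 * t))"
      by (intro smooth_on_add smooth_on_mult smooth_on_const rsm aff)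
    then have "smooth_on {0<..<1} (\<lambda>t. - ((1 + t) * g (1 + t) - (1 - t) * g (1 - t)))"
      by (rule smooth_on_cong) (simp add: algebra_simps)
    then show ?case
      by (rule smooth_onI[OF I, rotated]) (use mom_deriv_zero[OF 0(1)] in auto)
  next
    case (Suc k)
    have s1: "smooth_on {0<..<1} (mom (real k) g)" and s2: "smooth_on {0<..<1} (mom (real k) (\<lambda>u. u\<^sup>2 * g u))"
      using Suc.IH Suc.prems sq[OF Suc.prems] by blast+
    have c: "continuous_on {0<..<1} (mom (real k) g)" "continuous_on {0<..<1} (mom (real k) (\<lambda>u. u\<^sup>2 * g u))"
      using s1 s2 Cder_continuous unfolding smooth_on_def by blast+
    have "smooth_on {0<..<1} (\<lambda>t. (- 4 * (real k + 1)) * (t * ((1 + - 1 * t ^ 2) * mom (real k) g t + mom (real k) (\<lambda>u. u\<^sup>2 * g u) t)))"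
      by (intro smooth_on_add smooth_on_mult smooth_on_const rsm smooth_on_power s1 s2)
    then have "smooth_on {0<..<1} (\<lambda>t. - (4 * (real k + 1) * t * ((1 - t\<^sup>2) * mom (real k) g t + mom (real k) (\<lambda>u. u\<^sup>2 * g u) t)))"
      by (rule smooth_on_cong) (simp add: algebra_simps)
    then show ?case
      by (rule smooth_onI[OF I, rotated]) (use der[OF Suc.prems(1) c] in \<open>simp only: greaterThanLessThan_iff\<close>)
  qed
  show "smooth_on {0<..<1} (mom (real k) g)" using assms by (rule sm)
  assume t: "0 < t" "t < 1"
  have "continuous_on {0<..<1} (mom (real k) g)" "continuous_on {0<..<1} (mom (real k) (\<lambda>u. u\<^sup>2 * g u))"
    using sm[OF assms] sm[of "\<lambda>u. u\<^sup>2 * g u"] sq[OF assms] Cder_continuous unfolding smooth_on_def by blast+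
  then show "(mom (real (Suc k)) g has_real_derivative
      - (4 * (real k + 1) * t * ((1 - t\<^sup>2) * mom (real k) g t + mom (real k) (\<lambda>u. u\<^sup>2 * g u) t))) (at t)"
    using der[OF assms(1) _ _ t] by blast
qed

section \<open>The endpoint terms\<close>

text \<open>Known as \<open>opL k H (1 - x) / x ^ (2 * k + 1)\<close>. A signed x covers both
  endpoints: x = t belongs to 1 - t, and x = -t to 1 + t, where the odd power supplies the minus
  sign.\<close>

definition endpoint_sum :: "nat \<Rightarrow> (real \<Rightarrow> real) \<Rightarrow> real \<Rightarrow> real" where
  "endpoint_sum k H x = (\<Sum>j\<le>k. acoef k j * (x ^ j * (opD ^^ j) H (1 - x))) / x ^ (2 * k + 1)"

text \<open>The result of applying (1 / x) d/dx to \<open>endpoint_sum\<close>, term by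
  term.\<close>

definition endpoint_deriv :: "nat \<Rightarrow> (real \<Rightarrow> real) \<Rightarrow> real \<Rightarrow> real" where
  "endpoint_deriv k H x = ((\<Sum>j\<le>k. acoef k j * (real j * (x ^ j * (opD ^^ j) H (1 - x)) -
      (1 - x) * (x ^ Suc j * (opD ^^ Suc j) H (1 - x)))) -
    (2 * real k + 1) * (\<Sum>j\<le>k. acoef k j * (x ^ j * (opD ^^ j) H (1 - x)))) / x ^ (2 * k + 3)"

lemma endpoint_sum_deriv:
  assumes H: "smooth_on {0<..<2} H" and x: "x \<noteq> 0" "\<bar>x\<bar> < 1"
  shows "(endpoint_sum k H has_real_derivative x * endpoint_deriv k H x) (at x)"
proof -
  have S: "open {0<..<2::real}" "{0<..<2::real} \<subseteq> {0<..}" by auto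
  define y where "y j = x ^ j * (opD ^^ j) H (1 - x)" for j
  have dA: "((\<lambda>x. (opD ^^ j) H (1 - x)) has_real_derivative (1 - x) * (opD ^^ Suc j) H (1 - x) * (- 1)) (at x)" for j
  proof (rule DERIV_chain2[where g = "\<lambda>x. 1 - x"])
    have "1 - x \<in> {0<..<2}" using x by auto
    from opD_smooth(2)[OF opD_pow_smooth[OF H S] S this]
    show "((opD ^^ j) H has_real_derivative (1 - x) * (opD ^^ Suc j) H (1 - x)) (at (1 - x))" by simp
  qed (auto intro!: derivative_eq_intros)
  define s' where "s' = (\<Sum>j\<le>k. acoef k j * (real j * y j - (1 - x) * y (Suc j))) / x"
  define s where "s = (\<Sum>j\<le>k. acoef k j * y j)"
  have dy: "((\<lambda>x. x ^ j * (opD ^^ j) H (1 - x)) has_real_derivative (real j * y j - (1 - x) * y (Suc j)) / x) (at x)" for j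
  proof (rule DERIV_cong[OF DERIV_mult[OF DERIV_pow dA]])
    define A B where "A = (opD ^^ j) H (1 - x)" and "B = (opD ^^ Suc j) H (1 - x)"
    have "real j * x ^ (j - Suc 0) * x = real j * x ^ j" by (cases j) auto
    then have "(real j * x ^ (j - Suc 0) * A - (1 - x) * B * x ^ j) * x = real j * (x ^ j * A) - (1 - x) * (x ^ Suc j * B)"
      by (simp add: algebra_simps)
    then have "real j * x ^ (j - Suc 0) * A + (1 - x) * B * - 1 * x ^ j =
        (real j * (x ^ j * A) - (1 - x) * (x ^ Suc j * B)) / x"
      using x(1) by (simp add: eq_divide_eq)
    then show "real j * x ^ (j - Suc 0) * (opD ^^ j) H (1 - x) + (1 - x) * (opD ^^ Suc j) H (1 - x) * - 1 * x ^ j =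
      (real j * y j - (1 - x) * y (Suc j)) / x"
      unfolding y_def A_def B_def .
  qed
  have ds: "((\<lambda>x. \<Sum>j\<le>k. acoef k j * (x ^ j * (opD ^^ j) H (1 - x))) has_real_derivative s') (at x)"
  proof -
    have "((\<lambda>x. \<Sum>j\<le>k. acoef k j * (x ^ j * (opD ^^ j) H (1 - x))) has_real_derivative
      (\<Sum>j\<le>k. acoef k j * ((real j * y j - (1 - x) * y (Suc j)) / x))) (at x)"
      by (intro DERIV_sum DERIV_cmult dy)
    then show ?thesis by (simp add: s'_def sum_divide_distrib)
  qed
  have dp: "((\<lambda>x. x ^ (2 * k + 1)) has_real_derivative (2 * real k + 1) * x ^ (2 * k)) (at x)"
    using DERIV_pow[of "2 * k + 1" x UNIV] by (simp add: add.commute)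
  have "(endpoint_sum k H has_real_derivative (s' * x ^ (2 * k + 1) - s * ((2 * real k + 1) * x ^ (2 * k))) /
      (x ^ (2 * k + 1) * x ^ (2 * k + 1))) (at x)"
    unfolding endpoint_sum_def[abs_def] s_def y_def
    by (rule DERIV_divide[OF ds dp]) (use x in simp)
  moreover have "(s' * x ^ (2 * k + 1) - s * ((2 * real k + 1) * x ^ (2 * k))) / (x ^ (2 * k + 1) * x ^ (2 * k + 1)) =
     x * ((x * s' - (2 * real k + 1) * s) / x ^ (2 * k + 3))"
    using x(1) by (simp add: field_simps power_add power3_eq_cube)
  moreover have "x * s' = (\<Sum>j\<le>k. acoef k j * (real j * y j - (1 - x) * y (Suc j)))"
    using x(1) by (simp add: s'_def)
  ultimately show ?thesis by (simp only: endpoint_deriv_def s_def y_def)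
qed

text \<open>The left side is what D^(2 k + 2) makes of the raising formula at one endpoint: 4 (k +
  1) is twice the order 2 k + 2, from \<open>opD_pow_square_mult\<close> applied to the factor t^2.
  After the powers of x are cleared it is \<open>recursion_identity\<close>.\<close>

lemma endpoint_step:
  assumes H: "smooth_on {0<..<2} H" and x: "x \<noteq> 0" "\<bar>x\<bar> < 1"
  defines "H2 \<equiv> \<lambda>u. u\<^sup>2 * H u"
  shows "(1 - x\<^sup>2) * endpoint_deriv k H x - 4 * (real k + 1) * endpoint_sum k H x + endpoint_deriv k H2 x =
    - 2 * endpoint_sum (Suc k) H2 x"
proof -
  have S: "open {0<..<2::real}" "{0<..<2::real} \<subseteq> {0<..}" by auto
  have u: "1 - x \<in> {0<..<2}" using x by auto
  define y where "y j = x ^ j * (opD ^^ j) H (1 - x)" for j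
  define Q where "Q j = (1 - x)\<^sup>2 * y j + 2 * real j * x * y (j - 1)" for j
  have Q: "x ^ j * (opD ^^ j) H2 (1 - x) = Q j" for j
  proof -
    have "(opD ^^ j) H2 (1 - x) = (1 - x)\<^sup>2 * (opD ^^ j) H (1 - x) + 2 * real j * (opD ^^ (j - 1)) H (1 - x)"
      unfolding H2_def by (rule opD_pow_square_mult[OF H S u])
    then show ?thesis unfolding Q_def y_def by (cases j) (simp_all add: algebra_simps del: funpow.simps)
  qed
  define a where "a = (\<Sum>j\<le>k. acoef k j * y j)"
  define a' where "a' = (\<Sum>j\<le>k. acoef k j * (real j * y j - (1 - x) * y (Suc j)))"
  define c where "c = (\<Sum>j\<le>k. acoef k j * Q j)"
  define c' where "c' = (\<Sum>j\<le>k. acoef k j * (real j * Q j - (1 - x) * Q (Suc j)))"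
  define e where "e = (\<Sum>j\<le>Suc k. acoef (Suc k) j * Q j)"
  have 1: "endpoint_deriv k H x = (a' - (2 * real k + 1) * a) / x ^ (2 * k + 3)"
    by (simp only: endpoint_deriv_def a'_def a_def y_def)
  have 2: "endpoint_deriv k H2 x = (c' - (2 * real k + 1) * c) / x ^ (2 * k + 3)"
    by (simp only: endpoint_deriv_def c'_def c_def Q)
  have 3: "endpoint_sum k H x = x\<^sup>2 * a / x ^ (2 * k + 3)"
    using x(1) by (simp add: endpoint_sum_def a_def y_def power_add power2_eq_square power3_eq_cube)
  have 4: "endpoint_sum (Suc k) H2 x = e / x ^ (2 * k + 3)"
  proof -
    have "2 * Suc k + 1 = 2 * k + 3" by simp
    then show ?thesis by (simp only: endpoint_sum_def e_def Q)
  qed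
  have "(1 - x\<^sup>2) * (a' - (2 * real k + 1) * a) - 4 * (real k + 1) * x\<^sup>2 * a + (c' - (2 * real k + 1) * c) = - 2 * e"
    unfolding a'_def a_def c'_def c_def e_def Q_def by (rule recursion_identity)
  then show ?thesis unfolding 1 2 3 4
    by (simp only: times_divide_eq_right diff_divide_distrib[symmetric] add_divide_distrib[symmetric] mult.assoc)
qed

lemma opD_pow_zero: "(opD ^^ j) (\<lambda>_. 0) = (\<lambda>_. 0)"
proof (induction j)
  case (Suc j)
  have "opD (\<lambda>_. 0) = (\<lambda>_. 0)" by (simp add: opD_def fun_eq_iff)
  then show ?case using Suc by simp
qed simp

lemma opD_endpoint_sum:
  assumes H: "smooth_on {0<..<2} H" and t: "0 < t" "t < 1"
  shows "opD (\<lambda>s. c * (endpoint_sum k H s + endpoint_sum k H (- s))) t = c * (endpoint_deriv k H t + endpoint_deriv k H (- t))"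
proof (rule opD_eqI)
  have d: "(endpoint_sum k H has_real_derivative x * endpoint_deriv k H x) (at x)" if "x = t \<or> x = - t" for x
    using that t by (intro endpoint_sum_deriv[OF H]) auto
  have "((\<lambda>s. endpoint_sum k H (- s)) has_real_derivative - t * endpoint_deriv k H (- t) * (- 1)) (at t)"
    by (rule DERIV_chain2[where g = uminus, OF d[OF disjI2[OF refl]]]) (auto intro!: derivative_eq_intros)
  then have "((\<lambda>s. c * (endpoint_sum k H s + endpoint_sum k H (- s))) has_real_derivative
      c * (t * endpoint_deriv k H t + - t * endpoint_deriv k H (- t) * (- 1))) (at t)"
    by (intro DERIV_cmult DERIV_add d) auto
  moreover have "c * (t * endpoint_deriv k H t + - t * endpoint_deriv k H (- t) * (- 1)) =
      t * (c * (endpoint_deriv k H t + endpoint_deriv k H (- t)))"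
    by (simp add: algebra_simps)
  ultimately show "((\<lambda>s. c * (endpoint_sum k H s + endpoint_sum k H (- s))) has_real_derivative
      t * (c * (endpoint_deriv k H t + endpoint_deriv k H (- t)))) (at t)" by (simp only:)
qed (use t in simp)

text \<open>Induction with the hypothesis used for both \<open>g\<close> and u^2 \<open>g\<close>.
  One D turns the moment of exponent k + 1 into moments of exponent k, and of the remaining 2 k + 2
  all but one are covered by the hypothesis. Each step contributes (-4 (k + 1)) (-2) = 8 (k + 1),
  whence \<open>8 ^ k * fact k\<close>.\<close>

lemma opD_pow_mom:
  assumes "tame g" "smooth_on UNIV g" "0 < t" "t < 1"
  shows "(opD ^^ (2 * k + 1)) (mom (real k) g) t = 8 ^ k * fact k *
    (endpoint_sum k (\<lambda>u. u ^ (2 * k + 1) * g u) t + endpoint_sum k (\<lambda>u. u ^ (2 * k + 1) * g u) (- t))"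
  using assms
proof (induction k arbitrary: g t)
  case 0
  have "opD (mom 0 g) t = ((1 - t) * g (1 - t) - (1 + t) * g (1 + t)) / t"
    by (rule opD_eqI) (use mom_deriv_zero[OF 0(1,3,4)] 0 in \<open>simp_all\<close>)
  then show ?case using 0 by (simp add: endpoint_sum_def acoef_def diff_divide_distrib)
next
  case (Suc k)
  note g = Suc.prems(1,2) and t = Suc.prems(3,4)
  let ?I = "{0<..<1::real}"
  have S: "open ?I" "?I \<subseteq> {0<..}" "t \<in> ?I" using t by auto
  define g2 where "g2 u = u\<^sup>2 * g u" for u
  define H where "H u = u ^ (2 * k + 1) * g u" for u
  define H2 where "H2 u = u\<^sup>2 * H u" for u
  define M where "M = mom (real k) g"
  define M2 where "M2 = mom (real k) g2"
  define c :: real where "c = 8 ^ k * fact k"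
  define a where "a = - 4 * (real k + 1)"
  define N where "N = 2 * k + 2"
  have g2: "tame g2" "smooth_on UNIV g2"
    unfolding g2_def[abs_def] using g by (auto intro!: tame_mult smooth_on_mult smooth_on_power continuous_intros)
  have H: "smooth_on {0<..<2} H" "smooth_on {0<..<2} H2"
    unfolding H_def[abs_def] H2_def[abs_def]
    by (intro smooth_on_mult smooth_on_power smooth_on_subset[OF g(2)] subset_UNIV)+
  have H2: "(\<lambda>u. u ^ (2 * k + 1) * g2 u) = H2"
    by (simp add: fun_eq_iff H2_def H_def g2_def algebra_simps)
  have H3: "(\<lambda>u. u ^ (2 * Suc k + 1) * g u) = H2"
    by (simp add: fun_eq_iff H2_def H_def power2_eq_square algebra_simps)
  have M: "smooth_on ?I M" "smooth_on ?I M2" unfolding M_def M2_def by (intro mom_smooth g g2)+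
  have I1: "(opD ^^ (2 * k + 1)) M s = c * (endpoint_sum k H s + endpoint_sum k H (- s))" if "s \<in> ?I" for s
    unfolding M_def H_def[abs_def] c_def using that by (intro Suc.IH g) auto
  have I2: "(opD ^^ (2 * k + 1)) M2 s = c * (endpoint_sum k H2 s + endpoint_sum k H2 (- s))" if "s \<in> ?I" for s
    unfolding M2_def H2[symmetric] c_def using that by (intro Suc.IH g2) auto
  have SN: "N = Suc (2 * k + 1)" by (simp add: N_def)
  have N1: "(opD ^^ N) M t = c * (endpoint_deriv k H t + endpoint_deriv k H (- t))"
    unfolding SN funpow.simps o_def using opD_cong[OF S(1) I1 S(3)] opD_endpoint_sum[OF H(1) t] by simp
  have N2: "(opD ^^ N) M2 t = c * (endpoint_deriv k H2 t + endpoint_deriv k H2 (- t))"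
    unfolding SN funpow.simps o_def using opD_cong[OF S(1) I2 S(3)] opD_endpoint_sum[OF H(2) t] by simp
  have raise: "opD (mom (real (Suc k)) g) s = a * M s + 1 * ((- a) * (s\<^sup>2 * M s) + a * M2 s)" if "s \<in> ?I" for s
  proof (rule opD_eqI)
    have "- (4 * (real k + 1) * s * ((1 - s\<^sup>2) * M s + M2 s)) = s * (a * M s + 1 * ((- a) * (s\<^sup>2 * M s) + a * M2 s))"
      by (simp add: a_def algebra_simps)
    then show "(mom (real (Suc k)) g has_real_derivative s * (a * M s + 1 * ((- a) * (s\<^sup>2 * M s) + a * M2 s))) (at s)"
      using mom_smooth(2)[OF g, of s k] that unfolding M_def M2_def g2_def[abs_def] by simp
  qed (use that in simp)
  have sq: "smooth_on ?I (\<lambda>s. s\<^sup>2 * M s)" by (intro smooth_on_mult smooth_on_power M)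
  have lin: "smooth_on ?I (\<lambda>s. (- a) * (s\<^sup>2 * M s) + a * M2 s)"
    by (intro smooth_on_add smooth_on_mult smooth_on_const smooth_on_power M)
  have "(opD ^^ (2 * Suc k + 1)) (mom (real (Suc k)) g) t = (opD ^^ N) (opD (mom (real (Suc k)) g)) t"
  proof -
    have "2 * Suc k + 1 = Suc N" by (simp add: N_def)
    then show ?thesis by (simp only: funpow_Suc_right o_def)
  qed
  also have "\<dots> = (opD ^^ N) (\<lambda>s. a * M s + 1 * ((- a) * (s\<^sup>2 * M s) + a * M2 s)) t"
    by (rule opD_pow_cong[OF S(1) raise S(3)])
  also have "\<dots> = a * (opD ^^ N) M t + 1 * ((- a) * (t\<^sup>2 * (opD ^^ N) M t + 2 * real N * (opD ^^ (N - 1)) M t) + a * (opD ^^ N) M2 t)"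
    by (simp only: opD_pow_linear[OF M(1) lin S] opD_pow_linear[OF sq M(2) S] opD_pow_square_mult[OF M(1) S])
  also have "(opD ^^ (N - 1)) M t = c * (endpoint_sum k H t + endpoint_sum k H (- t))"
    using I1[OF S(3)] by (simp only: SN diff_Suc_1)
  also have "a * (opD ^^ N) M t + 1 * ((- a) * (t\<^sup>2 * (opD ^^ N) M t +
        2 * real N * (c * (endpoint_sum k H t + endpoint_sum k H (- t)))) + a * (opD ^^ N) M2 t) =
      a * c * (((1 - t\<^sup>2) * endpoint_deriv k H t - 4 * (real k + 1) * endpoint_sum k H t + endpoint_deriv k H2 t) +
        ((1 - (- t)\<^sup>2) * endpoint_deriv k H (- t) - 4 * (real k + 1) * endpoint_sum k H (- t) + endpoint_deriv k H2 (- t)))"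
    unfolding N1 N2 by (simp add: N_def algebra_simps)
  also have "\<dots> = a * c * (- 2 * endpoint_sum (Suc k) H2 t + - 2 * endpoint_sum (Suc k) H2 (- t))"
  proof -
    have *: "(1 - x\<^sup>2) * endpoint_deriv k H x - 4 * (real k + 1) * endpoint_sum k H x + endpoint_deriv k H2 x =
        - 2 * endpoint_sum (Suc k) H2 x" if "x = t \<or> x = - t" for x
      unfolding H2_def[abs_def] by (rule endpoint_step[OF H(1)]) (use that t in auto)
    show ?thesis by (simp only: *[OF disjI1[OF refl]] *[OF disjI2[OF refl]])
  qed
  also have "\<dots> = 8 ^ Suc k * fact (Suc k) * (endpoint_sum (Suc k) H2 t + endpoint_sum (Suc k) H2 (- t))"
    by (simp add: a_def c_def algebra_simps)
  finally show ?case unfolding H3 .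
qed

lemma endpoint_sum_opL:
  assumes "t \<noteq> 0"
  shows "endpoint_sum k H t + endpoint_sum k H (- t) = (opL k H (1 - t) - opL k H (1 + t)) / t ^ (2 * k + 1)"
  using assms by (simp add: endpoint_sum_def opL_altdef mult.assoc diff_divide_distrib)

lemma opL_symmetric_iff_mom:
  fixes k :: nat
  assumes g: "test_function_on {0<..<2} g"
  defines "h \<equiv> \<lambda>t. t ^ (2 * k + 1) * g t"
  shows "(\<forall>t\<in>{0..1}. opL k h (1 - t) = opL k h (1 + t)) \<longleftrightarrow> (\<forall>t. 0 < t \<and> t < 1 \<longrightarrow> mom (real k) g t = 0)"
proof -
  have tame: "tame g" by (rule test_function_tame[OF g])
  have smooth: "smooth_on UNIV g"
    using g C_k_imp_Cder unfolding test_function_on_def smooth_def smooth_on_def by blast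
  obtain \<epsilon> where \<epsilon>: "\<epsilon> > 0" "\<And>u. g u \<noteq> 0 \<Longrightarrow> \<epsilon> \<le> u \<and> u \<le> 2 - \<epsilon>"
    using tame unfolding tame_def by blast
  have D: "(opD ^^ (2 * k + 1)) (mom (real k) g) t = 8 ^ k * fact k * ((opL k h (1 - t) - opL k h (1 + t)) / t ^ (2 * k + 1))"
    if "0 < t" "t < 1" for t
    unfolding opD_pow_mom[OF tame smooth that] h_def using that by (subst endpoint_sum_opL) auto
  have zero: "(opD ^^ j) f x = 0" if "open S" "x \<in> S" "\<And>y. y \<in> S \<Longrightarrow> f y = 0" for S f x j
    using opD_pow_cong[OF that(1), of f "\<lambda>_. 0"] that(2,3) by (simp add: opD_pow_zero)
  show ?thesis
  proof (intro iffI allI impI ballI)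
    fix t :: real assume sym: "\<forall>t\<in>{0..1}. opL k h (1 - t) = opL k h (1 + t)" and t: "0 < t \<and> t < 1"
    \<comment> \<open>For t beyond this b the support of g lies in |u - 1| < t, so the moment
      vanishes there and D can be undone step by step; the minimum keeps b positive.\<close>
    show "mom (real k) g t = 0"
    proof (rule opD_pow_zero_imp[where f = "mom (real k) g" and b = "1 - min \<epsilon> (1 / 2)" and j = "2 * k + 1"])
      show "smooth_on {0<..<1} (mom (real k) g)" by (rule mom_smooth[OF tame smooth])
      show "mom (real k) g s = 0" if "1 - min \<epsilon> (1 / 2) < s" "s < 1" for s
      proof -
        have "u * g u * pker (real k) s u = 0" for u
          using that \<epsilon>(2)[of u] by (auto simp: pker_def)
        then show ?thesis unfolding mom_def by (simp only: Bochner_Integration.integral_zero)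
      qed
      show "(opD ^^ (2 * k + 1)) (mom (real k) g) s = 0" if "0 < s" "s < 1" for s
        unfolding D[OF that] using sym that by simp
    qed (use t \<epsilon> in auto)
  next
    fix t :: real assume m: "\<forall>t. 0 < t \<and> t < 1 \<longrightarrow> mom (real k) g t = 0" and t: "t \<in> {0..1}"
    \<comment> \<open>The formula for the powers of D holds for 0 < t < 1. At t = 0 both sides
      coincide, and at t = 1 the operators are evaluated at 0 and 2, near which h vanishes.\<close>
    then consider "t = 0" | "0 < t" "t < 1" | "t = 1" by fastforce
    then show "opL k h (1 - t) = opL k h (1 + t)"
    proof cases
      case 2
      have "(opD ^^ (2 * k + 1)) (mom (real k) g) t = 0"
        using m 2 by (intro zero[of "{0<..<1}"]) auto
      then show ?thesis unfolding D[OF 2] using 2 by simp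
    next
      case 3
      have "(opD ^^ j) h 0 = 0" for j
        using \<epsilon> by (intro zero[of "{..<\<epsilon>}"]) (force simp: h_def)+
      moreover have "(opD ^^ j) h 2 = 0" for j
        using \<epsilon> by (intro zero[of "{2 - \<epsilon><..}"]) (force simp: h_def)+
      ultimately show ?thesis using 3 by (simp add: opL_altdef)
    qed simp
  qed
qed

theorem theorem3p1:
  shows "(\<forall>(n::nat) (k::nat) (\<alpha>::real) (g::real \<Rightarrow> real) (h::real \<Rightarrow> real).
      n \<ge> 3 \<and> odd n \<and> k = (n - 3) div 2 \<and> \<alpha> = (real n - 2) / 2 \<and>
      test_function_on {0<..<2} g \<and> h = (\<lambda>t. t ^ (n - 2) * g t) \<longrightarrow>
      ((\<forall>t\<in>{0..1}. opL k h (1 - t) = opL k h (1 + t)) \<longleftrightarrow> integral_identity \<alpha> h)) \<and>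
    (\<forall>(n::nat) (\<alpha>::real) (g::real \<Rightarrow> real) (h::real \<Rightarrow> real).
      n = CARD('n::finite) \<and> n \<ge> 2 \<and> \<alpha> = (real n - 2) / 2 \<and>
      test_function_on {0<..<2} g \<and> h = (\<lambda>t. t ^ (n - 2) * g t) \<longrightarrow>
      ((\<exists>f :: real ^ 'n \<Rightarrow> real. test_function_on (ball 0 1) f \<and> radial f \<and>
          (\<forall>p\<in>sphere 0 1. \<forall>t\<in>{0<..<2}. spherical_mean f p t = g t)) \<longleftrightarrow>
        integral_identity \<alpha> h))"
proof (intro conjI allI impI; elim conjE)
  fix n k :: nat and \<alpha> :: real and g h :: "real \<Rightarrow> real"
  assume n: "n \<ge> 3" "odd n" and k: "k = (n - 3) div 2" and \<alpha>: "\<alpha> = (real n - 2) / 2"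
    and g: "test_function_on {0<..<2} g" and h: "h = (\<lambda>t. t ^ (n - 2) * g t)"
  have nk: "n = 2 * k + 3" using n k by presburger
  then have "n - 2 = 2 * k + 1" by simp
  then have "h = (\<lambda>t. t ^ (2 * k + 1) * g t)" using h by (simp only:)
  then have "(\<forall>t\<in>{0..1}. opL k h (1 - t) = opL k h (1 + t)) \<longleftrightarrow> (\<forall>t. 0 < t \<and> t < 1 \<longrightarrow> mom (real k) g t = 0)"
    using opL_symmetric_iff_mom[OF g, of k] by (simp only:)
  also have "real k = (real n - 3) / 2" using nk by simp
  finally show "(\<forall>t\<in>{0..1}. opL k h (1 - t) = opL k h (1 + t)) \<longleftrightarrow> integral_identity \<alpha> h"
    using integral_identity_iff_mom[OF _ test_function_tame[OF g] \<alpha> h] n by simp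
next
  fix n :: nat and \<alpha> :: real and g h :: "real \<Rightarrow> real"
  assume n: "n = CARD('n)" "n \<ge> 2" and \<alpha>: "\<alpha> = (real n - 2) / 2"
    and g: "test_function_on {0<..<2} g" and h: "h = (\<lambda>t. t ^ (n - 2) * g t)"
  note tame = test_function_tame[OF g]
  have n2: "CARD('n) \<ge> 2" using n by simp
  show "(\<exists>f :: real ^ 'n \<Rightarrow> real. test_function_on (ball 0 1) f \<and> radial f \<and>
      (\<forall>p\<in>sphere 0 1. \<forall>t\<in>{0<..<2}. spherical_mean f p t = g t)) \<longleftrightarrow> integral_identity \<alpha> h"
    unfolding integral_identity_iff_mom[OF n(2) tame \<alpha> h] n(1)
  proof (intro iffI allI impI; (elim exE conjE)?)
    fix f :: "real ^ 'n \<Rightarrow> real" and t :: real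
    assume f: "test_function_on (ball 0 1) f" "radial f"
      and mean: "\<forall>p\<in>sphere 0 1. \<forall>t\<in>{0<..<2}. spherical_mean f p t = g t" and t: "0 < t" "t < 1"
    show "mom ((real CARD('n) - 3) / 2) g t = 0"
      by (rule range_imp_mom_zero[OF n2 f tame _ t]) (use mean in auto)
  next
    assume "\<forall>t. 0 < t \<and> t < 1 \<longrightarrow> mom ((real CARD('n) - 3) / 2) g t = 0"
    then show "\<exists>f :: real ^ 'n \<Rightarrow> real. test_function_on (ball 0 1) f \<and> radial f \<and>
      (\<forall>p\<in>sphere 0 1. \<forall>t\<in>{0<..<2}. spherical_mean f p t = g t)"
      by (intro mom_zero_imp_range[OF n2 g]) auto
  qed
qed

end
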